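(* Let $a>0$, $\Omega_a=[0,2\pi/a]\times[0,2\pi]$, $\psi^*(x_1,x_2)=\cos x_2$, and let $\kappa\ge \frac1a$. Let $\psi\in C^2_{\rm per}(\Omega_a)$ satisfy $$\|\nabla^2\psi-\nabla^2\psi^*\|_{C^0}<\frac{\kappa^2}{4}\qquad\text{and}\qquad \|\nabla^2\psi-\nabla^2\psi^*\|_{C^0}\le\frac12 ,$$ and suppose that $\psi$ is a solution of either the Lagrangian formulation problem $$-\Delta\psi(\mathbf x)=\kappa\int_0^\infty e^{-\kappa s}\,\psi^*(\mathbf y(\mathbf x,s))\,ds,$$ where $\mathbf y$ is the trajectory map of $\psi$, or the steady-state Euler formulation problem $$(\nabla\times\psi)\cdot\nabla(\Delta\psi)=-\kappa\,\Delta(\psi-\psi^* ).$$ Then $\psi$ is regular, i.e. $\Delta\psi\in C^1_{\rm per}(\Omega_a)$, and $\psi=\psi^*$.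
   Context: Notation: $\nabla\times\psi=(-\partial_{x_2}\psi,\ \partial_{x_1}\psi)$. $C^{k}_{\rm per}(\Omega_a)$ is the space of $C^k$ functions $\phi$ on $\mathbb R^2$ that are $2\pi/a$-periodic in $x_1$, $2\pi$-periodic in $x_2$, and satisfy $\int_{\Omega_a}\phi\,dx_1dx_2=0$. $\|\cdot\|_{C^0}$ is the maximum over $\Omega_a$ of the Euclidean norm; for the matrix $\nabla^2\psi$ of second derivatives this is the maximum of the Frobenius norm. For $\psi\in C^2_{\rm per}(\Omega_a)$ the trajectory map $\mathbf y(\mathbf x,t)$, $t\ge0$, is the solution of $$-\frac{\partial}{\partial t}\mathbf y(\mathbf x,t)=(\nabla\times\psi)(\mathbf y(\mathbf x,t)),\quad t>0,\qquad \mathbf y(\mathbf x,0)=\mathbf x .$$ Since $\psi$ is only assumed to be $C^2$, the Euler formulation equation is understood in the sense of distributions, with $(\nabla\times\psi)\cdot\nabla(\Delta\psi)$ read as $\nabla\cdot\big((\nabla\times\psi)\,\Delta\psi\big)$ (note that $\nabla\times\psi$ is divergence free). *)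

theory Defs
  imports "HOL-Analysis.Analysis"
begin

section \<open>Differential operators on the plane\<close>

definition partial :: "2 \<Rightarrow> (real^2 \<Rightarrow> real) \<Rightarrow> real^2 \<Rightarrow> real" where
  "partial i f x = frechet_derivative f (at x) (axis i 1)"

definition grad :: "(real^2 \<Rightarrow> real) \<Rightarrow> real^2 \<Rightarrow> real^2" where
  "grad f x = (\<chi> i. partial i f x)"

definition curl :: "(real^2 \<Rightarrow> real) \<Rightarrow> real^2 \<Rightarrow> real^2" where
  "curl f x = vector [- partial 2 f x, partial 1 f x]"

definition hessian :: "(real^2 \<Rightarrow> real) \<Rightarrow> real^2 \<Rightarrow> real^2^2" where
  "hessian f x = (\<chi> i j. partial i (partial j f) x)"

definition laplacian :: "(real^2 \<Rightarrow> real) \<Rightarrow> real^2 \<Rightarrow> real" where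
  "laplacian f x = partial 1 (partial 1 f) x + partial 2 (partial 2 f) x"

section \<open>Function spaces\<close>

primrec Ck :: "nat \<Rightarrow> (real^2 \<Rightarrow> real) \<Rightarrow> bool" where
  "Ck 0 f \<longleftrightarrow> continuous_on UNIV f"
| "Ck (Suc k) f \<longleftrightarrow> (\<forall>x. f differentiable (at x)) \<and> (\<forall>i. Ck k (partial i f))"

definition Omega :: "real \<Rightarrow> (real^2) set" where
  "Omega a = {x. 0 \<le> x $ 1 \<and> x $ 1 \<le> 2 * pi / a \<and> 0 \<le> x $ 2 \<and> x $ 2 \<le> 2 * pi}"

definition C_per :: "nat \<Rightarrow> real \<Rightarrow> (real^2 \<Rightarrow> real) set" where
  "C_per k a = {f. Ck k f
     \<and> (\<forall>x. f (x + vector [2 * pi / a, 0]) = f x)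
     \<and> (\<forall>x. f (x + vector [0, 2 * pi]) = f x)
     \<and> integral (Omega a) f = 0}"

text \<open>For continuous \<open>F\<close> the supremum over the compact set \<open>Omega a\<close> is a maximum.
  The library norm on \<open>real^2^2\<close> is the Frobenius norm.\<close>
definition C0_norm :: "real \<Rightarrow> (real^2 \<Rightarrow> 'b::real_normed_vector) \<Rightarrow> real" where
  "C0_norm a F = (SUP x\<in>Omega a. norm (F x))"

text \<open>Smooth compactly supported test functions, for distributions on the plane.\<close>
definition test_function :: "(real^2 \<Rightarrow> real) \<Rightarrow> bool" where
  "test_function \<phi> \<longleftrightarrow> (\<forall>k. Ck k \<phi>) \<and> compact (closure {x. \<phi> x \<noteq> 0})"

section \<open>The two formulations\<close>

definition psi_star :: "real^2 \<Rightarrow> real" where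
  "psi_star x = cos (x $ 2)"

text \<open>The differential equation is imposed for \<open>t > 0\<close> only; continuity on \<open>{0..}\<close>
  ties the solution to its initial value.  Values of \<open>y x t\<close> at \<open>t < 0\<close> are irrelevant.\<close>
definition trajectory_map :: "(real^2 \<Rightarrow> real) \<Rightarrow> (real^2 \<Rightarrow> real \<Rightarrow> real^2) \<Rightarrow> bool" where
  "trajectory_map \<psi> y \<longleftrightarrow>
     (\<forall>x. y x 0 = x \<and> continuous_on {0..} (y x)
        \<and> (\<forall>t>0. (y x has_vector_derivative - curl \<psi> (y x t)) (at t)))"

text \<open>For \<open>\<psi> \<in> C_per 2 a\<close> with \<open>a > 0\<close> the field \<open>curl \<psi>\<close> is bounded and Lipschitz, so a
  trajectory map exists and is unique for \<open>t \<ge> 0\<close>; the existential quantifier picks it out.\<close>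
definition lagrangian_solution :: "real \<Rightarrow> (real^2 \<Rightarrow> real) \<Rightarrow> bool" where
  "lagrangian_solution \<kappa> \<psi> \<longleftrightarrow>
     (\<exists>y. trajectory_map \<psi> y
        \<and> (\<forall>x. - laplacian \<psi> x = \<kappa> * integral {0..} (\<lambda>s. exp (- \<kappa> * s) * psi_star (y x s))))"

text \<open>The identity \<open>div (laplacian \<psi> * curl \<psi>) = - \<kappa> * laplacian (\<psi> - psi_star)\<close> in the sense of
  distributions: the divergence is moved onto the test function, while the right-hand side
  is a continuous function when \<open>\<psi>\<close> is of class \<open>C\<^sup>2\<close>.\<close>
definition euler_solution :: "real \<Rightarrow> (real^2 \<Rightarrow> real) \<Rightarrow> bool" where
  "euler_solution \<kappa> \<psi> \<longleftrightarrow>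
     (\<forall>\<phi>. test_function \<phi> \<longrightarrow>
        - integral UNIV (\<lambda>x. (laplacian \<psi> x *\<^sub>R curl \<psi> x) \<bullet> grad \<phi> x)
        = integral UNIV (\<lambda>x. - \<kappa> * laplacian (\<lambda>z. \<psi> z - psi_star z) x * \<phi> x))"

end

theory Submission
  imports Defs
begin

text \<open>Write \<open>L = laplacian \<psi>\<close> and \<open>u = L + cos x\<^sub>2\<close>, the Laplacian of \<open>\<phi> = \<psi> - \<psi>\<^sup>*\<close>. The flow of
  \<open>- curl \<psi>\<close> preserves area, so a Lagrangian solution solves the Euler equation weakly. Testing that
  equation with mollified \<open>L\<close> (the commutator vanishes in the limit because \<open>curl \<psi>\<close> is \<open>C\<^sup>1\<close> and divergence
  free) and with \<open>cos x\<^sub>2\<close> gives \<open>\<kappa> \<integral> u\<^sup>2 = - \<integral> u sin x\<^sub>2 \<partial>\<^sub>1\<phi>\<close>, hence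
  \<open>\<kappa>\<^sup>2 \<integral> u\<^sup>2 \<le> \<integral> (sin x\<^sub>2 \<partial>\<^sub>1\<phi>)\<^sup>2\<close>. The inequality of Wirtinger in \<open>x\<^sub>1\<close> gives
  \<open>a\<^sup>2 \<integral> (\<partial>\<^sub>1\<phi>)\<^sup>2 \<le> \<integral> u\<^sup>2\<close>; since \<open>\<kappa> a \<ge> 1\<close>, together they force \<open>cos x\<^sub>2 \<partial>\<^sub>1\<phi> = 0\<close>, so \<open>\<partial>\<^sub>1\<phi> = 0\<close>,
  \<open>u = 0\<close> and \<open>\<phi> = 0\<close>. Regularity is then a consequence of uniqueness.\<close>

section \<open>Calculus on the plane\<close>

text \<open>Since \<open>\<psi>\<close> is only of class \<open>C\<^sup>2\<close>, \<open>L\<close>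
  is merely continuous: it cannot serve as a test function itself, and the commutator has to vanish
  in the limit using no more than continuity of \<open>L\<close>. This is arranged by an odd kernel,
  for which exchanging the two arguments of \<open>L\<close> replaces the field by its difference
  quotient. For the test with \<open>cos x\<^sub>2\<close> no limit is taken, because convolution
  with an even kernel only multiplies the cosine by a constant. Area preservation is obtained
  without differentiating the flow in its initial point. One explicit Euler step has Jacobian
  \<open>1 + O(h\<^sup>2)\<close> because \<open>curl \<psi>\<close> is divergence free, so
  \<open>t / h\<close> steps change integrals by \<open>O(h)\<close>. At
  \<open>\<kappa> a = 1\<close> the estimates have no slack. The two ends of the chain differ by
  exactly \<open>\<integral> (cos x\<^sub>2 \<partial>\<^sub>1\<phi>)\<^sup>2\<close>, and the sign
  of this remainder, not a strict inequality of constants, gives the conclusion.\<close>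

lemma vector_2_eq: "(vector [s, t] :: real^2) = s *\<^sub>R axis 1 1 + t *\<^sub>R axis 2 1"
  by (simp add: vec_eq_iff forall_2 axis_def)

lemma vector_2_eta: "vector [x $ 1, x $ 2] = (x :: real^2)"
  by (simp add: vec_eq_iff forall_2)

lemma inner_2: "(x :: real^2) \<bullet> y = x $ 1 * y $ 1 + x $ 2 * y $ 2"
  by (simp add: inner_vec_def sum_2)

lemma continuous_on_vector_2 [continuous_intros]:
  "continuous_on S f \<Longrightarrow> continuous_on S g \<Longrightarrow> continuous_on S (\<lambda>x. vector [f x, g x] :: real^2)"
  unfolding vector_2_eq by (intro continuous_intros)

lemma has_derivative_vector_2:
  assumes "(f has_derivative f') F" "(g has_derivative g') F"
  shows "((\<lambda>x. vector [f x, g x] :: real^2) has_derivative (\<lambda>h. vector [f' h, g' h])) F"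
  unfolding vector_2_eq by (intro derivative_intros assms)

lemma mem_cbox_2: "x \<in> cbox l u \<longleftrightarrow> l $ 1 \<le> x $ 1 \<and> x $ 1 \<le> u $ 1 \<and> l $ 2 \<le> x $ 2 \<and> x $ 2 \<le> (u :: real^2) $ 2"
  by (auto simp: mem_box_cart forall_2)

lemma partial_eqI: "(f has_derivative D) (at x) \<Longrightarrow> partial i f x = D (axis i 1)"
  unfolding partial_def by (metis frechet_derivative_at)

text \<open>Linearity recovers the Frechet derivative from the two axis directions, so rules for
  \<open>has_derivative\<close> can be read off for \<open>partial\<close> by evaluating at
  \<open>axis i 1\<close>.\<close>

lemma has_derivative_partial:
  assumes "f differentiable (at x)"
  shows "(f has_derivative (\<lambda>h. h $ 1 * partial 1 f x + h $ 2 * partial 2 f x)) (at x)"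
proof -
  let ?D = "frechet_derivative f (at x)"
  have D: "(f has_derivative ?D) (at x)"
    using assms by (simp add: frechet_derivative_works)
  interpret bounded_linear ?D using D by (rule has_derivative_bounded_linear)
  have "?D h = h $ 1 * partial 1 f x + h $ 2 * partial 2 f x" for h
  proof -
    have "?D h = ?D ((h $ 1) *\<^sub>R axis 1 1 + (h $ 2) *\<^sub>R axis 2 1)"
      using vector_2_eq[of "h $ 1" "h $ 2"] by (simp add: vector_2_eta)
    then show ?thesis by (simp add: add scaleR partial_def)
  qed
  then have "?D = (\<lambda>h. h $ 1 * partial 1 f x + h $ 2 * partial 2 f x)" by blast
  then show ?thesis using D by metis
qed

lemma has_derivative_compose_partial:
  assumes "f differentiable (at (g t))" "(g has_derivative g') (at t within S)"
  shows "((\<lambda>t. f (g t)) has_derivative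
    (\<lambda>h. g' h $ 1 * partial 1 f (g t) + g' h $ 2 * partial 2 f (g t))) (at t within S)"
  using diff_chain_within[OF assms(2) has_derivative_at_withinI[OF has_derivative_partial[OF assms(1)]]]
  by (simp add: o_def)

lemma has_real_derivative_compose_partial:
  assumes "f differentiable (at (g t))" "(g has_vector_derivative g') (at t within S)"
  shows "((\<lambda>t. f (g t)) has_real_derivative
    (g' $ 1 * partial 1 f (g t) + g' $ 2 * partial 2 f (g t))) (at t within S)"
proof -
  have "(\<lambda>h. (h *\<^sub>R g') $ 1 * partial 1 f (g t) + (h *\<^sub>R g') $ 2 * partial 2 f (g t))
      = (*) (g' $ 1 * partial 1 f (g t) + g' $ 2 * partial 2 f (g t))"
    by (simp add: fun_eq_iff algebra_simps)
  then show ?thesis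
    using has_derivative_compose_partial[OF assms(1) assms(2)[unfolded has_vector_derivative_def]]
    by (simp add: has_field_derivative_def)
qed

lemma partial_line_1:
  assumes "f differentiable (at (vector [s, t]))"
  shows "((\<lambda>s. f (vector [s, t])) has_real_derivative partial 1 f (vector [s, t])) (at s within S)"
proof -
  have "((\<lambda>s. vector [s, t] :: real^2) has_vector_derivative axis 1 1) (at s within S)"
    unfolding vector_2_eq by (auto intro!: derivative_eq_intros)
  from has_real_derivative_compose_partial[OF assms this] show ?thesis by (simp add: axis_def)
qed

lemma partial_line_2:
  assumes "f differentiable (at (vector [s, t]))"
  shows "((\<lambda>t. f (vector [s, t])) has_real_derivative partial 2 f (vector [s, t])) (at t within S)"
proof -
  have "((\<lambda>t. vector [s, t] :: real^2) has_vector_derivative axis 2 1) (at t within S)"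
    unfolding vector_2_eq by (auto intro!: derivative_eq_intros)
  from has_real_derivative_compose_partial[OF assms this] show ?thesis by (simp add: axis_def)
qed

lemma differentiable_imp_continuous_on_UNIV:
  "(\<And>x. f differentiable (at x)) \<Longrightarrow> continuous_on UNIV f"
  by (simp add: continuous_at_imp_continuous_on differentiable_imp_continuous_within)

lemma continuous_on_UNIV_compose:
  "continuous_on UNIV f \<Longrightarrow> continuous_on S g \<Longrightarrow> continuous_on S (\<lambda>x. f (g x))"
  by (rule continuous_on_compose2[of UNIV f]) auto

text \<open>Fubini is applied on pairs. The map \<open>?g\<close> from pairs to
  \<open>real^2\<close> sends boxes to boxes of the same area, and its inverse \<open>?h\<close>
  sends boxes to boxes, which is what \<open>has_integral_twiddle\<close> asks for.\<close>

lemma integral_cbox_2: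
  fixes f :: "real^2 \<Rightarrow> real"
  assumes f: "continuous_on UNIV f"
  shows "integral (cbox (vector [a1, a2]) (vector [b1, b2])) f
    = integral {a1..b1} (\<lambda>s. integral {a2..b2} (\<lambda>t. f (vector [s, t])))"
proof -
  let ?g = "\<lambda>(s, t). vector [s, t] :: real^2" and ?h = "\<lambda>x::real^2. (x $ 1, x $ 2)"
  have img_g: "?g ` cbox u v = cbox (?g u) (?g v)" for u v
    by (force simp: mem_cbox_2 image_iff vec_eq_iff forall_2 cbox_Pair_eq split: prod.splits)
  have img_h: "?h ` cbox u v = cbox (?h u) (?h v)" for u v
  proof (intro set_eqI iffI)
    fix p assume "p \<in> cbox (?h u) (?h v)"
    then have "vector [fst p, snd p] \<in> cbox u v" by (auto simp: mem_cbox_2 cbox_Pair_eq)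
    then show "p \<in> ?h ` cbox u v" by (rule rev_image_eqI) simp
  qed (auto simp: mem_cbox_2 cbox_Pair_eq)
  have content: "measure lborel (?g ` cbox u v) = 1 * measure lborel (cbox u v)" for u v
  proof (cases "cbox u v = {}")
    case False
    then have ne: "cbox (?g u) (?g v) \<noteq> {}" using img_g[of u v] by auto
    obtain u1 u2 v1 v2 where uv: "u = (u1, u2)" "v = (v1, v2)" by (cases u, cases v)
    have "u1 \<le> v1" "u2 \<le> v2" using False by (auto simp: uv cbox_Pair_eq)
    then show ?thesis using content_cbox_cart[OF ne]
      by (simp only: img_g) (simp add: uv prod.distrib content_Pair UNIV_2)
  qed auto
  have cont: "continuous_on S (\<lambda>x. f (?g x))" for S
    by (auto simp: case_prod_unfold intro!: continuous_on_UNIV_compose[OF f] continuous_intros)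
  have "(f has_integral integral (cbox (vector [a1, a2]) (vector [b1, b2])) f) (cbox (vector [a1, a2]) (vector [b1, b2]))"
    by (intro integrable_integral integrable_continuous continuous_on_subset[OF f]) auto
  moreover have "isCont ?g p" for p
    by (rule continuous_on_interior[of UNIV]) (auto simp: case_prod_unfold intro!: continuous_intros)
  moreover have "\<exists>w z. ?g ` cbox u v = cbox w z" "\<exists>w z. ?h ` cbox u' v' = cbox w z" for u v u' v'
    unfolding img_g img_h by blast+
  ultimately have "((\<lambda>x. f (?g x)) has_integral (1 / 1) *\<^sub>R integral (cbox (vector [a1, a2]) (vector [b1, b2])) f)
      (?h ` cbox (vector [a1, a2]) (vector [b1, b2]))"
    by (intro has_integral_twiddle[OF zero_less_one _ _ _ _ _ content]) (auto simp: vector_2_eta)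
  then have "integral (cbox (a1, a2) (b1, b2)) (\<lambda>x. f (?g x)) = integral (cbox (vector [a1, a2]) (vector [b1, b2])) f"
    by (simp add: img_h integral_unique)
  also have "integral (cbox (a1, a2) (b1, b2)) (\<lambda>x. f (?g x))
     = integral (cbox a1 b1) (\<lambda>s. integral (cbox a2 b2) (\<lambda>t. f (?g (s, t))))"
    by (rule integral_prod_continuous[OF cont])
  finally show ?thesis by simp
qed

lemma integral_cbox_2':
  fixes f :: "real^2 \<Rightarrow> real"
  assumes f: "continuous_on UNIV f"
  shows "integral (cbox (vector [a1, a2]) (vector [b1, b2])) f
    = integral {a2..b2} (\<lambda>t. integral {a1..b1} (\<lambda>s. f (vector [s, t])))"
proof -
  have "continuous_on S (\<lambda>(s, t). f (vector [s, t]))" for S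
    by (auto simp: case_prod_unfold intro!: continuous_on_UNIV_compose[OF f] continuous_intros)
  from integral_swap_continuous[OF this] show ?thesis by (simp add: integral_cbox_2[OF f])
qed

text \<open>Over any rectangle both mixed derivatives integrate to the double increment of
  \<open>f\<close> at the four corners. A strict inequality between two continuous functions at
  \<open>x\<close> would persist on a small box and separate their integrals.\<close>

lemma mixed_partials_eq:
  fixes f :: "real^2 \<Rightarrow> real"
  assumes "Ck 2 f"
  shows "partial 1 (partial 2 f) x = partial 2 (partial 1 f) x"
proof -
  have f: "\<And>x. f differentiable (at x)" "\<And>i x. partial i f differentiable (at x)"
    "\<And>i j. continuous_on UNIV (partial i (partial j f))"
    using assms by (auto simp: numeral_2_eq_2)
  let ?A = "partial 1 (partial 2 f)" and ?B = "partial 2 (partial 1 f)"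
  have eq: "integral (cbox (vector [a1, a2]) (vector [b1, b2])) ?A
       = integral (cbox (vector [a1, a2]) (vector [b1, b2])) ?B" if le: "a1 \<le> b1" "a2 \<le> b2" for a1 a2 b1 b2
  proof -
    let ?d = "f (vector [b1, b2]) - f (vector [a1, b2]) - f (vector [b1, a2]) + f (vector [a1, a2])"
    have 1: "integral {a1..b1} (\<lambda>s. ?A (vector [s, t])) = partial 2 f (vector [b1, t]) - partial 2 f (vector [a1, t])" for t
      using le by (intro integral_unique fundamental_theorem_of_calculus)
        (auto simp: has_real_derivative_iff_has_vector_derivative[symmetric] intro!: partial_line_1 f)
    have 2: "((\<lambda>t. partial 2 f (vector [b1, t]) - partial 2 f (vector [a1, t])) has_integral
        (f (vector [b1, b2]) - f (vector [b1, a2])) - (f (vector [a1, b2]) - f (vector [a1, a2]))) {a2..b2}"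
      using le by (intro has_integral_diff fundamental_theorem_of_calculus)
        (auto simp: has_real_derivative_iff_has_vector_derivative[symmetric] intro!: partial_line_2 f)
    have 3: "integral {a2..b2} (\<lambda>t. ?B (vector [s, t])) = partial 1 f (vector [s, b2]) - partial 1 f (vector [s, a2])" for s
      using le by (intro integral_unique fundamental_theorem_of_calculus)
        (auto simp: has_real_derivative_iff_has_vector_derivative[symmetric] intro!: partial_line_2 f)
    have 4: "((\<lambda>s. partial 1 f (vector [s, b2]) - partial 1 f (vector [s, a2])) has_integral
        (f (vector [b1, b2]) - f (vector [a1, b2])) - (f (vector [b1, a2]) - f (vector [a1, a2]))) {a1..b1}"
      using le by (intro has_integral_diff fundamental_theorem_of_calculus)
        (auto simp: has_real_derivative_iff_has_vector_derivative[symmetric] intro!: partial_line_1 f)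
    have "integral (cbox (vector [a1, a2]) (vector [b1, b2])) ?A = ?d"
      unfolding integral_cbox_2'[OF f(3)] 1 using integral_unique[OF 2] by simp
    moreover have "integral (cbox (vector [a1, a2]) (vector [b1, b2])) ?B = ?d"
      unfolding integral_cbox_2[OF f(3)] 3 using integral_unique[OF 4] by simp
    ultimately show ?thesis by simp
  qed
  have no_less: False if "continuous_on UNIV F" "continuous_on UNIV G" and less: "F x < G x"
    and I: "\<And>a1 a2 b1 b2. a1 \<le> b1 \<Longrightarrow> a2 \<le> b2 \<Longrightarrow>
      integral (cbox (vector [a1, a2]) (vector [b1, b2])) F = integral (cbox (vector [a1, a2]) (vector [b1, b2])) G"
    for F G :: "real^2 \<Rightarrow> real"
  proof -
    have "open {z. F z < G z}" using that by (intro open_Collect_less) auto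
    then obtain e where e: "e > 0" "ball x e \<subseteq> {z. F z < G z}"
      using less openE by (metis mem_Collect_eq)
    obtain l u where lu: "x \<in> box l u" "box l u \<subseteq> ball x e"
      using rational_boxes[OF e(1)] by metis
    have "integral (cbox l u) F < integral (cbox l u) G"
      using lu e by (intro integral_less continuous_on_subset[OF that(1)] continuous_on_subset[OF that(2)]) auto
    moreover have "l $ 1 \<le> u $ 1" "l $ 2 \<le> u $ 2"
      using lu(1) by (auto simp: mem_box_cart forall_2)
    ultimately show False using I[of "l $ 1" "u $ 1" "l $ 2" "u $ 2"] by (simp add: vector_2_eta)
  qed
  show ?thesis
    using no_less[OF f(3) f(3), of 1 2 2 1] no_less[OF f(3) f(3), of 2 1 1 2] eq by fastforce
qed

section \<open>Biperiodic functions\<close>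

text \<open>The codomain is polymorphic because the notion is applied to the vector field
  \<open>curl \<psi>\<close> as well as to scalar functions.\<close>

definition biperiodic :: "real \<Rightarrow> (real^2 \<Rightarrow> 'b) \<Rightarrow> bool" where
  "biperiodic a f \<longleftrightarrow> (\<forall>x. f (x + vector [2 * pi / a, 0]) = f x \<and> f (x + vector [0, 2 * pi]) = f x)"

lemma Omega_eq_cbox: "Omega a = cbox (vector [0, 0]) (vector [2 * pi / a, 2 * pi])"
  by (auto simp: Omega_def mem_cbox_2)

lemma biperiodic_add_int:
  assumes "biperiodic a f"
  shows "f (x + vector [of_int m * (2 * pi / a), of_int n * (2 * pi)]) = f x"
proof -
  have 1: "f (x + of_int m *\<^sub>R vector [2 * pi / a, 0]) = f x" for x m
  proof (induction m rule: int_induct[where k = 0])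
    case (step1 i)
    have "f (x + of_int (i + 1) *\<^sub>R vector [2 * pi / a, 0]) = f ((x + of_int i *\<^sub>R vector [2 * pi / a, 0]) + vector [2 * pi / a, 0])"
      by (simp add: algebra_simps)
    then show ?case using assms step1 by (simp add: biperiodic_def)
  next
    case (step2 i)
    have "f ((x + of_int (i - 1) *\<^sub>R vector [2 * pi / a, 0]) + vector [2 * pi / a, 0]) = f (x + of_int i *\<^sub>R vector [2 * pi / a, 0])"
      by (simp add: algebra_simps)
    then show ?case using assms step2 by (simp add: biperiodic_def)
  qed simp
  have 2: "f (x + of_int m *\<^sub>R vector [0, 2 * pi]) = f x" for x m
  proof (induction m rule: int_induct[where k = 0])
    case (step1 i)
    have "f (x + of_int (i + 1) *\<^sub>R vector [0, 2 * pi]) = f ((x + of_int i *\<^sub>R vector [0, 2 * pi]) + vector [0, 2 * pi])"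
      by (simp add: algebra_simps)
    then show ?case using assms step1 by (simp add: biperiodic_def)
  next
    case (step2 i)
    have "f ((x + of_int (i - 1) *\<^sub>R vector [0, 2 * pi]) + vector [0, 2 * pi]) = f (x + of_int i *\<^sub>R vector [0, 2 * pi])"
      by (simp add: algebra_simps)
    then show ?case using assms step2 by (simp add: biperiodic_def)
  qed simp
  have "x + vector [of_int m * (2 * pi / a), of_int n * (2 * pi)]
      = (x + of_int m *\<^sub>R vector [2 * pi / a, 0]) + of_int n *\<^sub>R vector [0, 2 * pi]"
    by (simp add: vec_eq_iff forall_2)
  then show ?thesis using 1 2 by metis
qed

lemma biperiodic_reduce:
  assumes "a > 0" "biperiodic a f"
  obtains x' where "x' \<in> Omega a" "f x' = f x"
proof -
  have reduce: "\<exists>m. 0 \<le> s + of_int m * P \<and> s + of_int m * P \<le> P" if "P > 0" for s P :: real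
  proof -
    have "of_int \<lfloor>s / P\<rfloor> * P \<le> s" "s < (of_int \<lfloor>s / P\<rfloor> + 1) * P"
      using that floor_correct[of "s / P"] by (simp_all add: pos_le_divide_eq[symmetric] pos_divide_less_eq[symmetric])
    then show ?thesis by (intro exI[of _ "- \<lfloor>s / P\<rfloor>"]) (simp add: algebra_simps)
  qed
  obtain m where m: "0 \<le> x $ 1 + of_int m * (2 * pi / a)" "x $ 1 + of_int m * (2 * pi / a) \<le> 2 * pi / a"
    using reduce[of "2 * pi / a" "x $ 1"] assms(1) by (auto simp: field_simps)
  obtain n where n: "0 \<le> x $ 2 + of_int n * (2 * pi)" "x $ 2 + of_int n * (2 * pi) \<le> 2 * pi"
    using reduce[of "2 * pi" "x $ 2"] by auto
  show ?thesis
    by (rule that[OF _ biperiodic_add_int[OF assms(2), of x m n]]) (use m n in \<open>simp add: Omega_def\<close>)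
qed

lemma biperiodic_bounded:
  fixes f :: "real^2 \<Rightarrow> 'b::real_normed_vector"
  assumes "a > 0" "biperiodic a f" "continuous_on UNIV f"
  obtains B where "B > 0" "\<And>x. norm (f x) \<le> B"
proof -
  have "bounded (f ` Omega a)"
    unfolding Omega_eq_cbox
    by (intro compact_imp_bounded compact_continuous_image continuous_on_subset[OF assms(3)]) auto
  then obtain B where B: "B > 0" "\<And>x. x \<in> Omega a \<Longrightarrow> norm (f x) \<le> B"
    unfolding bounded_pos by auto
  show ?thesis
    by (rule that[OF B(1)]) (metis B(2) biperiodic_reduce[OF assms(1,2)])
qed

lemma biperiodic_partial:
  assumes "biperiodic a f" "\<And>x. f differentiable (at x)"
  shows "biperiodic a (partial i f)"
proof -
  have *: "partial i f (x + c) = partial i f x" if "\<And>x. f (x + c) = f x" for c x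
  proof -
    have "(f has_derivative frechet_derivative f (at (x + c))) (at (x + c))"
      using assms(2) frechet_derivative_works by blast
    then have "((\<lambda>x. f (x + c)) has_derivative frechet_derivative f (at (x + c))) (at x)"
      by (auto intro!: derivative_eq_intros has_derivative_compose[of "\<lambda>x. x + c" "\<lambda>x. x" x UNIV f])
    then show ?thesis using partial_eqI[of f] that by (simp add: partial_def)
  qed
  show ?thesis using assms(1) *[of "vector [2 * pi / a, 0]"] *[of "vector [0, 2 * pi]"]
    by (simp add: biperiodic_def)
qed

lemma biperiodic_shift: "biperiodic a f \<Longrightarrow> biperiodic a (\<lambda>x. f (x + c))"
  unfolding biperiodic_def by (simp add: add.assoc add.commute[of _ c]) (simp add: add.assoc[symmetric])

text \<open>With an antiderivative \<open>F\<close>, the integral over a window of length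
  \<open>P\<close> is \<open>F (x + P) - F x\<close>, whose derivative
  \<open>f (x + P) - f x\<close> vanishes.\<close>

lemma integral_periodic_shift:
  fixes f :: "real \<Rightarrow> real"
  assumes f: "continuous_on UNIV f" and per: "\<And>x. f (x + P) = f x" and P: "P > 0"
  shows "integral {0..P} (\<lambda>x. f (x + c)) = integral {0..P} f"
proof -
  \<comment> \<open>The interval from \<open>A\<close> to \<open>B\<close> is wide enough that
    \<open>x\<close> and \<open>x + P\<close> are interior for every \<open>x\<close> between
    \<open>- \<bar>c\<bar>\<close> and \<open>\<bar>c\<bar>\<close>, so \<open>F\<close> has
    two-sided derivatives there.\<close>
  define A where "A = - \<bar>c\<bar> - 1"
  define B where "B = \<bar>c\<bar> + P + 1"
  define F where "F = (\<lambda>x. integral {A..x} f)"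
  have F: "(F has_real_derivative f x) (at x)" if "A < x" "x < B" for x
  proof -
    have "(F has_real_derivative f x) (at x within {A..B})"
      unfolding F_def using that
      by (intro integral_has_real_derivative continuous_on_subset[OF f]) auto
    then show ?thesis using that by (simp add: at_within_Icc_at)
  qed
  have "((\<lambda>x. F (x + P) - F x) has_real_derivative 0) (at x within {-\<bar>c\<bar>..\<bar>c\<bar>})" if "x \<in> {-\<bar>c\<bar>..\<bar>c\<bar>}" for x
    using that P
    by (auto intro!: derivative_eq_intros DERIV_chain'[of "\<lambda>x. x + P" _ _ _ F, where E = "f (x + P)"]
       has_field_derivative_at_within[OF F] F simp: A_def B_def per)
  then obtain k where k: "\<And>x. x \<in> {-\<bar>c\<bar>..\<bar>c\<bar>} \<Longrightarrow> F (x + P) - F x = k"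
    using has_field_derivative_zero_constant[of "{-\<bar>c\<bar>..\<bar>c\<bar>}" "\<lambda>x. F (x + P) - F x"] by auto
  have F_eq: "integral {x..x + P} f = F (x + P) - F x" if "x \<in> {-\<bar>c\<bar>..\<bar>c\<bar>}" for x
    unfolding F_def using that P
    by (subst Henstock_Kurzweil_Integration.integral_combine[of A x "x + P" f, symmetric])
      (auto simp: A_def intro!: integrable_continuous_real continuous_on_subset[OF f])
  have "integral {0..P} (\<lambda>x. f (x + c)) = integral {c..c + P} f"
    using integral_shift_real_ivl[of c c "c + P" f] by (simp add: add.commute)
  also have "\<dots> = integral {0..0 + P} f"
    using F_eq[of c] F_eq[of 0] k[of c] k[of 0] abs_ge_self[of c] abs_ge_minus_self[of c] by simp
  finally show ?thesis by simp
qed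

text \<open>Each coordinate is shifted while it is the inner variable, so the order of integration
  is exchanged between the two shifts.\<close>

lemma integral_Omega_shift:
  fixes f :: "real^2 \<Rightarrow> real"
  assumes a: "a > 0" and f: "continuous_on UNIV f" and per: "biperiodic a f"
  shows "integral (Omega a) (\<lambda>x. f (x + c)) = integral (Omega a) f"
proof -
  let ?P = "2 * pi / a"
  have P: "?P > 0" using a by simp
  have per1: "f (vector [s + ?P, t]) = f (vector [s, t])" for s t
  proof -
    have "vector [s + ?P, t] = vector [s, t] + (vector [?P, 0] :: real^2)"
      by (simp add: vec_eq_iff forall_2)
    then show ?thesis using per by (simp add: biperiodic_def)
  qed
  have per2: "f (vector [s, t + 2 * pi]) = f (vector [s, t])" for s t
  proof -
    have "vector [s, t + 2 * pi] = vector [s, t] + (vector [0, 2 * pi] :: real^2)"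
      by (simp add: vec_eq_iff forall_2)
    then show ?thesis using per by (simp add: biperiodic_def)
  qed
  have shift: "vector [s, t] + c = vector [s + c $ 1, t + c $ 2]" for s t
    by (simp add: vec_eq_iff forall_2)
  have fc: "continuous_on UNIV (\<lambda>x. f (x + c))"
    by (intro continuous_on_UNIV_compose[OF f] continuous_intros)
  have "integral (Omega a) (\<lambda>x. f (x + c))
     = integral {0..?P} (\<lambda>s. integral {0..2 * pi} (\<lambda>t. f (vector [s + c $ 1, t + c $ 2])))"
    unfolding Omega_eq_cbox integral_cbox_2[OF fc] shift ..
  also have "\<dots> = integral {0..?P} (\<lambda>s. integral {0..2 * pi} (\<lambda>t. f (vector [s + c $ 1, t])))"
    by (intro arg_cong[where f = "integral {0..?P}"] ext integral_periodic_shift[of "\<lambda>t. f (vector [_, t])"] per2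
        continuous_on_UNIV_compose[OF f] continuous_intros) simp
  also have "\<dots> = integral {0..2 * pi} (\<lambda>t. integral {0..?P} (\<lambda>s. f (vector [s + c $ 1, t])))"
  proof -
    have "continuous_on (cbox (0, 0) (?P, 2 * pi)) (\<lambda>(s, t). f (vector [s + c $ 1, t]))"
      by (auto simp: case_prod_unfold intro!: continuous_on_UNIV_compose[OF f] continuous_intros)
    from integral_swap_continuous[OF this] show ?thesis by simp
  qed
  also have "\<dots> = integral {0..2 * pi} (\<lambda>t. integral {0..?P} (\<lambda>s. f (vector [s, t])))"
    by (intro arg_cong[where f = "integral {0..2 * pi}"] ext integral_periodic_shift[of "\<lambda>s. f (vector [s, _])"] per1
        continuous_on_UNIV_compose[OF f] continuous_intros P)
  also have "\<dots> = integral (Omega a) f"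
    unfolding Omega_eq_cbox integral_cbox_2'[OF f] ..
  finally show ?thesis .
qed

section \<open>Integration by parts and vanishing integrals on the period cell\<close>

lemma integral_Omega_partial_eq_0:
  fixes f :: "real^2 \<Rightarrow> real"
  assumes a: "a > 0" and f: "\<And>x. f differentiable (at x)" "continuous_on UNIV (partial i f)"
    and per: "biperiodic a f"
  shows "integral (Omega a) (partial i f) = 0"
proof -
  let ?P = "2 * pi / a"
  have eq: "vector [0, t] + (vector [?P, 0] :: real^2) = vector [?P, t]"
    "vector [s, 0] + (vector [0, 2 * pi] :: real^2) = vector [s, 2 * pi]" for s t
    by (simp_all add: vec_eq_iff forall_2)
  have per: "f (vector [?P, t]) = f (vector [0, t])" "f (vector [s, 2 * pi]) = f (vector [s, 0])" for s t
    using per unfolding biperiodic_def by (metis eq(1), metis eq(2))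
  consider "i = 1" | "i = 2" using exhaust_2 by blast
  then show ?thesis
  proof cases
    case 1
    have "integral {0..?P} (\<lambda>s. partial 1 f (vector [s, t])) = f (vector [?P, t]) - f (vector [0, t])" for t
      using a by (intro integral_unique fundamental_theorem_of_calculus)
        (auto simp: has_real_derivative_iff_has_vector_derivative[symmetric] intro!: partial_line_1 f)
    then show ?thesis using f(2) per unfolding 1 Omega_eq_cbox by (simp add: integral_cbox_2')
  next
    case 2
    have "integral {0..2 * pi} (\<lambda>t. partial 2 f (vector [s, t])) = f (vector [s, 2 * pi]) - f (vector [s, 0])" for s
      by (intro integral_unique fundamental_theorem_of_calculus)
        (auto simp: has_real_derivative_iff_has_vector_derivative[symmetric] intro!: partial_line_2 f)
    then show ?thesis using f(2) per unfolding 2 Omega_eq_cbox by (simp add: integral_cbox_2)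
  qed
qed

lemma partial_mult:
  assumes "f differentiable (at x)" "g differentiable (at x)"
  shows "partial i (\<lambda>x. f x * g x) x = f x * partial i g x + partial i f x * g x"
  using partial_eqI[OF has_derivative_mult[OF has_derivative_partial[OF assms(1)] has_derivative_partial[OF assms(2)]], of i]
    exhaust_2[of i] by (auto simp: axis_def)

lemma integrable_on_Omega: "continuous_on UNIV f \<Longrightarrow> f integrable_on Omega a"
  for f :: "real^2 \<Rightarrow> real"
  unfolding Omega_eq_cbox using continuous_on_subset[of UNIV f] by (intro integrable_continuous) auto

lemma integral_by_parts_Omega:
  fixes f g :: "real^2 \<Rightarrow> real"
  assumes a: "a > 0" and f: "\<And>x. f differentiable (at x)" "continuous_on UNIV (partial i f)" "biperiodic a f"
    and g: "\<And>x. g differentiable (at x)" "continuous_on UNIV (partial i g)" "biperiodic a g"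
  shows "integral (Omega a) (\<lambda>x. f x * partial i g x) = - integral (Omega a) (\<lambda>x. partial i f x * g x)"
proof -
  have [continuous_intros]: "continuous_on UNIV f" "continuous_on UNIV g"
    using f g by (auto intro: differentiable_imp_continuous_on_UNIV)
  have eq: "partial i (\<lambda>x. f x * g x) = (\<lambda>x. f x * partial i g x + partial i f x * g x)"
    using f g by (simp add: partial_mult fun_eq_iff)
  have "integral (Omega a) (partial i (\<lambda>x. f x * g x)) = 0"
    using f g by (intro integral_Omega_partial_eq_0[OF a] differentiable_mult)
      (auto simp: eq biperiodic_def intro!: continuous_intros)
  moreover have "integral (Omega a) (\<lambda>x. f x * partial i g x + partial i f x * g x)
     = integral (Omega a) (\<lambda>x. f x * partial i g x) + integral (Omega a) (\<lambda>x. partial i f x * g x)"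
    using f(2) g(2) by (intro integral_add integrable_on_Omega continuous_on_mult) (auto intro: continuous_intros)
  ultimately show ?thesis unfolding eq by linarith
qed

lemma integral_Omega_eq_0D:
  fixes f :: "real^2 \<Rightarrow> real"
  assumes a: "a > 0" and f: "continuous_on UNIV f" "biperiodic a f" "\<And>x. 0 \<le> f x"
    and I: "integral (Omega a) f \<le> 0"
  shows "f x = 0"
proof -
  obtain x' where x': "x' \<in> Omega a" "f x' = f x" using biperiodic_reduce[OF a f(2)] .
  have "integral (Omega a) f = 0"
    using I integral_nonneg[OF integrable_on_Omega[OF f(1)], of a] f(3) by simp
  \<comment> \<open>The criterion for a zero integral asks for a box with interior points; the
    centre of the cell is one.\<close>
  moreover have "box (vector [0, 0]) (vector [2 * pi / a, 2 * pi] :: real^2) \<noteq> {}"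
  proof -
    have "vector [pi / a, pi] \<in> box (vector [0, 0]) (vector [2 * pi / a, 2 * pi] :: real^2)"
      using a by (simp add: mem_box_cart forall_2 field_simps)
    then show ?thesis by blast
  qed
  ultimately have "f x' = 0"
    using integral_cbox_eq_0_iff[of "vector [0, 0]" "vector [2 * pi / a, 2 * pi]" f] x'(1) f
    unfolding Omega_eq_cbox by (metis continuous_on_subset top_greatest)
  then show ?thesis using x' by simp
qed

section \<open>The inequality of Wirtinger and its planar consequence\<close>

text \<open>On the interval, \<open>f'\<^sup>2 - a\<^sup>2 (f - k)\<^sup>2 = (f' - a (f - k) cot (a (x - c)))\<^sup>2 + (a (f - k)\<^sup>2 cot (a (x - c)))'\<close>,
  and the boundary terms vanish.\<close>
lemma wirtinger_half_period:
  fixes f f' :: "real \<Rightarrow> real"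
  assumes a: "a > 0" and f: "\<And>x. (f has_real_derivative f' x) (at x)" and f': "continuous_on UNIV f'"
    and b: "b = c + pi / a" and ends: "f c = k" "f b = k"
  shows "a\<^sup>2 * integral {c..b} (\<lambda>x. (f x - k)\<^sup>2) \<le> integral {c..b} (\<lambda>x. (f' x)\<^sup>2)"
proof -
  have cb: "c < b" using a b by simp
  have cont_f: "continuous_on UNIV f"
    by (intro continuous_at_imp_continuous_on ballI DERIV_isCont[OF f])
  define q where "q = (\<lambda>x. (f' x)\<^sup>2 - a\<^sup>2 * (f x - k)\<^sup>2)"
  define Q where "Q = (\<lambda>x. integral {c..x} q)"
  \<comment> \<open>The boundary term. The cotangent has poles at \<open>c\<close> and
    \<open>b\<close>, which the double zero of \<open>(f x - k)\<^sup>2\<close> outweighs.\<close>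
  define G where "G = (\<lambda>x. a * (f x - k)\<^sup>2 * cot (a * (x - c)))"
  have cont_q: "continuous_on S q" for S
    unfolding q_def by (intro continuous_intros continuous_on_subset[OF f'] continuous_on_subset[OF cont_f]) auto
  have Q: "(Q has_real_derivative q x) (at x within {c..b})" if "x \<in> {c..b}" for x
    unfolding Q_def using that by (intro integral_has_real_derivative cont_q) auto
  have sin_pos: "sin (a * (x - c)) > 0" if "c < x" "x < b" for x
    using that a by (intro sin_gt_zero) (auto simp: b field_simps)
  have deriv: "((\<lambda>x. Q x - G x) has_real_derivative (f' x - a * (f x - k) * cot (a * (x - c)))\<^sup>2) (at x)"
    if x: "c < x" "x < b" for x
  proof -
    have s: "sin (a * (x - c)) \<noteq> 0" using sin_pos[OF x] by simp
    have 1: "(Q has_real_derivative q x) (at x)"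
      using Q[of x] x by (simp add: at_within_Icc_at)
    have 2: "(G has_real_derivative
      (a * (2 * (f x - k) * f' x) * cot (a * (x - c)) + a * (f x - k)\<^sup>2 * (- inverse ((sin (a * (x - c)))\<^sup>2) * a))) (at x)"
      unfolding G_def using s by (auto intro!: derivative_eq_intros f DERIV_chain2[OF DERIV_cot])
    have csc: "inverse ((sin (a * (x - c)))\<^sup>2) = 1 + (cot (a * (x - c)))\<^sup>2"
    proof -
      have "(sin (a * (x - c)))\<^sup>2 * (1 + (cot (a * (x - c)))\<^sup>2) = 1"
        using s by (simp add: cot_def field_simps)
      then show ?thesis using s by (metis inverse_unique)
    qed
    show ?thesis
      by (rule derivative_eq_intros 1 2 refl)+ (simp only: csc q_def, simp add: power2_eq_square algebra_simps)
  qed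
  have mono: "Q x - G x \<le> Q y - G y" if "c < x" "x \<le> y" "y < b" for x y
    using that by (intro DERIV_nonneg_imp_nondecreasing[of x y "\<lambda>x. Q x - G x"])
      (auto intro!: exI deriv)
  \<comment> \<open>Dividing both \<open>f x - k\<close> and the sine by \<open>x - e\<close> gives
    two convergent quotients, the second with a nonzero limit; the spare factor
    \<open>f x - k\<close> then sends \<open>G\<close> to 0.\<close>
  have G_lim: "(G \<longlongrightarrow> 0) (at e within S)" if "f e = k" "sin (a * (e - c)) = 0" for e S
  proof -
    have "((\<lambda>x. (f x - k) / (x - e)) \<longlongrightarrow> f' e) (at e)"
      using f[of e] that by (simp add: has_field_derivative_iff)
    moreover have "((\<lambda>x. sin (a * (x - c))) has_real_derivative a * cos (a * (e - c))) (at e)"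
      by (auto intro!: derivative_eq_intros)
    then have "((\<lambda>x. sin (a * (x - c)) / (x - e)) \<longlongrightarrow> a * cos (a * (e - c))) (at e)"
      using that by (simp add: has_field_derivative_iff)
    moreover have "cos (a * (e - c)) \<noteq> 0"
      using sin_cos_squared_add[of "a * (e - c)"] that by auto
    moreover have "(f \<longlongrightarrow> f e) (at e)"
      using DERIV_isCont[OF f[of e]] isCont_def by blast
    ultimately have "((\<lambda>x. a * (f x - k) * ((f x - k) / (x - e)) / (sin (a * (x - c)) / (x - e)) * cos (a * (x - c)))
        \<longlongrightarrow> a * (f e - k) * f' e / (a * cos (a * (e - c))) * cos (a * (e - c))) (at e)"
      using a by (intro tendsto_intros) auto
    then have "((\<lambda>x. a * (f x - k) * ((f x - k) / (x - e)) / (sin (a * (x - c)) / (x - e)) * cos (a * (x - c))) \<longlongrightarrow> 0) (at e)"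
      using that by simp
    then have "(G \<longlongrightarrow> 0) (at e)"
      by (rule Lim_transform_eventually)
        (auto simp: G_def cot_def power2_eq_square eventually_at_filter)
    then show ?thesis by (rule tendsto_within_subset) auto
  qed
  have Q_lim: "(Q \<longlongrightarrow> Q e) (at e within {c<..<b})" if "e \<in> {c..b}" for e
    using DERIV_continuous[OF Q[OF that]] unfolding continuous_within
    by (rule tendsto_within_subset) auto
  \<comment> \<open>\<open>Q - G\<close> is monotone on the open interval only; limits at
    \<open>c\<close> and then at \<open>b\<close> carry this to
    \<open>Q c \<le> Q b\<close>.\<close>
  have "((\<lambda>x. Q x - G x) \<longlongrightarrow> Q c - 0) (at c within {c<..<b})"
    using cb by (intro tendsto_diff G_lim Q_lim ends) auto
  then have 0: "Q c - 0 \<le> Q y - G y" if "c < y" "y < b" for y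
  proof (rule tendsto_upperbound)
    show "\<forall>\<^sub>F x in at c within {c<..<b}. Q x - G x \<le> Q y - G y"
      unfolding eventually_at using that mono[of _ y]
      by (intro exI[of _ "y - c"]) (auto simp: dist_real_def)
    show "at c within {c<..<b} \<noteq> bot" using cb by (simp add: at_within_eq_bot_iff)
  qed
  have "((\<lambda>x. Q x - G x) \<longlongrightarrow> Q b - 0) (at b within {c<..<b})"
    using cb a by (intro tendsto_diff G_lim Q_lim ends) (auto simp: b)
  then have "Q c - 0 \<le> Q b - 0"
  proof (rule tendsto_lowerbound)
    show "\<forall>\<^sub>F x in at b within {c<..<b}. Q c - 0 \<le> Q x - G x"
      unfolding eventually_at using 0 cb by (intro exI[of _ 1]) auto
    show "at b within {c<..<b} \<noteq> bot" using cb by (simp add: at_within_eq_bot_iff)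
  qed
  moreover have "Q b = integral {c..b} (\<lambda>x. (f' x)\<^sup>2) - a\<^sup>2 * integral {c..b} (\<lambda>x. (f x - k)\<^sup>2)"
    unfolding Q_def q_def
    by (subst integral_diff) (auto intro!: integrable_continuous_real continuous_intros
        continuous_on_subset[OF f'] continuous_on_subset[OF cont_f])
  ultimately show ?thesis by (simp add: Q_def)
qed

text \<open>A continuous function of period \<open>2 * pi / a\<close> takes equal values at two points half a period apart.\<close>
lemma wirtinger:
  fixes f f' :: "real \<Rightarrow> real"
  assumes a: "a > 0" and f: "\<And>x. (f has_real_derivative f' x) (at x)" and f': "continuous_on UNIV f'"
    and per: "\<And>x. f (x + 2 * pi / a) = f x" and mean: "integral {0..2 * pi / a} f = 0"
  shows "a\<^sup>2 * integral {0..2 * pi / a} (\<lambda>x. (f x)\<^sup>2) \<le> integral {0..2 * pi / a} (\<lambda>x. (f' x)\<^sup>2)"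
proof -
  let ?P = "2 * pi / a"
  have P: "?P > 0" using a by simp
  have cont_f: "continuous_on UNIV f"
    by (intro continuous_at_imp_continuous_on ballI DERIV_isCont[OF f])
  have [continuous_intros]: "continuous_on S f" "continuous_on S f'" for S
    using cont_f f' continuous_on_subset by blast+
  have per': "f' (x + ?P) = f' x" for x
  proof -
    have "((\<lambda>x. f (x + ?P)) has_real_derivative f' (x + ?P)) (at x)"
      using f[of "x + ?P"] by (simp add: DERIV_shift)
    then show ?thesis using f[of x] per DERIV_unique by simp
  qed
  \<comment> \<open>The difference over half a period changes sign when its argument advances by
    half a period, so it has a zero between \<open>0\<close> and \<open>pi / a\<close>.\<close>
  have "\<exists>c. f (c + pi / a) - f c = 0"
  proof -
    let ?d = "\<lambda>x. f (x + pi / a) - f x"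
    have "f (pi / a + pi / a) = f 0" using per[of 0] by simp
    then have "?d (pi / a) = - ?d 0" by simp
    moreover have "continuous_on {0..pi / a} ?d"
      by (intro continuous_on_diff continuous_on_UNIV_compose[OF cont_f, of _ "\<lambda>x. x + pi / a"]
          continuous_on_subset[OF cont_f] continuous_intros) simp
    ultimately show ?thesis
      using IVT'[of ?d 0 0 "pi / a"] IVT2'[of ?d "pi / a" 0 0] a by (cases "?d 0 \<le> 0") force+
  qed
  then obtain c where c: "f (c + pi / a) = f c" by auto
  let ?k = "f c" and ?m = "c + pi / a" and ?e = "c + pi / a + pi / a"
  have e: "?e = ?P + c" by simp
  have "pi / a \<le> 2 * pi / a" using a by (simp add: field_simps)
  then have comb: "integral {c..?e} g = integral {c..?m} g + integral {?m..?e} g" if "continuous_on UNIV g" for g :: "real \<Rightarrow> real"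
    using a by (intro Henstock_Kurzweil_Integration.integral_combine[symmetric] integrable_continuous_real continuous_on_subset[OF that]) auto
  have shift: "integral {c..?e} g = integral {0..?P} g" if "continuous_on UNIV g" "\<And>x. g (x + ?P) = g x" for g :: "real \<Rightarrow> real"
    using integral_shift_real_ivl[of c c ?e g] integral_periodic_shift[OF that P, of c] by (simp add: e)
  have fe: "f ?e = f c" using per[of c] e by (simp add: add.commute)
  have "continuous_on UNIV (\<lambda>x. (f x - ?k)\<^sup>2)" "continuous_on UNIV (\<lambda>x. (f' x)\<^sup>2)"
    by (intro continuous_intros)+
  note comb' = this[THEN comb]
  \<comment> \<open>\<open>f - f c\<close> vanishes at \<open>c\<close>, at the midpoint
    \<open>?m\<close> and at \<open>?e\<close>, so the half-period inequality applies on both halves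
    with the same constant.\<close>
  have "a\<^sup>2 * integral {c..?e} (\<lambda>x. (f x - ?k)\<^sup>2) \<le> integral {c..?e} (\<lambda>x. (f' x)\<^sup>2)"
    unfolding comb' distrib_left
    using wirtinger_half_period[OF a f f' refl refl, of c] wirtinger_half_period[OF a f f' refl, of ?m ?k] c fe
    by (intro add_mono) simp_all
  moreover have "integral {c..?e} (\<lambda>x. (f x - ?k)\<^sup>2) = integral {0..?P} (\<lambda>x. (f x - ?k)\<^sup>2)"
    by (rule shift) (auto intro!: continuous_intros simp: per)
  moreover have "integral {c..?e} (\<lambda>x. (f' x)\<^sup>2) = integral {0..?P} (\<lambda>x. (f' x)\<^sup>2)"
    by (rule shift) (auto intro!: continuous_intros simp: per')
  \<comment> \<open>A function of mean zero has its smallest mean square deviation about 0, because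
    the cross term \<open>2 * ?k * f x\<close> integrates to 0.\<close>
  moreover have "integral {0..?P} (\<lambda>x. (f x)\<^sup>2) \<le> integral {0..?P} (\<lambda>x. (f x - ?k)\<^sup>2)"
  proof -
    have "integral {0..?P} (\<lambda>x. (f x - ?k)\<^sup>2) = integral {0..?P} (\<lambda>x. (f x)\<^sup>2 - 2 * ?k * f x + ?k\<^sup>2)"
      by (simp add: power2_eq_square algebra_simps)
    also have "\<dots> = integral {0..?P} (\<lambda>x. (f x)\<^sup>2 - 2 * ?k * f x) + integral {0..?P} (\<lambda>x. ?k\<^sup>2)"
      by (intro integral_add integrable_continuous_real continuous_intros)
    also have "integral {0..?P} (\<lambda>x. (f x)\<^sup>2 - 2 * ?k * f x) = integral {0..?P} (\<lambda>x. (f x)\<^sup>2) - integral {0..?P} (\<lambda>x. 2 * ?k * f x)"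
      by (intro integral_diff integrable_continuous_real continuous_intros)
    finally show ?thesis using mean a by simp
  qed
  ultimately show ?thesis
    by (smt (verit) mult_left_mono zero_le_power2)
qed

text \<open>For \<open>f\<close> of class \<open>C\<^sup>2\<close> only, third derivatives are avoided by replacing one of the second
  derivatives with a second difference quotient.\<close>
lemma integral_partial_11_22_nonneg:
  assumes a: "a > 0" and C2: "Ck 2 f" and per: "biperiodic a f"
  shows "0 \<le> integral (Omega a) (\<lambda>x. partial 1 (partial 1 f) x * partial 2 (partial 2 f) x)"
proof -
  have f: "\<And>x. f differentiable (at x)" "\<And>i x. partial i f differentiable (at x)"
    "\<And>i j. continuous_on UNIV (partial i (partial j f))"
    using C2 by (auto simp: numeral_2_eq_2)
  let ?e = "axis 1 1 :: real^2"
  have per2: "biperiodic a (partial i (partial j f))" for i j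
    using biperiodic_partial[OF biperiodic_partial[OF per f(1)] f(2)] .
  have cont: "continuous_on UNIV f" "\<And>i. continuous_on UNIV (partial i f)"
    using f by (auto intro: differentiable_imp_continuous_on_UNIV)
  have [continuous_intros]: "continuous_on S (\<lambda>x. f (g x))" "continuous_on S (\<lambda>x. partial i f (g x))" "continuous_on S (\<lambda>x. partial i (partial j f) (g x))"
    if "continuous_on S g" for S i j and g :: "real^2 \<Rightarrow> real^2"
    using that cont f(3) continuous_on_UNIV_compose by blast+
  \<comment> \<open>The symmetric second difference in \<open>x\<^sub>1\<close>; divided by
    \<open>h\<^sup>2\<close> it tends to \<open>partial 1 (partial 1 f)\<close>.\<close>
  define D where "D = (\<lambda>h x. f (x + h *\<^sub>R ?e) - 2 * f x + f (x - h *\<^sub>R ?e))"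
  have D: "0 \<le> integral (Omega a) (\<lambda>x. D h x * partial 2 (partial 2 f) x)" for h
  proof -
    define g where "g = (\<lambda>x. f (x + h *\<^sub>R ?e) - f x)"
    have shift_diff: "(\<lambda>x. u (x + h *\<^sub>R ?e)) differentiable (at x)"
      "partial i (\<lambda>x. u (x + h *\<^sub>R ?e)) x = partial i u (x + h *\<^sub>R ?e)" if "\<And>x. u differentiable (at x)" for u i x
    proof -
      have "(u has_derivative frechet_derivative u (at (x + h *\<^sub>R ?e))) (at (x + h *\<^sub>R ?e))"
        using that frechet_derivative_works by blast
      then have *: "((\<lambda>x. u (x + h *\<^sub>R ?e)) has_derivative frechet_derivative u (at (x + h *\<^sub>R ?e))) (at x)"
        by (auto intro!: derivative_eq_intros has_derivative_compose[of "\<lambda>x. x + h *\<^sub>R ?e" "\<lambda>x. x" x UNIV u])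
      show "(\<lambda>x. u (x + h *\<^sub>R ?e)) differentiable (at x)" using * differentiableI by blast
      show "partial i (\<lambda>x. u (x + h *\<^sub>R ?e)) x = partial i u (x + h *\<^sub>R ?e)"
        using partial_eqI[OF *] by (simp add: partial_def)
    qed
    have g': "g differentiable (at x)" "partial i g x = partial i f (x + h *\<^sub>R ?e) - partial i f x" for i x
    proof -
      show "g differentiable (at x)"
        unfolding g_def by (intro differentiable_diff shift_diff(1) f)
      show "partial i g x = partial i f (x + h *\<^sub>R ?e) - partial i f x"
        using partial_eqI[OF has_derivative_diff[OF has_derivative_partial[OF shift_diff(1)[of f x, OF f(1)]] has_derivative_partial[OF f(1)]], of i]
          shift_diff(2)[of f _ x, OF f(1)] exhaust_2[of i]
        unfolding g_def by (auto simp: axis_def)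
    qed
    have g'': "partial i g differentiable (at x)"
      "partial j (partial i g) x = partial j (partial i f) (x + h *\<^sub>R ?e) - partial j (partial i f) x" for i j x
    proof -
      have eq: "partial i g = (\<lambda>x. partial i f (x + h *\<^sub>R ?e) - partial i f x)" using g' by blast
      show "partial i g differentiable (at x)"
        unfolding eq by (intro differentiable_diff shift_diff(1) f)
      show "partial j (partial i g) x = partial j (partial i f) (x + h *\<^sub>R ?e) - partial j (partial i f) x"
        using partial_eqI[OF has_derivative_diff[OF has_derivative_partial[OF shift_diff(1)[of "partial i f" x, OF f(2)]] has_derivative_partial[OF f(2)]], of j]
          shift_diff(2)[of "partial i f" _ x, OF f(2)] exhaust_2[of j]
        unfolding eq by (auto simp: axis_def)
    qed
    have per_g: "biperiodic a g" "biperiodic a (partial 2 g)"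
    proof -
      show "biperiodic a g" using per biperiodic_shift[OF per, of "h *\<^sub>R ?e"] by (simp add: g_def biperiodic_def)
      then show "biperiodic a (partial 2 g)" using g'(1) by (rule biperiodic_partial)
    qed
    have cont_g: "continuous_on UNIV g" "continuous_on UNIV (partial i g)" "continuous_on UNIV (partial i (partial j g))" for i j
      using g'(2) g''(2) by (auto simp: g_def intro!: continuous_intros simp flip: fun_eq_iff
         cong: continuous_on_cong)
    let ?F = "partial 2 (partial 2 f)"
    \<comment> \<open>Discrete integration by parts: \<open>D h x\<close> is the increment of
      \<open>g\<close> between \<open>x - h *\<^sub>R ?e\<close> and \<open>x\<close>, and a
      translation moves this increment onto \<open>?F\<close>, which turns it into a second
      derivative of \<open>g\<close>. One ordinary integration by parts then leaves a
      square.\<close>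
    have "integral (Omega a) (\<lambda>x. D h x * ?F x)
        = integral (Omega a) (\<lambda>x. g x * ?F x) - integral (Omega a) (\<lambda>x. g (x - h *\<^sub>R ?e) * ?F x)"
      by (subst integral_diff[symmetric])
        (auto simp: D_def g_def algebra_simps intro!: integrable_on_Omega continuous_intros)
    also have "integral (Omega a) (\<lambda>x. g (x - h *\<^sub>R ?e) * ?F x) = integral (Omega a) (\<lambda>x. g x * ?F (x + h *\<^sub>R ?e))"
    proof -
      have "biperiodic a (\<lambda>x. g (x - h *\<^sub>R ?e) * ?F x)"
        using biperiodic_shift[OF per_g(1), of "- h *\<^sub>R ?e"] per2[of 2 2] by (simp add: biperiodic_def)
      moreover have "continuous_on UNIV (\<lambda>x. g (x - h *\<^sub>R ?e) * ?F x)"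
        by (auto simp: g_def intro!: continuous_intros)
      ultimately show ?thesis using integral_Omega_shift[OF a, of "\<lambda>x. g (x - h *\<^sub>R ?e) * ?F x" "h *\<^sub>R ?e"] by simp
    qed
    also have "integral (Omega a) (\<lambda>x. g x * ?F x) - integral (Omega a) (\<lambda>x. g x * ?F (x + h *\<^sub>R ?e))
       = - integral (Omega a) (\<lambda>x. g x * partial 2 (partial 2 g) x)"
      by (subst integral_diff[symmetric])
        (auto simp: g''(2) algebra_simps simp flip: integral_neg intro!: integrable_on_Omega continuous_intros cont_g)
    also have "\<dots> = integral (Omega a) (\<lambda>x. partial 2 g x * partial 2 g x)"
      using g'(1) g''(1) per_g cont_g by (subst integral_by_parts_Omega[OF a]) auto
    also have "\<dots> \<ge> 0"
      by (intro integral_nonneg integrable_on_Omega continuous_on_mult cont_g) auto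
    finally show ?thesis .
  qed
  obtain B where B: "B > 0" "\<And>x. \<bar>partial 1 (partial 1 f) x\<bar> \<le> B"
    using biperiodic_bounded[OF a per2 f(3)] by (metis real_norm_def)
  obtain C where C: "C > 0" "\<And>x. \<bar>partial 2 (partial 2 f) x\<bar> \<le> C"
    using biperiodic_bounded[OF a per2 f(3)] by (metis real_norm_def)
  have line: "((\<lambda>h. u (x + h *\<^sub>R ?e)) has_real_derivative partial 1 u (x + h *\<^sub>R ?e)) (at h)"
    if "\<And>x. u differentiable (at x)" for u x h
  proof -
    have "((\<lambda>h. x + h *\<^sub>R ?e) has_vector_derivative ?e) (at h)"
      by (auto intro!: derivative_eq_intros)
    from has_real_derivative_compose_partial[OF that this] show ?thesis by (simp add: axis_def)
  qed
  have line': "((\<lambda>h. u (x - h *\<^sub>R ?e)) has_real_derivative - partial 1 u (x - h *\<^sub>R ?e)) (at h)"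
    if "\<And>x. u differentiable (at x)" for u x h
  proof -
    have "((\<lambda>h. x - h *\<^sub>R ?e) has_vector_derivative - ?e) (at h)"
      by (auto intro!: derivative_eq_intros)
    from has_real_derivative_compose_partial[OF that this] show ?thesis by (simp add: axis_def)
  qed
  have D_eq: "\<exists>r. 0 < r \<and> r < h \<and>
      D h x = h\<^sup>2 / 2 * (partial 1 (partial 1 f) (x + r *\<^sub>R ?e) + partial 1 (partial 1 f) (x - r *\<^sub>R ?e))"
    if "h > 0" for h x
  proof -
    \<comment> \<open>\<open>d\<close> lists the derivatives of \<open>D\<close> in
      \<open>h\<close>. Those of order 0 and 1 vanish at 0, so the Maclaurin formula of order 2
      consists of its remainder alone.\<close>
    define d where "d = (\<lambda>m::nat. if m = 0 then (\<lambda>h. D h x)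
      else if m = 1 then (\<lambda>h. partial 1 f (x + h *\<^sub>R ?e) - partial 1 f (x - h *\<^sub>R ?e))
      else (\<lambda>h. partial 1 (partial 1 f) (x + h *\<^sub>R ?e) + partial 1 (partial 1 f) (x - h *\<^sub>R ?e)))"
    have "\<forall>m t. m < 2 \<and> 0 \<le> t \<and> t \<le> h \<longrightarrow> (d m has_real_derivative d (Suc m) t) (at t)"
      unfolding D_def d_def using f
      by (auto simp: less_2_cases_iff intro!: derivative_eq_intros line line')
    from Maclaurin[OF that _ _ this, of "\<lambda>h. D h x"] obtain r
      where "0 < r" "r < h" "D h x = (\<Sum>m<2. d m 0 / fact m * h ^ m) + d 2 r / fact 2 * h\<^sup>2"
      by (auto simp: d_def)
    then show ?thesis
      by (intro exI[of _ r]) (simp add: d_def D_def lessThan_nat_numeral lessThan_Suc)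
  qed
  define h where "h = (\<lambda>n::nat. 1 / (real n + 1))"
  have h: "h n > 0" for n by (simp add: h_def)
  have h_lim: "h \<longlonglongrightarrow> 0"
    using LIMSEQ_inverse_real_of_nat unfolding h_def by (simp add: inverse_eq_divide add.commute)
  let ?A = "partial 1 (partial 1 f)" and ?F = "partial 2 (partial 2 f)"
  \<comment> \<open>The intermediate point may depend on \<open>x\<close> arbitrarily: it enters the
    pointwise bound and the pointwise limit, while integrability is checked on \<open>D\<close>
    itself.\<close>
  define r where "r = (\<lambda>n x. SOME r. 0 < r \<and> r < h n \<and> D (h n) x = (h n)\<^sup>2 / 2 * (?A (x + r *\<^sub>R ?e) + ?A (x - r *\<^sub>R ?e)))"
  have r: "0 < r n x" "r n x < h n"
    "D (h n) x = (h n)\<^sup>2 / 2 * (?A (x + r n x *\<^sub>R ?e) + ?A (x - r n x *\<^sub>R ?e))" for n x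
    using someI_ex[OF D_eq[OF h[of n], of x]] unfolding r_def by auto
  have r_lim: "(\<lambda>n. r n x) \<longlonglongrightarrow> 0" for x
    by (rule tendsto_sandwich[OF _ _ tendsto_const h_lim]) (auto intro: always_eventually less_imp_le r)
  have quot: "D (h n) x / (h n)\<^sup>2 = (?A (x + r n x *\<^sub>R ?e) + ?A (x - r n x *\<^sub>R ?e)) / 2" for n x
    using h[of n] by (simp add: r(3))
  have "(\<lambda>n. integral (Omega a) (\<lambda>x. D (h n) x / (h n)\<^sup>2 * ?F x)) \<longlonglongrightarrow> integral (Omega a) (\<lambda>x. ?A x * ?F x)"
  proof (rule dominated_convergence(2))
    show "(\<lambda>x. D (h n) x / (h n)\<^sup>2 * ?F x) integrable_on Omega a" for n
      using h[of n] by (auto simp: D_def intro!: integrable_on_Omega continuous_intros)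
    show "(\<lambda>x. B * C) integrable_on Omega a" by (intro integrable_on_Omega continuous_intros)
    show "norm (D (h n) x / (h n)\<^sup>2 * ?F x) \<le> B * C" for n x
    proof -
      have "\<bar>D (h n) x / (h n)\<^sup>2\<bar> \<le> B"
        unfolding quot using B(2)[of "x + r n x *\<^sub>R ?e"] B(2)[of "x - r n x *\<^sub>R ?e"] by (simp add: abs_le_iff)
      then show ?thesis using C B by (simp only: real_norm_def abs_mult) (intro mult_mono, auto)
    qed
    show "(\<lambda>n. D (h n) x / (h n)\<^sup>2 * ?F x) \<longlonglongrightarrow> ?A x * ?F x" for x
    proof -
      have A: "isCont ?A y" for y using f(3) by (simp add: continuous_on_eq_continuous_at)
      have "(\<lambda>n. (?A (x + r n x *\<^sub>R ?e) + ?A (x - r n x *\<^sub>R ?e)) / 2 * ?F x)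
          \<longlonglongrightarrow> (?A (x + 0 *\<^sub>R ?e) + ?A (x - 0 *\<^sub>R ?e)) / 2 * ?F x"
        by (intro tendsto_intros isCont_tendsto_compose[OF A] r_lim) auto
      then show ?thesis unfolding quot by simp
    qed
  qed
  moreover have "0 \<le> integral (Omega a) (\<lambda>x. D (h n) x / (h n)\<^sup>2 * ?F x)" for n
    using D[of "h n"] by (simp add: divide_inverse mult.assoc mult.left_commute[of _ "inverse _"])
  ultimately show ?thesis
    by (intro tendsto_lowerbound[OF _ always_eventually trivial_limit_sequentially]) auto
qed

text \<open>The inequality of Wirtinger is applied to \<open>partial 1 f\<close> on each line of
  constant \<open>x\<^sub>2\<close>, where it has mean zero as the derivative of a periodic
  function. Passing from \<open>partial 1 (partial 1 f)\<close> to the Laplacian only enlarges the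
  integral, since the cross term of the square has nonnegative integral.\<close>

lemma integral_partial_1_le_laplacian:
  assumes a: "a > 0" and C2: "Ck 2 f" and per: "biperiodic a f"
  shows "a\<^sup>2 * integral (Omega a) (\<lambda>x. (partial 1 f x)\<^sup>2) \<le> integral (Omega a) (\<lambda>x. (laplacian f x)\<^sup>2)"
proof -
  have f: "\<And>x. f differentiable (at x)" "\<And>i x. partial i f differentiable (at x)"
    "\<And>i j. continuous_on UNIV (partial i (partial j f))"
    using C2 by (auto simp: numeral_2_eq_2)
  have cont: "\<And>i. continuous_on UNIV (partial i f)"
    using f by (auto intro: differentiable_imp_continuous_on_UNIV)
  let ?p = "partial 1 f" and ?A = "partial 1 (partial 1 f)" and ?F = "partial 2 (partial 2 f)" and ?P = "2 * pi / a"
  have per1: "u (vector [s + ?P, t]) = u (vector [s, t])" if "biperiodic a u" for s t and u :: "real^2 \<Rightarrow> real"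
  proof -
    have "vector [s + ?P, t] = vector [s, t] + (vector [?P, 0] :: real^2)"
      by (simp add: vec_eq_iff forall_2)
    then show ?thesis using that by (simp add: biperiodic_def)
  qed
  have c: "continuous_on S (\<lambda>s. u (vector [s, t]))" "continuous_on S (\<lambda>t. u (vector [s, t]))" 
    "continuous_on T (\<lambda>(s, t). u (vector [s, t]))"
    if "continuous_on UNIV u" for S s t T and u :: "real^2 \<Rightarrow> real"
    by (auto simp: case_prod_unfold intro!: continuous_on_UNIV_compose[OF that] continuous_intros)
  have slice: "a\<^sup>2 * integral {0..?P} (\<lambda>s. (?p (vector [s, t]))\<^sup>2) \<le> integral {0..?P} (\<lambda>s. (?A (vector [s, t]))\<^sup>2)" for t
  proof (rule wirtinger[OF a])
    show "((\<lambda>s. ?p (vector [s, t])) has_real_derivative ?A (vector [s, t])) (at s)" for s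
      by (intro partial_line_1 f)
    show "integral {0..?P} (\<lambda>s. ?p (vector [s, t])) = 0"
      using a per1[OF per, of 0 t] integral_unique[OF fundamental_theorem_of_calculus[of 0 ?P "\<lambda>s. f (vector [s, t])" "\<lambda>s. ?p (vector [s, t])"]]
      by (simp add: has_real_derivative_iff_has_vector_derivative[symmetric] partial_line_1 f)
  qed (auto intro!: c f per1 biperiodic_partial per)
  have "a\<^sup>2 * integral (Omega a) (\<lambda>x. (?p x)\<^sup>2) = integral {0..2 * pi} (\<lambda>t. a\<^sup>2 * integral {0..?P} (\<lambda>s. (?p (vector [s, t]))\<^sup>2))"
    unfolding Omega_eq_cbox by (subst integral_cbox_2') (auto intro!: continuous_intros cont)
  also have "\<dots> \<le> integral {0..2 * pi} (\<lambda>t. integral {0..?P} (\<lambda>s. (?A (vector [s, t]))\<^sup>2))"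
  proof (rule integral_le[OF _ _ slice])
    have int: "(\<lambda>t. integral {0..?P} (\<lambda>s. (u (vector [s, t]))\<^sup>2)) integrable_on {0..2 * pi}"
      if "continuous_on UNIV u" for u :: "real^2 \<Rightarrow> real"
    proof -
      have "continuous_on T (\<lambda>(t, s). (u (vector [s, t]))\<^sup>2)" for T
        by (auto simp: case_prod_unfold intro!: continuous_on_power continuous_on_UNIV_compose[OF that] continuous_intros)
      from integral_continuous_on_param[of "{0..2 * pi}" 0 ?P, OF this] show ?thesis
        by (intro integrable_continuous_real) simp
    qed
    show "(\<lambda>t. a\<^sup>2 * integral {0..?P} (\<lambda>s. (?p (vector [s, t]))\<^sup>2)) integrable_on {0..2 * pi}"
      using int[OF cont, of 1] by (rule integrable_on_mult_right)
    show "(\<lambda>t. integral {0..?P} (\<lambda>s. (?A (vector [s, t]))\<^sup>2)) integrable_on {0..2 * pi}"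
      by (rule int[OF f(3)])
  qed
  also have "\<dots> = integral (Omega a) (\<lambda>x. (?A x)\<^sup>2)"
    unfolding Omega_eq_cbox by (subst integral_cbox_2') (auto intro!: continuous_intros f)
  also have "\<dots> \<le> integral (Omega a) (\<lambda>x. (?A x)\<^sup>2) + integral (Omega a) (\<lambda>x. 2 * (?A x * ?F x))"
    using integral_partial_11_22_nonneg[OF a C2 per] by simp
  also have "\<dots> = integral (Omega a) (\<lambda>x. (?A x)\<^sup>2 + 2 * (?A x * ?F x))"
    by (intro integral_add[symmetric] integrable_on_Omega continuous_intros f)
  also have "\<dots> \<le> integral (Omega a) (\<lambda>x. (laplacian f x)\<^sup>2)"
    unfolding laplacian_def
    by (intro integral_le integrable_on_Omega continuous_intros f) (simp add: power2_eq_square algebra_simps)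
  finally show ?thesis .
qed

section \<open>Smooth bump functions\<close>

text \<open>The derivative is an existential witness, so each closure proof can supply its own
  formula for it.\<close>

primrec Ck_real :: "nat \<Rightarrow> (real \<Rightarrow> real) \<Rightarrow> bool" where
  "Ck_real 0 g \<longleftrightarrow> continuous_on UNIV g"
| "Ck_real (Suc k) g \<longleftrightarrow> (\<exists>g'. (\<forall>t. (g has_real_derivative g' t) (at t)) \<and> Ck_real k g')"

lemma Ck_real_SucD: "Ck_real (Suc k) g \<Longrightarrow> Ck_real k g"
proof (induction k arbitrary: g)
  case 0
  then show ?case by (auto intro!: continuous_at_imp_continuous_on intro: DERIV_isCont)
next
  case (Suc k)
  then show ?case by (metis Ck_real.simps(2))
qed

lemma Ck_real_imp_continuous: "Ck_real k g \<Longrightarrow> continuous_on UNIV g"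
  by (induction k) (auto dest: Ck_real_SucD simp del: Ck_real.simps(2))

lemma Ck_real_cmult: "Ck_real k f \<Longrightarrow> Ck_real k (\<lambda>t. c * f t)"
proof (induction k arbitrary: f)
  case 0
  then show ?case by (auto intro: continuous_intros)
next
  case (Suc k)
  then obtain f' where f': "\<forall>t. (f has_real_derivative f' t) (at t)" "Ck_real k f'" by auto
  then have "\<forall>t. ((\<lambda>t. c * f t) has_real_derivative c * f' t) (at t)"
    by (auto intro!: derivative_eq_intros)
  then show ?case using Suc.IH[OF f'(2)] by auto
qed

lemma Ck_real_add: "Ck_real k f \<Longrightarrow> Ck_real k g \<Longrightarrow> Ck_real k (\<lambda>t. f t + g t)"
proof (induction k arbitrary: f g)
  case 0
  then show ?case by (auto intro: continuous_intros)
next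
  case (Suc k)
  then obtain f' g' where d: "\<forall>t. (f has_real_derivative f' t) (at t)" "Ck_real k f'"
    "\<forall>t. (g has_real_derivative g' t) (at t)" "Ck_real k g'" by auto
  then have "\<forall>t. ((\<lambda>t. f t + g t) has_real_derivative f' t + g' t) (at t)"
    by (auto intro!: derivative_eq_intros)
  then show ?case using Suc.IH[OF d(2,4)] by auto
qed

lemma Ck_real_mult: "Ck_real k f \<Longrightarrow> Ck_real k g \<Longrightarrow> Ck_real k (\<lambda>t. f t * g t)"
proof (induction k arbitrary: f g)
  case 0
  then show ?case by (auto intro: continuous_intros)
next
  case (Suc k)
  then obtain f' g' where d: "\<forall>t. (f has_real_derivative f' t) (at t)" "Ck_real k f'"
    "\<forall>t. (g has_real_derivative g' t) (at t)" "Ck_real k g'" by auto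
  then have "\<forall>t. ((\<lambda>t. f t * g t) has_real_derivative f' t * g t + f t * g' t) (at t)"
    by (auto intro!: derivative_eq_intros)
  moreover have "Ck_real k (\<lambda>t. f' t * g t + f t * g' t)"
    using Suc.prems d by (intro Ck_real_add Suc.IH Ck_real_SucD[of k f] Ck_real_SucD[of k g])
  ultimately show ?case by auto
qed

lemma Ck_real_affine: "Ck_real k f \<Longrightarrow> Ck_real k (\<lambda>t. f (m * t + c))"
proof (induction k arbitrary: f)
  case 0
  then have "continuous_on UNIV f" by simp
  then have "continuous_on UNIV (\<lambda>t. f (m * t + c))"
    by (rule continuous_on_UNIV_compose) (intro continuous_intros)
  then show ?case by simp
next
  case (Suc k)
  then obtain f' where f': "\<And>t. (f has_real_derivative f' t) (at t)" "Ck_real k f'" by auto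
  have "((\<lambda>t. f (m * t + c)) has_real_derivative f' (m * t + c) * m) (at t)" for t
    by (rule DERIV_chain2[OF f'(1)]) (auto intro!: derivative_eq_intros)
  then have "\<forall>t. ((\<lambda>t. f (m * t + c)) has_real_derivative m * f' (m * t + c)) (at t)"
    by (simp add: mult.commute)
  then show ?case using Ck_real_cmult[OF Suc.IH[OF f'(2)]] by auto
qed

text \<open>All powers of \<open>t\<close> in the denominator are treated together because
  differentiation maps the family into its own linear combinations; smoothness is then one induction
  on the order, for all \<open>j\<close> at once.\<close>

definition flat_exp :: "nat \<Rightarrow> real \<Rightarrow> real" where
  "flat_exp j t = (if t \<le> 0 then 0 else exp (- (1 / t)) / t ^ j)"

text \<open>With \<open>1 / t\<close> as the variable this is the fact that exponentials outgrow
  powers.\<close>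

lemma flat_exp_tendsto_0: "(flat_exp j \<longlongrightarrow> 0) (at 0)"
proof -
  have "((\<lambda>t::real. (1 / t) ^ j / exp (1 / t)) \<longlongrightarrow> 0) (at_right 0)"
    using filterlim_compose[OF tendsto_power_div_exp_0 filterlim_inverse_at_top_right]
    by (simp add: inverse_eq_divide)
  then have "(flat_exp j \<longlongrightarrow> 0) (at_right 0)"
    by (rule Lim_transform_eventually)
      (auto simp: flat_exp_def eventually_at_filter exp_minus field_simps)
  moreover have "(flat_exp j \<longlongrightarrow> 0) (at_left 0)"
    by (rule Lim_transform_eventually[OF tendsto_const]) (auto simp: flat_exp_def eventually_at_filter)
  ultimately show ?thesis by (simp add: filterlim_split_at)
qed

lemma flat_exp_has_derivative:
  "(flat_exp j has_real_derivative - real j * flat_exp (j + 1) t + flat_exp (j + 2) t) (at t)"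
proof (cases t "0 :: real" rule: linorder_cases)
  case less
  have "((\<lambda>t. 0) has_real_derivative 0) (at t)" by simp
  then have "(flat_exp j has_real_derivative 0) (at t)"
    by (rule has_field_derivative_transform_within_open[of _ _ _ "{..<0}"]) (use less in \<open>auto simp: flat_exp_def\<close>)
  then show ?thesis using less by (simp add: flat_exp_def)
next
  case equal
  \<comment> \<open>The difference quotient at 0 is the next member of the family, whose limit at 0
    is known; at \<open>h = 0\<close> both sides are 0.\<close>
  have "(\<lambda>h. flat_exp j h / h) = flat_exp (j + 1)"
    by (auto simp: flat_exp_def fun_eq_iff)
  then have "(flat_exp j has_real_derivative 0) (at 0)"
    using flat_exp_tendsto_0[of "j + 1"] by (simp add: has_field_derivative_iff flat_exp_def)
  then show ?thesis using equal by (simp add: flat_exp_def)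
next
  case greater
  have pow: "((\<lambda>t. t ^ j) has_real_derivative real j * t ^ j / t) (at t)"
    using DERIV_pow[of j t] greater by (cases j) auto
  have ex: "((\<lambda>t. exp (- (1 / t))) has_real_derivative exp (- (1 / t)) / t\<^sup>2) (at t)"
    using greater by (auto intro!: derivative_eq_intros simp: power2_eq_square)
  have "((\<lambda>t. exp (- (1 / t)) / t ^ j) has_real_derivative - real j * flat_exp (j + 1) t + flat_exp (j + 2) t) (at t)"
    by (rule DERIV_cong[OF DERIV_divide[OF ex pow]])
      (use greater in \<open>auto simp: flat_exp_def field_simps power2_eq_square\<close>)
  then show ?thesis
    by (rule has_field_derivative_transform_within_open[of _ _ _ "{0<..}"]) (use greater in \<open>auto simp: flat_exp_def\<close>)
qed

lemma Ck_real_flat_exp: "Ck_real k (flat_exp j)"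
proof (induction k arbitrary: j)
  case 0
  show ?case
    using flat_exp_has_derivative by (auto intro!: continuous_at_imp_continuous_on intro: DERIV_isCont)
next
  case (Suc k)
  have "Ck_real k (\<lambda>t. - real j * flat_exp (j + 1) t + flat_exp (j + 2) t)"
    by (intro Ck_real_add Ck_real_cmult Suc.IH)
  then show ?case using flat_exp_has_derivative[of j] by (subst Ck_real.simps) (intro exI conjI allI, assumption+)
qed

text \<open>The profile of the test functions. Evenness of \<open>b\<close> and oddness of
  \<open>b'\<close> later remove the unwanted moments of the kernel, and positivity keeps its mass
  from vanishing.\<close>

lemma bump_exists:
  obtains b b' :: "real \<Rightarrow> real"
  where "\<And>k. Ck_real k b" "\<And>t. (b has_real_derivative b' t) (at t)" "continuous_on UNIV b" "continuous_on UNIV b'"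
    "\<And>t. b (- t) = b t" "\<And>t. b' (- t) = - b' t"
    "\<And>t. \<bar>t\<bar> \<ge> 1 \<Longrightarrow> b t = 0" "\<And>t. \<bar>t\<bar> \<ge> 1 \<Longrightarrow> b' t = 0" "\<And>t. \<bar>t\<bar> < 1 \<Longrightarrow> b t > 0"
proof -
  define b where "b = (\<lambda>t. flat_exp 0 (1 + t) * flat_exp 0 (1 - t))"
  have Ck: "Ck_real k b" for k
    unfolding b_def
    using Ck_real_affine[OF Ck_real_flat_exp[of k 0], of 1 1] Ck_real_affine[OF Ck_real_flat_exp[of k 0], of "-1" 1]
    by (intro Ck_real_mult) (simp_all add: add.commute)
  obtain b' where b': "\<And>t. (b has_real_derivative b' t) (at t)" "Ck_real 1 b'"
    using Ck[of 2] by (auto simp: numeral_2_eq_2)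
  have even: "b (- t) = b t" for t by (simp add: b_def mult.commute)
  have odd: "b' (- t) = - b' t" for t
  proof -
    have "((\<lambda>t. b (- t)) has_real_derivative - b' (- t)) (at t)"
      by (rule DERIV_chain2[OF b'(1), THEN DERIV_cong]) (auto intro!: derivative_eq_intros)
    then have "(b has_real_derivative - b' (- t)) (at t)" by (simp add: even)
    then show ?thesis using DERIV_unique[OF b'(1)[of t]] by simp
  qed
  have zero: "b t = 0" if "\<bar>t\<bar> \<ge> 1" for t using that by (auto simp: b_def flat_exp_def abs_if split: if_splits)
  have pos: "b t > 0" if "\<bar>t\<bar> < 1" for t using that by (auto simp: b_def flat_exp_def)
  \<comment> \<open>Where \<open>\<bar>t\<bar> \<ge> 1\<close> the value 0 is a global minimum of
    \<open>b\<close>; this includes the points with \<open>\<bar>t\<bar> = 1\<close>.\<close>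
  have zero': "b' t = 0" if "\<bar>t\<bar> \<ge> 1" for t
  proof (rule DERIV_local_min[OF b'(1) zero_less_one], intro allI impI)
    show "b t \<le> b s" for s using zero[OF that] zero[of s] pos[of s] by (cases "\<bar>s\<bar> < 1") auto
  qed
  show ?thesis
    by (rule that[OF Ck b'(1) Ck_real_imp_continuous[OF Ck[of 0]] Ck_real_imp_continuous[OF b'(2)] even odd zero zero' pos])
qed

section \<open>Products of one-variable functions on the plane\<close>

lemma has_derivative_prod_2:
  assumes "(f has_real_derivative f') (at (z $ 1))" "(g has_real_derivative g') (at (z $ 2))"
  shows "((\<lambda>z::real^2. f (z $ 1) * g (z $ 2)) has_derivative (\<lambda>h. h $ 1 * (f' * g (z $ 2)) + h $ 2 * (f (z $ 1) * g'))) (at z)"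
proof -
  have "((\<lambda>z::real^2. f (z $ 1)) has_derivative (\<lambda>h. f' * h $ 1)) (at z)"
    using DERIV_compose_FDERIV[OF assms(1) bounded_linear_imp_has_derivative[OF bounded_linear_vec_nth]]
    by (simp add: mult.commute)
  moreover have "((\<lambda>z::real^2. g (z $ 2)) has_derivative (\<lambda>h. g' * h $ 2)) (at z)"
    using DERIV_compose_FDERIV[OF assms(2) bounded_linear_imp_has_derivative[OF bounded_linear_vec_nth]]
    by (simp add: mult.commute)
  ultimately have "((\<lambda>z::real^2. f (z $ 1) * g (z $ 2)) has_derivative (\<lambda>h. f (z $ 1) * (g' * h $ 2) + f' * h $ 1 * g (z $ 2))) (at z)"
    by (rule has_derivative_mult)
  then show ?thesis by (simp add: mult_ac add_ac)
qed

lemma partial_prod_2: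
  assumes "\<And>t. (f has_real_derivative f' t) (at t)" "\<And>t. (g has_real_derivative g' t) (at t)"
  shows "(\<lambda>z::real^2. f (z $ 1) * g (z $ 2)) differentiable (at z)"
    and "partial 1 (\<lambda>z. f (z $ 1) * g (z $ 2)) = (\<lambda>z. f' (z $ 1) * g (z $ 2))"
    and "partial 2 (\<lambda>z. f (z $ 1) * g (z $ 2)) = (\<lambda>z. f (z $ 1) * g' (z $ 2))"
proof -
  note D = has_derivative_prod_2[OF assms(1,2)]
  show "(\<lambda>z::real^2. f (z $ 1) * g (z $ 2)) differentiable (at z)" using D differentiableI by blast
  show "partial 1 (\<lambda>z. f (z $ 1) * g (z $ 2)) = (\<lambda>z. f' (z $ 1) * g (z $ 2))"
    "partial 2 (\<lambda>z. f (z $ 1) * g (z $ 2)) = (\<lambda>z. f (z $ 1) * g' (z $ 2))"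
    by (simp_all add: fun_eq_iff partial_eqI[OF D] axis_def)
qed

lemma Ck_prod_2:
  "Ck_real k f \<Longrightarrow> Ck_real k g \<Longrightarrow> Ck k (\<lambda>z. f (z $ 1) * g (z $ 2))"
proof (induction k arbitrary: f g)
  case 0
  then have fg: "continuous_on UNIV f" "continuous_on UNIV g" by auto
  have "continuous_on UNIV (\<lambda>z::real^2. f (z $ 1) * g (z $ 2))"
    by (intro continuous_on_mult continuous_on_UNIV_compose[OF fg(1)] continuous_on_UNIV_compose[OF fg(2)] continuous_intros)
  then show ?case by simp
next
  case (Suc k)
  then obtain f' g' where d: "\<And>t. (f has_real_derivative f' t) (at t)" "Ck_real k f'"
    "\<And>t. (g has_real_derivative g' t) (at t)" "Ck_real k g'" by auto
  have "Ck k (partial i (\<lambda>z. f (z $ 1) * g (z $ 2)))" for i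
    using exhaust_2[of i] Suc.IH[OF d(2) Ck_real_SucD[OF Suc.prems(2)]] Suc.IH[OF Ck_real_SucD[OF Suc.prems(1)] d(4)]
    by (auto simp: partial_prod_2(2,3)[OF d(1,3)])
  then show ?case using partial_prod_2(1)[OF d(1,3)] by simp
qed

lemma integral_cbox_prod:
  fixes f g :: "real \<Rightarrow> real"
  assumes fg: "continuous_on UNIV f" "continuous_on UNIV g"
  shows "integral (cbox (vector [a1, a2]) (vector [b1, b2])) (\<lambda>w::real^2. f (w $ 1) * g (w $ 2))
    = integral {a1..b1} f * integral {a2..b2} g"
proof -
  have "continuous_on UNIV (\<lambda>w::real^2. f (w $ 1) * g (w $ 2))"
    by (intro continuous_on_mult continuous_on_UNIV_compose[OF fg(1)] continuous_on_UNIV_compose[OF fg(2)] continuous_intros)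
  then show ?thesis by (simp add: integral_cbox_2)
qed

lemma integral_odd_eq_0:
  fixes f :: "real \<Rightarrow> real"
  assumes "\<And>t. f (- t) = - f t"
  shows "integral {- r..r} f = 0"
  using Henstock_Kurzweil_Integration.integral_reflect_real[of r "- r" f] by (simp add: assms)

section \<open>Weak identities on the torus\<close>

lemma minus_vector_2: "- vector [s, t] = (vector [- s, - t] :: real^2)"
  by (simp add: vec_eq_iff forall_2)

lemma integral_reflect_square:
  "integral (cbox (vector [-1, -1]) (vector [1, 1])) (\<lambda>w::real^2. f (- w)) = integral (cbox (vector [-1, -1]) (vector [1, 1])) f"
  for f :: "real^2 \<Rightarrow> real"
  using Henstock_Kurzweil_Integration.integral_reflect[of "vector [1, 1]" "vector [-1, -1]" f] by (simp add: minus_vector_2)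

lemma swap_Omega:
  fixes F :: "real^2 \<Rightarrow> real^2 \<Rightarrow> real"
  assumes "continuous_on UNIV (\<lambda>(x, w). F x w)"
  shows "integral (Omega a) (\<lambda>x. integral (cbox l u) (F x)) = integral (cbox l u) (\<lambda>w. integral (Omega a) (\<lambda>x. F x w))"
  unfolding Omega_eq_cbox
  by (rule integral_swap_continuous) (rule continuous_on_subset[OF assms], simp)

text \<open>Symmetrization in \<open>w\<close> turns \<open>V\<close> into the difference quotient \<open>(V (x + \<epsilon> w) - V x) / \<epsilon>\<close>, so that
  the limit \<open>\<epsilon> \<rightarrow> 0\<close> only needs continuity of \<open>L\<close>.\<close>
lemma renormalized_energy_identity:
  fixes L u \<theta> :: "real^2 \<Rightarrow> real" and V H :: "real^2 \<Rightarrow> real^2"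
  defines "S \<equiv> cbox (vector [-1, -1]) (vector [1, 1]) :: (real^2) set"
  assumes a: "a > 0" and \<kappa>: "\<kappa> \<noteq> 0"
    and L: "continuous_on UNIV L" "biperiodic a L" and u: "continuous_on UNIV u" "biperiodic a u"
    and V: "\<And>x. (V has_derivative V' x) (at x)" "biperiodic a V" "\<And>x y. norm (V x - V y) \<le> K * norm (x - y)"
      "continuous_on UNIV (\<lambda>(x, w). V' x w)"
    and H: "continuous_on UNIV H" "\<And>w. H (- w) = - H w" and \<theta>: "continuous_on UNIV \<theta>" "integral S \<theta> \<noteq> 0"
    and weak: "\<And>\<epsilon> x. \<epsilon> > 0 \<Longrightarrow>
      integral S (\<lambda>w. L (x + \<epsilon> *\<^sub>R w) * (V (x + \<epsilon> *\<^sub>R w) \<bullet> H w)) = \<epsilon> * \<kappa> * integral S (\<lambda>w. u (x + \<epsilon> *\<^sub>R w) * \<theta> w)"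
    and div: "\<And>x. integral S (\<lambda>w. V' x w \<bullet> H w) = 0"
  shows "integral (Omega a) (\<lambda>x. L x * u x) = 0"
proof -
  have V_cont: "continuous_on UNIV V"
    using V(1) by (intro continuous_at_imp_continuous_on ballI has_derivative_continuous) auto
  have [continuous_intros]: "continuous_on T (\<lambda>x. L (g x))" "continuous_on T (\<lambda>x. u (g x))"
    "continuous_on T (\<lambda>x. V (g x))" "continuous_on T (\<lambda>x. H (g x))" "continuous_on T (\<lambda>x. \<theta> (g x))"
    if "continuous_on T g" for T :: "'z::topological_space set" and g
    using that L(1) u(1) V_cont H(1) \<theta>(1) continuous_on_UNIV_compose by blast+
  have int_Omega: "f integrable_on Omega a" if "continuous_on UNIV f" for f :: "real^2 \<Rightarrow> real"
    by (rule integrable_on_Omega[OF that])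
  have int_S: "f integrable_on S" if "continuous_on UNIV f" for f :: "real^2 \<Rightarrow> real"
    unfolding S_def using continuous_on_subset[OF that] by (intro integrable_continuous) auto
  \<comment> \<open>\<open>D\<close> contains the increment of \<open>V\<close>, of order
    \<open>\<epsilon>\<close> by the Lipschitz bound, so \<open>D / \<epsilon>\<close> stays bounded
    and converges although \<open>L\<close> is only continuous.\<close>
  define D where "D = (\<lambda>\<epsilon> x w. L x * L (x + \<epsilon> *\<^sub>R w) * ((V (x + \<epsilon> *\<^sub>R w) - V x) \<bullet> H w))"
  have D_cont: "continuous_on UNIV (\<lambda>(x, w). D \<epsilon> x w)" for \<epsilon>
    unfolding D_def case_prod_unfold by (intro continuous_intros)
  have sym: "integral (Omega a) (\<lambda>x. integral S (D \<epsilon> x))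
     = 2 * \<epsilon> * \<kappa> * integral (Omega a) (\<lambda>x. integral S (\<lambda>w. L x * u (x + \<epsilon> *\<^sub>R w) * \<theta> w))" if "\<epsilon> > 0" for \<epsilon>
  proof -
    define A where "A = (\<lambda>x w. L x * L (x + \<epsilon> *\<^sub>R w) * (V (x + \<epsilon> *\<^sub>R w) \<bullet> H w))"
    define B where "B = (\<lambda>x w. L x * L (x + \<epsilon> *\<^sub>R w) * (V x \<bullet> H w))"
    have A_cont: "continuous_on UNIV (\<lambda>(x, w). A x w)" and B_cont: "continuous_on UNIV (\<lambda>(x, w). B x w)"
      unfolding A_def B_def case_prod_unfold by (intro continuous_intros)+
    have A_eq: "integral S (A x) = \<epsilon> * \<kappa> * integral S (\<lambda>w. L x * u (x + \<epsilon> *\<^sub>R w) * \<theta> w)" for x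
    proof -
      have "integral S (A x) = L x * integral S (\<lambda>w. L (x + \<epsilon> *\<^sub>R w) * (V (x + \<epsilon> *\<^sub>R w) \<bullet> H w))"
        unfolding A_def by (simp add: mult.assoc)
      also have "\<dots> = L x * (\<epsilon> * \<kappa> * integral S (\<lambda>w. u (x + \<epsilon> *\<^sub>R w) * \<theta> w))"
        by (simp only: weak[OF that])
      also have "\<dots> = \<epsilon> * \<kappa> * integral S (\<lambda>w. L x * u (x + \<epsilon> *\<^sub>R w) * \<theta> w)"
        by (simp add: mult.assoc)
      finally show ?thesis .
    qed
    \<comment> \<open>Translation by \<open>\<epsilon> *\<^sub>R w\<close> exchanges the two
      arguments of \<open>L\<close>, and the oddness of \<open>H\<close> supplies the sign. After
      reflection in \<open>w\<close> the double integrals of \<open>A\<close> and \<open>B\<close>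
      are opposite, so that of \<open>D = A - B\<close> is twice that of \<open>A\<close>.\<close>
    have "integral (Omega a) (\<lambda>x. A x (- w)) = - integral (Omega a) (\<lambda>x. B x w)" for w
    proof -
      have "biperiodic a (\<lambda>x. A x (- w))"
        using L(2) V(2) biperiodic_shift[OF L(2), of "\<epsilon> *\<^sub>R - w"] biperiodic_shift[OF V(2), of "\<epsilon> *\<^sub>R - w"]
        unfolding A_def biperiodic_def by simp
      moreover have "continuous_on UNIV (\<lambda>x. A x (- w))"
        unfolding A_def by (intro continuous_intros)
      ultimately have "integral (Omega a) (\<lambda>x. A x (- w)) = integral (Omega a) (\<lambda>x. A (x + \<epsilon> *\<^sub>R w) (- w))"
        using integral_Omega_shift[OF a, of "\<lambda>x. A x (- w)" "\<epsilon> *\<^sub>R w"] by simp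
      also have "(\<lambda>x. A (x + \<epsilon> *\<^sub>R w) (- w)) = (\<lambda>x. - B x w)"
        by (simp add: A_def B_def H(2) fun_eq_iff mult.commute)
      finally show ?thesis by simp
    qed
    then have "integral S (\<lambda>w. integral (Omega a) (\<lambda>x. A x w)) = - integral S (\<lambda>w. integral (Omega a) (\<lambda>x. B x w))"
      using integral_reflect_square[of "\<lambda>w. integral (Omega a) (\<lambda>x. A x w)"] unfolding S_def by simp
    then have AB: "integral (Omega a) (\<lambda>x. integral S (B x)) = - integral (Omega a) (\<lambda>x. integral S (A x))"
      using swap_Omega[OF A_cont] swap_Omega[OF B_cont] unfolding S_def by simp
    have cont_param: "continuous_on UNIV (\<lambda>x. integral S (F x))" if "continuous_on UNIV (\<lambda>(x, w). F x w)"
      for F :: "real^2 \<Rightarrow> real^2 \<Rightarrow> real"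
      unfolding S_def by (rule integral_continuous_on_param) (rule continuous_on_subset[OF that], simp)
    have "D \<epsilon> x = (\<lambda>w. A x w - B x w)" for x
      by (simp add: D_def A_def B_def fun_eq_iff inner_diff_left algebra_simps)
    moreover have "A x integrable_on S" "B x integrable_on S" for x
      unfolding A_def B_def by (intro int_S continuous_intros)+
    ultimately have "integral S (D \<epsilon> x) = integral S (A x) - integral S (B x)" for x
      using integral_diff[of "A x" S "B x"] by simp
    then have "integral (Omega a) (\<lambda>x. integral S (D \<epsilon> x)) = integral (Omega a) (\<lambda>x. integral S (A x)) - integral (Omega a) (\<lambda>x. integral S (B x))"
      using integral_diff[OF int_Omega int_Omega, OF cont_param[OF A_cont] cont_param[OF B_cont]] by simp
    then show ?thesis using AB by (simp add: A_eq)
  qed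
  define \<epsilon> where "\<epsilon> = (\<lambda>n::nat. 1 / (real n + 1))"
  have \<epsilon>: "\<epsilon> n > 0" "\<epsilon> n \<le> 1" for n by (auto simp: \<epsilon>_def)
  have \<epsilon>_lim: "\<epsilon> \<longlonglongrightarrow> 0"
    using LIMSEQ_inverse_real_of_nat unfolding \<epsilon>_def by (simp add: inverse_eq_divide add.commute)
  \<comment> \<open>Both variables are put into one box, so that a single dominated convergence
    handles the double integral.\<close>
  define Q where "Q = cbox (vector [0, 0], vector [-1, -1]) (vector [2 * pi / a, 2 * pi] :: real^2, vector [1, 1] :: real^2)"
  have int_Q: "F integrable_on Q" and Q_eq: "integral Q F = integral (Omega a) (\<lambda>x. integral S (\<lambda>w. F (x, w)))"
    if "continuous_on UNIV F" for F :: "(real^2) \<times> (real^2) \<Rightarrow> real"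
    using continuous_on_subset[OF that] integral_prod_continuous[of _ _ _ _ F]
    unfolding Q_def S_def Omega_eq_cbox by (auto intro: integrable_continuous)
  have Q_S: "snd p \<in> S" if "p \<in> Q" for p
    using that by (cases p) (auto simp: Q_def S_def cbox_Pair_eq)
  obtain BL where BL: "BL > 0" "\<And>x. \<bar>L x\<bar> \<le> BL"
    using biperiodic_bounded[OF a L(2,1)] by (metis real_norm_def)
  obtain Bu where Bu: "Bu > 0" "\<And>x. \<bar>u x\<bar> \<le> Bu"
    using biperiodic_bounded[OF a u(2,1)] by (metis real_norm_def)
  have "bounded (H ` S)" "bounded (\<theta> ` S)" "bounded S"
    unfolding S_def
    by (intro compact_imp_bounded compact_continuous_image continuous_on_subset[OF H(1)] continuous_on_subset[OF \<theta>(1)]; simp)+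
  then obtain BH B\<theta> R where BH: "\<And>w. w \<in> S \<Longrightarrow> norm (H w) \<le> BH" and B\<theta>: "\<And>w. w \<in> S \<Longrightarrow> \<bar>\<theta> w\<bar> \<le> B\<theta>"
    and R: "\<And>w. w \<in> S \<Longrightarrow> norm w \<le> R"
    unfolding bounded_iff by force
  have lim1: "(\<lambda>n. integral Q (\<lambda>(x, w). D (\<epsilon> n) x w / \<epsilon> n)) \<longlonglongrightarrow> integral Q (\<lambda>(x, w). L x * L x * (V' x w \<bullet> H w))"
  proof (rule dominated_convergence(2))
    show "(\<lambda>(x, w). D (\<epsilon> n) x w / \<epsilon> n) integrable_on Q" for n
      using \<epsilon>(1)[of n] D_cont[of "\<epsilon> n"] unfolding case_prod_unfold by (intro int_Q continuous_intros) auto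
    show "(\<lambda>p. BL * BL * ((K * R) * BH)) integrable_on Q" by (intro int_Q continuous_intros)
    show "norm (case p of (x, w) \<Rightarrow> D (\<epsilon> n) x w / \<epsilon> n) \<le> BL * BL * ((K * R) * BH)" if "p \<in> Q" for n p
    proof -
      obtain x w where p: "p = (x, w)" by (cases p)
      have w: "w \<in> S" using Q_S[OF that] p by simp
      have "0 \<le> norm (V (axis 1 1) - V 0)" by simp
      also have "\<dots> \<le> K" using V(3)[of "axis 1 1" 0] by simp
      finally have "0 \<le> K" .
      have "norm (V (x + \<epsilon> n *\<^sub>R w) - V x) \<le> K * (\<epsilon> n * norm w)"
        using V(3)[of "x + \<epsilon> n *\<^sub>R w" x] \<epsilon>(1)[of n] by simp
      also have "\<dots> \<le> K * (\<epsilon> n * R)"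
        using R[OF w] \<epsilon>(1)[of n] \<open>0 \<le> K\<close> by (intro mult_left_mono) auto
      finally have "norm (V (x + \<epsilon> n *\<^sub>R w) - V x) / \<epsilon> n \<le> K * R"
        using \<epsilon>(1)[of n] by (simp add: field_simps)
      moreover have "0 \<le> norm (V (x + \<epsilon> n *\<^sub>R w) - V x) / \<epsilon> n" using \<epsilon>(1)[of n] by simp
      ultimately have 1: "norm (V (x + \<epsilon> n *\<^sub>R w) - V x) / \<epsilon> n * norm (H w) \<le> (K * R) * BH"
        using BH[OF w] by (intro mult_mono) auto
      have "\<bar>(V (x + \<epsilon> n *\<^sub>R w) - V x) \<bullet> H w\<bar> / \<epsilon> n \<le> norm (V (x + \<epsilon> n *\<^sub>R w) - V x) * norm (H w) / \<epsilon> n"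
        using \<epsilon>(1)[of n] by (intro divide_right_mono Cauchy_Schwarz_ineq2) auto
      also have "\<dots> = norm (V (x + \<epsilon> n *\<^sub>R w) - V x) / \<epsilon> n * norm (H w)" by simp
      finally have 2: "\<bar>(V (x + \<epsilon> n *\<^sub>R w) - V x) \<bullet> H w\<bar> / \<epsilon> n \<le> (K * R) * BH" using 1 by linarith
      have "norm (case p of (x, w) \<Rightarrow> D (\<epsilon> n) x w / \<epsilon> n)
          = \<bar>L x\<bar> * \<bar>L (x + \<epsilon> n *\<^sub>R w)\<bar> * (\<bar>(V (x + \<epsilon> n *\<^sub>R w) - V x) \<bullet> H w\<bar> / \<epsilon> n)"
        using \<epsilon>(1)[of n] by (simp add: p D_def abs_mult)
      also have "\<dots> \<le> BL * BL * ((K * R) * BH)"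
        using 2 BL \<epsilon>(1)[of n] by (intro mult_mono) auto
      finally show ?thesis .
    qed
    show "(\<lambda>n. case p of (x, w) \<Rightarrow> D (\<epsilon> n) x w / \<epsilon> n) \<longlonglongrightarrow> (case p of (x, w) \<Rightarrow> L x * L x * (V' x w \<bullet> H w))" for p
    proof -
      obtain x w where p: "p = (x, w)" by (cases p)
      have vder: "((\<lambda>\<epsilon>. V (x + \<epsilon> *\<^sub>R w)) has_vector_derivative V' x w) (at 0)"
      proof -
        have "((\<lambda>\<epsilon>. x + \<epsilon> *\<^sub>R w) has_derivative (\<lambda>h. h *\<^sub>R w)) (at 0)"
          by (auto intro!: derivative_eq_intros)
        from has_derivative_compose[OF this, of V "V' x"] V(1)[of x]
        have "((\<lambda>\<epsilon>. V (x + \<epsilon> *\<^sub>R w)) has_derivative (\<lambda>h. V' x (h *\<^sub>R w))) (at 0)" by simp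
        moreover have "V' x (h *\<^sub>R w) = h *\<^sub>R V' x w" for h
          using has_derivative_bounded_linear[OF V(1)[of x]] by (simp add: linear_simps)
        ultimately show ?thesis by (simp add: has_vector_derivative_def)
      qed
      have "((\<lambda>\<epsilon>. (V (x + \<epsilon> *\<^sub>R w) - V x) /\<^sub>R \<epsilon>) \<longlongrightarrow> V' x w) (at 0)" (is ?quot)
      proof -
        have "((\<lambda>h. norm (V (x + h *\<^sub>R w) - V x - h *\<^sub>R V' x w) / norm h) \<longlongrightarrow> 0) (at 0)"
          using vder by (simp add: has_vector_derivative_def has_derivative_at)
        moreover have "norm (V (x + h *\<^sub>R w) - V x - h *\<^sub>R V' x w) / norm h
            = norm ((V (x + h *\<^sub>R w) - V x) /\<^sub>R h - V' x w)" if "h \<noteq> 0" for h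
        proof -
          have "(V (x + h *\<^sub>R w) - V x) /\<^sub>R h - V' x w = (V (x + h *\<^sub>R w) - V x - h *\<^sub>R V' x w) /\<^sub>R h"
            using that by (simp add: scaleR_diff_right)
          then show ?thesis by (simp add: divide_inverse mult.commute)
        qed
        ultimately have "((\<lambda>h. norm ((V (x + h *\<^sub>R w) - V x) /\<^sub>R h - V' x w)) \<longlongrightarrow> 0) (at 0)"
          by (elim Lim_transform_eventually) (auto simp: eventually_at_filter)
        then show ?quot by (rule LIM_zero_cancel[OF tendsto_norm_zero_cancel])
      qed
      moreover have "filterlim \<epsilon> (at 0) sequentially"
        using \<epsilon>_lim \<epsilon>(1) by (simp add: filterlim_at less_imp_neq[symmetric] always_eventually)
      ultimately have "(\<lambda>n. (V (x + \<epsilon> n *\<^sub>R w) - V x) /\<^sub>R \<epsilon> n) \<longlonglongrightarrow> V' x w"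
        by (rule filterlim_compose)
      moreover have "isCont L x" using L(1) by (simp add: continuous_on_eq_continuous_at)
      then have "(\<lambda>n. L (x + \<epsilon> n *\<^sub>R w)) \<longlonglongrightarrow> L x"
        by (rule isCont_tendsto_compose) (use tendsto_add[OF tendsto_const tendsto_scaleR[OF \<epsilon>_lim tendsto_const]] in auto)
      ultimately have "(\<lambda>n. L x * L (x + \<epsilon> n *\<^sub>R w) * (((V (x + \<epsilon> n *\<^sub>R w) - V x) /\<^sub>R \<epsilon> n) \<bullet> H w))
          \<longlonglongrightarrow> L x * L x * (V' x w \<bullet> H w)"
        by (intro tendsto_intros)
      then show ?thesis by (simp add: p D_def divide_inverse mult_ac)
    qed
  qed
  have lim2: "(\<lambda>n. integral Q (\<lambda>(x, w). L x * u (x + \<epsilon> n *\<^sub>R w) * \<theta> w)) \<longlonglongrightarrow> integral Q (\<lambda>(x, w). L x * u x * \<theta> w)"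
  proof (rule dominated_convergence(2))
    show "(\<lambda>(x, w). L x * u (x + \<epsilon> n *\<^sub>R w) * \<theta> w) integrable_on Q" for n
      unfolding case_prod_unfold by (intro int_Q continuous_intros)
    show "(\<lambda>p. BL * Bu * B\<theta>) integrable_on Q" by (intro int_Q continuous_intros)
    show "norm (case p of (x, w) \<Rightarrow> L x * u (x + \<epsilon> n *\<^sub>R w) * \<theta> w) \<le> BL * Bu * B\<theta>" if "p \<in> Q" for n p
      using Q_S[OF that] BL Bu B\<theta> by (cases p) (auto simp: abs_mult intro!: mult_mono)
    show "(\<lambda>n. case p of (x, w) \<Rightarrow> L x * u (x + \<epsilon> n *\<^sub>R w) * \<theta> w) \<longlonglongrightarrow> (case p of (x, w) \<Rightarrow> L x * u x * \<theta> w)" for p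
    proof -
      obtain x w where p: "p = (x, w)" by (cases p)
      have "isCont u x" using u(1) by (simp add: continuous_on_eq_continuous_at)
      then have "(\<lambda>n. u (x + \<epsilon> n *\<^sub>R w)) \<longlonglongrightarrow> u x"
        by (rule isCont_tendsto_compose) (use tendsto_add[OF tendsto_const tendsto_scaleR[OF \<epsilon>_lim tendsto_const]] in auto)
      then show ?thesis unfolding p by (auto intro!: tendsto_intros)
    qed
  qed
  have "integral Q (\<lambda>(x, w). D (\<epsilon> n) x w / \<epsilon> n) = 2 * \<kappa> * integral Q (\<lambda>(x, w). L x * u (x + \<epsilon> n *\<^sub>R w) * \<theta> w)" for n
  proof -
    have "integral Q (\<lambda>(x, w). D (\<epsilon> n) x w / \<epsilon> n) = integral Q (\<lambda>(x, w). D (\<epsilon> n) x w) / \<epsilon> n"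
      by (simp add: case_prod_unfold)
    also have "integral Q (\<lambda>(x, w). D (\<epsilon> n) x w) = integral (Omega a) (\<lambda>x. integral S (D (\<epsilon> n) x))"
      using Q_eq[OF D_cont] by simp
    also have "\<dots> = 2 * \<epsilon> n * \<kappa> * integral (Omega a) (\<lambda>x. integral S (\<lambda>w. L x * u (x + \<epsilon> n *\<^sub>R w) * \<theta> w))"
      by (rule sym[OF \<epsilon>(1)])
    also have "integral (Omega a) (\<lambda>x. integral S (\<lambda>w. L x * u (x + \<epsilon> n *\<^sub>R w) * \<theta> w)) = integral Q (\<lambda>(x, w). L x * u (x + \<epsilon> n *\<^sub>R w) * \<theta> w)"
      by (subst Q_eq) (auto simp: case_prod_unfold intro!: continuous_intros)
    finally show ?thesis using \<epsilon>(1)[of n] by simp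
  qed
  \<comment> \<open>In the limit the left side carries the factor
    \<open>V' x w \<bullet> H w\<close>, whose integral over \<open>w\<close> vanishes for each
    \<open>x\<close>; the right side splits off the mass of \<open>\<theta>\<close>.\<close>
  with lim1 tendsto_mult_left[OF lim2, of "2 * \<kappa>"]
  have "integral Q (\<lambda>(x, w). L x * L x * (V' x w \<bullet> H w)) = 2 * \<kappa> * integral Q (\<lambda>(x, w). L x * u x * \<theta> w)"
    using LIMSEQ_unique by simp
  moreover have "integral Q (\<lambda>(x, w). L x * L x * (V' x w \<bullet> H w)) = 0"
  proof -
    have "continuous_on UNIV (\<lambda>(x, w). L x * L x * (V' x w \<bullet> H w))"
      using V(4) unfolding case_prod_unfold by (intro continuous_intros)
    then show ?thesis by (simp add: Q_eq div)
  qed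
  moreover have "integral Q (\<lambda>(x, w). L x * u x * \<theta> w) = integral (Omega a) (\<lambda>x. L x * u x) * integral S \<theta>"
  proof -
    have "continuous_on UNIV (\<lambda>(x, w). L x * u x * \<theta> w)"
      unfolding case_prod_unfold by (intro continuous_intros)
    then show ?thesis by (simp add: Q_eq)
  qed
  ultimately show ?thesis using \<theta>(2) \<kappa> by simp
qed

text \<open>The identity is multiplied by \<open>cos (x $ 2)\<close> and integrated, and the
  translation is moved onto the cosine. The kernels reproduce the cosine and its derivative up to
  one common factor \<open>c\<close>, which cancels, so a kernel of fixed width suffices.\<close>

lemma weak_identity_against_cos:
  fixes L u \<theta> :: "real^2 \<Rightarrow> real" and V H :: "real^2 \<Rightarrow> real^2"
  defines "S \<equiv> cbox (vector [-1, -1]) (vector [1, 1]) :: (real^2) set"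
  assumes a: "a > 0"
    and L: "continuous_on UNIV L" "biperiodic a L" and u: "continuous_on UNIV u" "biperiodic a u"
    and V: "continuous_on UNIV V" "biperiodic a V"
    and H: "continuous_on UNIV H" and \<theta>: "continuous_on UNIV \<theta>"
    and weak: "\<And>x. integral S (\<lambda>w. L (x + w) * (V (x + w) \<bullet> H w)) = \<kappa> * integral S (\<lambda>w. u (x + w) * \<theta> w)"
    and cos_H: "\<And>s y. integral S (\<lambda>w. cos (s - w $ 2) * (y \<bullet> H w)) = - c * sin s * y $ 2"
    and cos_\<theta>: "\<And>s. integral S (\<lambda>w. cos (s - w $ 2) * \<theta> w) = c * cos s" and c: "c \<noteq> 0"
  shows "- integral (Omega a) (\<lambda>x. L x * sin (x $ 2) * V x $ 2) = \<kappa> * integral (Omega a) (\<lambda>x. u x * cos (x $ 2))"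
proof -
  have [continuous_intros]: "continuous_on T (\<lambda>x. L (g x))" "continuous_on T (\<lambda>x. u (g x))"
    "continuous_on T (\<lambda>x. V (g x))" "continuous_on T (\<lambda>x. H (g x))" "continuous_on T (\<lambda>x. \<theta> (g x))"
    if "continuous_on T g" for T :: "'z::topological_space set" and g
    using that L(1) u(1) V H(1) \<theta>(1) continuous_on_UNIV_compose by blast+
  have shift: "integral (Omega a) (\<lambda>x. cos (x $ 2) * F (x + w)) = integral (Omega a) (\<lambda>x. cos (x $ 2 - w $ 2) * F x)"
    if F: "continuous_on UNIV F" "biperiodic a F" for F w
  proof -
    have "continuous_on UNIV (\<lambda>x. cos (x $ 2) * F (x + w))"
      by (intro continuous_intros continuous_on_UNIV_compose[OF F(1)])
    moreover have "biperiodic a (\<lambda>x. cos (x $ 2) * F (x + w))"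
      using biperiodic_shift[OF F(2), of w] unfolding biperiodic_def by simp
    ultimately show ?thesis
      using integral_Omega_shift[OF a, of "\<lambda>x. cos (x $ 2) * F (x + w)" "- w"] by simp
  qed
  have "integral (Omega a) (\<lambda>x. cos (x $ 2) * integral S (\<lambda>w. L (x + w) * (V (x + w) \<bullet> H w)))
      = integral S (\<lambda>w. integral (Omega a) (\<lambda>x. cos (x $ 2) * (L (x + w) * (V (x + w) \<bullet> H w))))"
  proof -
    have "continuous_on UNIV (\<lambda>(x::real^2, w). cos (x $ 2) * (L (x + w) * (V (x + w) \<bullet> H w)))"
      unfolding case_prod_unfold by (intro continuous_intros)
    from swap_Omega[OF this] show ?thesis unfolding S_def by simp
  qed
  also have "\<dots> = integral S (\<lambda>w. integral (Omega a) (\<lambda>x. cos (x $ 2 - w $ 2) * (L x * (V x \<bullet> H w))))"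
  proof -
    have "biperiodic a (\<lambda>x. L x * (V x \<bullet> H w))" for w using L V unfolding biperiodic_def by simp
    then show ?thesis
      by (subst shift[of "\<lambda>x. L x * (V x \<bullet> H _)"]) (auto intro!: continuous_intros)
  qed
  also have "\<dots> = integral (Omega a) (\<lambda>x. integral S (\<lambda>w. cos (x $ 2 - w $ 2) * (L x * (V x \<bullet> H w))))"
  proof -
    have "continuous_on UNIV (\<lambda>(x::real^2, w::real^2). cos (x $ 2 - w $ 2) * (L x * (V x \<bullet> H w)))"
      unfolding case_prod_unfold by (intro continuous_intros)
    from swap_Omega[OF this] show ?thesis unfolding S_def by simp
  qed
  also have "\<dots> = integral (Omega a) (\<lambda>x. - c * (L x * sin (x $ 2) * V x $ 2))"
  proof -
    have "integral S (\<lambda>w. cos (x $ 2 - w $ 2) * (L x * (V x \<bullet> H w))) = L x * integral S (\<lambda>w. cos (x $ 2 - w $ 2) * (V x \<bullet> H w))" for x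
      by (simp add: mult.left_commute flip: integral_mult_right)
    then show ?thesis unfolding cos_H by (simp only:) (simp only: mult_ac mult_minus_left mult_minus_right)
  qed
  finally have 1: "integral (Omega a) (\<lambda>x. cos (x $ 2) * integral S (\<lambda>w. L (x + w) * (V (x + w) \<bullet> H w)))
    = - c * integral (Omega a) (\<lambda>x. L x * sin (x $ 2) * V x $ 2)" by simp
  have "integral (Omega a) (\<lambda>x. cos (x $ 2) * integral S (\<lambda>w. u (x + w) * \<theta> w))
      = integral S (\<lambda>w. integral (Omega a) (\<lambda>x. cos (x $ 2) * (u (x + w) * \<theta> w)))"
  proof -
    have "continuous_on UNIV (\<lambda>(x::real^2, w). cos (x $ 2) * (u (x + w) * \<theta> w))"
      unfolding case_prod_unfold by (intro continuous_intros)
    from swap_Omega[OF this] show ?thesis unfolding S_def by simp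
  qed
  also have "\<dots> = integral S (\<lambda>w. integral (Omega a) (\<lambda>x. cos (x $ 2 - w $ 2) * (u x * \<theta> w)))"
  proof -
    have "biperiodic a (\<lambda>x. u x * \<theta> w)" for w using u unfolding biperiodic_def by simp
    then show ?thesis
      by (subst shift[of "\<lambda>x. u x * \<theta> _"]) (auto intro!: continuous_intros)
  qed
  also have "\<dots> = integral (Omega a) (\<lambda>x. integral S (\<lambda>w. cos (x $ 2 - w $ 2) * (u x * \<theta> w)))"
  proof -
    have "continuous_on UNIV (\<lambda>(x::real^2, w::real^2). cos (x $ 2 - w $ 2) * (u x * \<theta> w))"
      unfolding case_prod_unfold by (intro continuous_intros)
    from swap_Omega[OF this] show ?thesis unfolding S_def by simp
  qed
  also have "\<dots> = integral (Omega a) (\<lambda>x. c * (u x * cos (x $ 2)))"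
  proof -
    have "integral S (\<lambda>w. cos (x $ 2 - w $ 2) * (u x * \<theta> w)) = u x * integral S (\<lambda>w. cos (x $ 2 - w $ 2) * \<theta> w)" for x
      by (simp add: mult.left_commute flip: integral_mult_right)
    then show ?thesis unfolding cos_\<theta> by (simp only:) (simp only: mult_ac)
  qed
  finally have 2: "integral (Omega a) (\<lambda>x. cos (x $ 2) * integral S (\<lambda>w. u (x + w) * \<theta> w))
    = c * integral (Omega a) (\<lambda>x. u x * cos (x $ 2))" by simp
  have "integral (Omega a) (\<lambda>x. cos (x $ 2) * integral S (\<lambda>w. L (x + w) * (V (x + w) \<bullet> H w)))
    = \<kappa> * integral (Omega a) (\<lambda>x. cos (x $ 2) * integral S (\<lambda>w. u (x + w) * \<theta> w))"
    by (simp add: weak mult.left_commute flip: integral_mult_right)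
  then have "c * - integral (Omega a) (\<lambda>x. L x * sin (x $ 2) * V x $ 2) = c * (\<kappa> * integral (Omega a) (\<lambda>x. u x * cos (x $ 2)))"
    using 1 2 by algebra
  then show ?thesis by (rule mult_left_cancel[OF c, THEN iffD1])
qed

section \<open>Flows of Lipschitz fields\<close>

lemma absolutely_integrable_compact_support:
  fixes f :: "'a::euclidean_space \<Rightarrow> 'b::euclidean_space"
  assumes f: "continuous_on UNIV f" and supp: "\<And>x. norm x > R \<Longrightarrow> f x = 0"
  shows "f absolutely_integrable_on UNIV"
proof -
  obtain c :: 'a where c: "cball 0 R \<subseteq> cbox (- c) c"
    using bounded_subset_cbox_symmetric[OF bounded_cball] by blast
  then have "f = (\<lambda>x. if x \<in> cbox (- c) c then f x else 0)"
  proof (intro ext)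
    show "f x = (if x \<in> cbox (- c) c then f x else 0)" for x
      using c supp[of x] by (cases "norm x > R") (auto simp: subset_iff)
  qed
  moreover have "f absolutely_integrable_on cbox (- c) c"
    by (rule absolutely_integrable_continuous[OF continuous_on_subset[OF f]]) simp
  ultimately show ?thesis by (metis absolutely_integrable_restrict_UNIV)
qed

lemma bounded_compact_support:
  fixes f :: "'a::euclidean_space \<Rightarrow> 'b::real_normed_vector"
  assumes f: "continuous_on UNIV f" and supp: "\<And>x. norm x > R \<Longrightarrow> f x = 0"
  obtains B where "B > 0" "\<And>x. norm (f x) \<le> B"
proof -
  have "bounded (f ` cball 0 R)"
    by (intro compact_imp_bounded compact_continuous_image continuous_on_subset[OF f]) auto
  then obtain B where B: "B > 0" "\<And>x. x \<in> cball 0 R \<Longrightarrow> norm (f x) \<le> B"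
    unfolding bounded_pos by auto
  show ?thesis
  proof (rule that[OF B(1)])
    show "norm (f x) \<le> B" for x using B supp[of x] by (cases "norm x > R") auto
  qed
qed

text \<open>The assumption \<open>det\<close> encodes incompressibility. The determinant is
  \<open>1 - h * \<tau> + h\<^sup>2 * \<delta>\<close> with trace \<open>\<tau>\<close> and
  determinant \<open>\<delta>\<close> of \<open>v' x\<close>, so the bound for all \<open>h\<close>
  says that \<open>\<tau> = 0\<close> and \<open>\<bar>\<delta>\<bar> \<le> C\<close>.\<close>

locale lipschitz_field =
  fixes v :: "real^2 \<Rightarrow> real^2" and v' :: "real^2 \<Rightarrow> real^2 \<Rightarrow> real^2" and K M C :: real
  assumes K: "K \<ge> 0" and M: "M \<ge> 0"
    and lipschitz: "norm (v x - v y) \<le> K * norm (x - y)" and bounded: "norm (v x) \<le> M"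
    and deriv: "(v has_derivative v' x) (at x)"
    and det: "\<bar>det (matrix (\<lambda>w. w - h *\<^sub>R v' x w)) - 1\<bar> \<le> C * h\<^sup>2"
begin

section \<open>Convergence of explicit Euler steps to trajectories\<close>

definition euler_step :: "real \<Rightarrow> real^2 \<Rightarrow> real^2" where
  "euler_step h x = x - h *\<^sub>R v x"

text \<open>The initial value is left out, so that time shifts of a trajectory are trajectories
  again.\<close>

definition is_trajectory :: "(real \<Rightarrow> real^2) \<Rightarrow> bool" where
  "is_trajectory z \<longleftrightarrow> continuous_on {0..} z \<and> (\<forall>t>0. (z has_vector_derivative - v (z t)) (at t))"

lemma continuous_v: "continuous_on UNIV v"
  using deriv by (intro continuous_at_imp_continuous_on ballI has_derivative_continuous) auto

lemma C_nonneg: "C \<ge> 0"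
  using det[of 1 0] abs_ge_zero order_trans by fastforce

lemma trajectory_displacement:
  assumes "is_trajectory z" "0 \<le> s" "s \<le> t"
  shows "norm (z t - z s) \<le> M * (t - s)"
proof (cases "s = t")
  case False
  have "norm (z t - z s) \<le> M * t - M * s"
    using assms False bounded
    by (intro differentiable_bound_general[of s t z "\<lambda>t. M * t" "\<lambda>t. - v (z t)" "\<lambda>_. M"])
      (auto simp: is_trajectory_def intro!: derivative_eq_intros continuous_intros intro: continuous_on_subset)
  then show ?thesis by (simp add: algebra_simps)
qed simp

text \<open>During one step the trajectory moves by at most \<open>M * h\<close>, hence its velocity
  changes by at most \<open>K * (M * h)\<close>; integration over the step gives the second factor
  \<open>h\<close>.\<close>

lemma euler_local_error:
  assumes z: "is_trajectory z" and t: "0 \<le> t" and h: "0 < h"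
  shows "norm (z (t + h) - euler_step h (z t)) \<le> K * M * h\<^sup>2"
proof -
  let ?q = "\<lambda>s. z s + s *\<^sub>R v (z t)"
  have "norm (?q (t + h) - ?q t) \<le> (K * (M * h)) * (t + h) - (K * (M * h)) * t"
  proof (rule differentiable_bound_general[of t "t + h" ?q "\<lambda>s. (K * (M * h)) * s" "\<lambda>s. v (z t) - v (z s)" "\<lambda>_. K * (M * h)"])
    show "continuous_on {t..t + h} ?q"
      using z t by (auto simp: is_trajectory_def intro!: continuous_intros intro: continuous_on_subset)
    show "(?q has_vector_derivative v (z t) - v (z s)) (at s)" if "t < s" "s < t + h" for s
      using z t that by (auto simp: is_trajectory_def intro!: derivative_eq_intros)
    show "norm (v (z t) - v (z s)) \<le> K * (M * h)" if "t < s" "s < t + h" for s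
    proof -
      have "norm (v (z t) - v (z s)) \<le> K * norm (z s - z t)"
        using lipschitz[of "z t" "z s"] by (simp add: norm_minus_commute)
      also have "\<dots> \<le> K * (M * (s - t))"
        using trajectory_displacement[OF z t, of s] that K by (intro mult_left_mono) auto
      also have "\<dots> \<le> K * (M * h)"
        using that K M by (intro mult_left_mono) auto
      finally show ?thesis .
    qed
  qed (use h in \<open>auto intro!: derivative_eq_intros continuous_intros\<close>)
  then show ?thesis by (simp add: euler_step_def algebra_simps power2_eq_square)
qed

lemma euler_step_lipschitz:
  assumes "0 \<le> h"
  shows "norm (euler_step h x - euler_step h y) \<le> (1 + h * K) * norm (x - y)"
proof -
  have "euler_step h x - euler_step h y = (x - y) - h *\<^sub>R (v x - v y)"
    by (simp add: euler_step_def algebra_simps)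
  also have "norm \<dots> \<le> norm (x - y) + h * norm (v x - v y)"
    using norm_triangle_ineq4[of "x - y" "h *\<^sub>R (v x - v y)"] assms by simp
  also have "\<dots> \<le> norm (x - y) + h * (K * norm (x - y))"
    using assms lipschitz by (intro add_left_mono mult_left_mono)
  finally show ?thesis by (simp add: algebra_simps)
qed

text \<open>A step adds the local error and multiplies the old error by at most
  \<open>1 + h * K\<close>. The resulting geometric sum is bounded by \<open>n\<close> copies of a
  power that dominates every term.\<close>

lemma euler_global_error:
  assumes z: "is_trajectory z" and h: "0 < h"
  shows "norm (z (real n * h) - (euler_step h ^^ n) (z 0)) \<le> real n * (K * M * h\<^sup>2) * (1 + h * K) ^ n"
proof (induction n)
  case (Suc n)
  let ?e = "K * M * h\<^sup>2" and ?l = "1 + h * K"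
  have l: "?l \<ge> 1" and e: "?e \<ge> 0" using h K M by auto
  have "z (real (Suc n) * h) - (euler_step h ^^ Suc n) (z 0)
      = (z (real n * h + h) - euler_step h (z (real n * h)))
        + (euler_step h (z (real n * h)) - euler_step h ((euler_step h ^^ n) (z 0)))"
    by (simp add: algebra_simps)
  also have "norm \<dots> \<le> ?e + ?l * norm (z (real n * h) - (euler_step h ^^ n) (z 0))"
    using h by (intro norm_triangle_mono euler_local_error[OF z] euler_step_lipschitz) auto
  also have "\<dots> \<le> ?e * ?l ^ Suc n + ?l * (real n * ?e * ?l ^ n)"
    using l e one_le_power[OF l, of "Suc n"] Suc.IH
    by (intro add_mono mult_left_mono mult_left_le[of "?e", simplified] mult_right_le_one_le) (auto intro: mult_le_cancel_left1[THEN iffD2])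
  also have "\<dots> = real (Suc n) * ?e * ?l ^ Suc n"
    by (simp add: algebra_simps)
  finally show ?case .
qed simp

text \<open>With \<open>N\<close> steps of length \<open>t / N\<close> the global error is of order
  \<open>1 / N\<close>, since \<open>(1 + t / N * K) ^ N\<close> stays below
  \<open>exp (t * K)\<close>. Counting by \<open>Suc n\<close> avoids a division by 0.\<close>

lemma euler_method_tendsto:
  assumes z: "is_trajectory z" and t: "0 < t"
  shows "(\<lambda>n. (euler_step (t / real (Suc n)) ^^ Suc n) (z 0)) \<longlonglongrightarrow> z t"
proof -
  have bound: "norm (z t - (euler_step (t / real (Suc n)) ^^ Suc n) (z 0)) \<le> K * M * t\<^sup>2 * exp (t * K) * inverse (real (Suc n))" for n
  proof -
    let ?N = "real (Suc n)"
    have N: "?N > 0" by simp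
    have "norm (z t - (euler_step (t / ?N) ^^ Suc n) (z 0)) \<le> ?N * (K * M * (t / ?N)\<^sup>2) * (1 + t / ?N * K) ^ Suc n"
      using euler_global_error[OF z, of "t / ?N" "Suc n"] t N by simp
    also have "\<dots> \<le> ?N * (K * M * (t / ?N)\<^sup>2) * exp (t * K)"
    proof (rule mult_left_mono)
      have "(1 + t / ?N * K) ^ Suc n \<le> exp (t / ?N * K) ^ Suc n"
        using t K N by (intro power_mono exp_ge_add_one_self) auto
      also have "\<dots> = exp (?N * (t / ?N * K))" by (rule exp_of_nat_mult[symmetric])
      also have "?N * (t / ?N * K) = t * K" using N by (simp del: of_nat_Suc)
      finally show "(1 + t / ?N * K) ^ Suc n \<le> exp (t * K)" .
    qed (use K M in auto)
    also have "?N * (K * M * (t / ?N)\<^sup>2) = K * M * t\<^sup>2 * inverse ?N"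
      using N by (simp add: power2_eq_square field_simps del: of_nat_Suc)
    finally show ?thesis by (simp only: mult_ac)
  qed
  have "(\<lambda>n. K * M * t\<^sup>2 * exp (t * K) * inverse (real (Suc n))) \<longlonglongrightarrow> 0"
    using tendsto_mult_right_zero[OF LIMSEQ_inverse_real_of_nat] by blast
  then have "(\<lambda>n. z t - (euler_step (t / real (Suc n)) ^^ Suc n) (z 0)) \<longlonglongrightarrow> 0"
    by (rule Lim_null_comparison[OF always_eventually, rotated]) (use bound in blast)
  from tendsto_diff[OF tendsto_const[of "z t"] this] show ?thesis by simp
qed

text \<open>Both are limits of the same Euler iterates, which see only the initial value.\<close>

lemma trajectory_unique:
  assumes "is_trajectory z" "is_trajectory w" "z 0 = w 0" "t \<ge> 0"
  shows "z t = w t"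
  using euler_method_tendsto[OF assms(1), of t] euler_method_tendsto[OF assms(2), of t] assms(3,4)
  by (cases "t = 0") (auto intro: LIMSEQ_unique)

lemma is_trajectory_shift:
  assumes z: "is_trajectory z" and t: "t \<ge> 0"
  shows "is_trajectory (\<lambda>s. z (t + s))"
  unfolding is_trajectory_def
proof (intro conjI allI impI)
  show "continuous_on {0..} (\<lambda>s. z (t + s))"
    by (rule continuous_on_compose2[of "{0..}" z])
      (use z t in \<open>auto simp: is_trajectory_def intro!: continuous_intros\<close>)
  show "((\<lambda>s. z (t + s)) has_vector_derivative - v (z (t + s))) (at s)" if "s > 0" for s
  proof -
    have "(z has_vector_derivative - v (z (t + s))) (at (t + s))"
      using z t that by (simp add: is_trajectory_def)
    moreover have "((\<lambda>s. t + s) has_vector_derivative 1) (at s)"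
      by (auto intro!: derivative_eq_intros)
    ultimately show ?thesis
      using vector_diff_chain_at[of "\<lambda>s. t + s" 1 s z] by (simp add: o_def)
  qed
qed

section \<open>Area distortion of Euler steps and of the flow\<close>

lemma euler_step_bij:
  assumes h: "0 < h" "h * K < 1"
  shows "inj (euler_step h)" "surj (euler_step h)"
proof -
  have lip: "dist (y + h *\<^sub>R v x) (y + h *\<^sub>R v x') \<le> (h * K) * dist x x'" for x x' y
    using mult_left_mono[OF lipschitz[of x x'], of h] h
    by (simp add: dist_norm mult.assoc flip: scaleR_diff_right)
  \<comment> \<open>A preimage of \<open>y\<close> is a fixed point of
    \<open>\<lambda>x. y + h *\<^sub>R v x\<close>, a contraction because
    \<open>h * K < 1\<close>.\<close>
  have "\<exists>!x. y + h *\<^sub>R v x = x" for y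
    using h K lip by (intro banach_fix_type[of "h * K"]) auto
  then have "\<exists>!x. euler_step h x = y" for y
    by (simp add: euler_step_def diff_eq_eq) metis
  then show "inj (euler_step h)" "surj (euler_step h)"
    by (metis injI, metis surjI)
qed

lemma continuous_euler_step: "continuous_on UNIV (euler_step h)"
  unfolding euler_step_def by (intro continuous_intros continuous_v)

lemma continuous_euler_steps: "continuous_on UNIV (euler_step h ^^ n)"
proof (induction n)
  case (Suc n)
  then show ?case using continuous_on_UNIV_compose[OF continuous_euler_step] by (simp add: o_def)
qed (simp add: continuous_on_id id_def)

lemma euler_step_displacement:
  assumes "0 \<le> h"
  shows "norm (euler_step h x - x) \<le> h * M"
  using assms bounded by (simp add: euler_step_def mult_left_mono)

lemma euler_steps_displacement:
  assumes "0 \<le> h"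
  shows "norm ((euler_step h ^^ n) x - x) \<le> real n * (h * M)"
proof (induction n)
  case (Suc n)
  have "norm ((euler_step h ^^ Suc n) x - x) \<le> norm (euler_step h ((euler_step h ^^ n) x) - (euler_step h ^^ n) x) + norm ((euler_step h ^^ n) x - x)"
    using norm_triangle_ineq[of "euler_step h ((euler_step h ^^ n) x) - (euler_step h ^^ n) x" "(euler_step h ^^ n) x - x"] by simp
  also have "\<dots> \<le> h * M + real n * (h * M)"
    using euler_step_displacement[OF assms] Suc.IH by (intro add_mono)
  finally show ?case by (simp add: algebra_simps)
qed simp

text \<open>With the Jacobian inserted, the change of variables formula gives the integral of
  \<open>f\<close> exactly. The Jacobian differs from 1 by at most \<open>C * h\<^sup>2\<close>, and
  only the ball of radius \<open>R\<close> contributes.\<close>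

lemma euler_step_integral:
  fixes f :: "real^2 \<Rightarrow> real"
  assumes h: "0 < h" "h * K < 1" and f: "continuous_on UNIV f" "\<And>x. \<bar>f x\<bar> \<le> B"
    and supp: "\<And>x. norm x > R \<Longrightarrow> f x = 0" "\<And>x. norm x > R \<Longrightarrow> f (euler_step h x) = 0"
  shows "\<bar>integral UNIV (\<lambda>x. f (euler_step h x)) - integral UNIV f\<bar> \<le> C * h\<^sup>2 * B * measure lebesgue (cball (0::real^2) R)"
proof -
  let ?J = "\<lambda>x. det (matrix (\<lambda>w. w - h *\<^sub>R v' x w))"
  have B: "B \<ge> 0" using f(2)[of 0] by linarith
  have der: "(euler_step h has_derivative (\<lambda>w. w - h *\<^sub>R v' x w)) (at x within UNIV)" for x
    unfolding euler_step_def[abs_def] by (auto intro!: derivative_eq_intros deriv)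
  have fi: "f absolutely_integrable_on UNIV"
    using f(1) supp(1) by (rule absolutely_integrable_compact_support)
  have fTi: "(\<lambda>x. f (euler_step h x)) absolutely_integrable_on UNIV"
    using supp(2) continuous_on_UNIV_compose[OF f(1) continuous_euler_step]
    by (intro absolutely_integrable_compact_support[of _ R]) auto
  \<comment> \<open>Values are wrapped into \<open>real^1\<close>, the vector form in which the
    change of variables theorem is stated.\<close>
  have "(\<lambda>x. \<bar>?J x\<bar> *\<^sub>R (vec (f (euler_step h x)) :: real^1)) absolutely_integrable_on UNIV \<and>
      integral UNIV (\<lambda>x. \<bar>?J x\<bar> *\<^sub>R (vec (f (euler_step h x)) :: real^1)) = vec (integral UNIV f)"
    using has_absolute_integral_change_of_variables[of UNIV "euler_step h" "\<lambda>x w. w - h *\<^sub>R v' x w" "\<lambda>x. vec (f x) :: real^1" "vec (integral UNIV f)"]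
      der euler_step_bij[OF h] fi
    by (simp add: absolutely_integrable_on_1_iff integral_on_1_eq)
  then have Ji: "(\<lambda>x. \<bar>?J x\<bar> * f (euler_step h x)) integrable_on UNIV"
    and J: "integral UNIV (\<lambda>x. \<bar>?J x\<bar> * f (euler_step h x)) = integral UNIV f"
    by (simp_all add: absolutely_integrable_on_1_iff integral_on_1_eq vec_eq_iff absolutely_integrable_on_def)
  have "\<bar>integral UNIV (\<lambda>x. f (euler_step h x)) - integral UNIV f\<bar>
      = norm (integral UNIV (\<lambda>x. f (euler_step h x) - \<bar>?J x\<bar> * f (euler_step h x)))"
    using J Ji fTi by (subst integral_diff) (auto simp: absolutely_integrable_on_def)
  also have "\<dots> \<le> integral UNIV (\<lambda>x. C * h\<^sup>2 * B * indicator (cball (0::real^2) R) x)"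
  proof (rule Henstock_Kurzweil_Integration.integral_norm_bound_integral)
    show "(\<lambda>x. f (euler_step h x) - \<bar>?J x\<bar> * f (euler_step h x)) integrable_on UNIV"
      using Ji fTi by (intro integrable_diff) (auto simp: absolutely_integrable_on_def)
    show "(\<lambda>x. C * h\<^sup>2 * B * indicator (cball (0::real^2) R) x) integrable_on UNIV"
      by (intro integrable_on_mult_right) (simp add: integrable_on_indicator)
    show "norm (f (euler_step h x) - \<bar>?J x\<bar> * f (euler_step h x)) \<le> C * h\<^sup>2 * B * indicator (cball (0::real^2) R) x" for x
    proof (cases "norm x > R")
      case True
      then show ?thesis by (simp add: supp)
    next
      case False
      have "norm (f (euler_step h x) - \<bar>?J x\<bar> * f (euler_step h x)) = \<bar>1 - \<bar>?J x\<bar>\<bar> * \<bar>f (euler_step h x)\<bar>"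
        by (simp add: abs_mult[symmetric] algebra_simps)
      also have "\<dots> \<le> (C * h\<^sup>2) * B"
        using det[of h x] f(2) B C_nonneg by (intro mult_mono) auto
      finally show ?thesis using False by simp
    qed
  qed
  also have "\<dots> = C * h\<^sup>2 * B * measure lebesgue (cball (0::real^2) R)"
    using lmeasure_integral_UNIV[of "cball (0::real^2) R"] by simp
  finally show ?thesis .
qed

text \<open>The innermost step is removed first, with the remaining composition in the role of
  \<open>f\<close>. The radius \<open>R'\<close> serves every stage, since \<open>n\<close> steps
  move a point by at most \<open>real n * (h * M)\<close>.\<close>

lemma euler_steps_integral:
  fixes f :: "real^2 \<Rightarrow> real"
  assumes h: "0 < h" "h * K < 1" and f: "continuous_on UNIV f" "\<And>x. \<bar>f x\<bar> \<le> B"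
    and supp: "\<And>x. norm x > R \<Longrightarrow> f x = 0" and R': "R + real n * (h * M) \<le> R'"
  shows "\<bar>integral UNIV (\<lambda>x. f ((euler_step h ^^ n) x)) - integral UNIV f\<bar>
    \<le> real n * (C * h\<^sup>2 * B * measure lebesgue (cball (0::real^2) R'))"
  using R'
proof (induction n)
  case (Suc n)
  let ?c = "C * h\<^sup>2 * B * measure lebesgue (cball (0::real^2) R')"
  have zero: "f ((euler_step h ^^ k) x) = 0" if "k \<le> Suc n" "norm x > R'" for k x
  proof (rule supp)
    have "norm x \<le> norm ((euler_step h ^^ k) x) + norm ((euler_step h ^^ k) x - x)"
      using norm_triangle_ineq4[of "(euler_step h ^^ k) x" "(euler_step h ^^ k) x - x"] by simp
    moreover have "norm ((euler_step h ^^ k) x - x) \<le> real k * (h * M)"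
      using h by (intro euler_steps_displacement) simp
    moreover have "real k * (h * M) \<le> real (Suc n) * (h * M)"
      using that h M by (intro mult_right_mono) auto
    ultimately show "norm ((euler_step h ^^ k) x) > R"
      using Suc.prems that by linarith
  qed
  have "\<bar>integral UNIV (\<lambda>x. f ((euler_step h ^^ n) (euler_step h x))) - integral UNIV (\<lambda>x. f ((euler_step h ^^ n) x))\<bar> \<le> ?c"
  proof (rule euler_step_integral[OF h])
    show "continuous_on UNIV (\<lambda>x. f ((euler_step h ^^ n) x))"
      by (rule continuous_on_UNIV_compose[OF f(1) continuous_euler_steps])
    show "f ((euler_step h ^^ n) (euler_step h x)) = 0" if "norm x > R'" for x
      using zero[of "Suc n" x] that by (simp add: funpow_swap1)
  qed (use f(2) zero in auto)
  moreover have "R + real n * (h * M) \<le> R'"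
  proof -
    have "real n * (h * M) \<le> real (Suc n) * (h * M)" using h M by (intro mult_right_mono) auto
    then show ?thesis using Suc.prems by linarith
  qed
  note Suc.IH[OF this]
  ultimately show ?case by (simp add: funpow_swap1 algebra_simps)
qed simp

text \<open>Liouville's theorem. Over a time \<open>t\<close> there are \<open>t / h\<close> steps,
  each with an integral error of order \<open>h\<^sup>2\<close>, so the total error is of order
  \<open>h\<close>; dominated convergence passes from the Euler iterates to the flow.\<close>

lemma flow_integral_eq:
  fixes f :: "real^2 \<Rightarrow> real"
  assumes y: "\<And>x. is_trajectory (y x)" "\<And>x. y x 0 = x" and t: "t > 0"
    and f: "continuous_on UNIV f" and supp: "\<And>x. norm x > R \<Longrightarrow> f x = 0"
  shows "(\<lambda>x. f (y x t)) integrable_on UNIV" "integral UNIV (\<lambda>x. f (y x t)) = integral UNIV f"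
proof -
  obtain B where B: "B > 0" "\<And>x. \<bar>f x\<bar> \<le> B"
    using bounded_compact_support[OF f supp] by (metis real_norm_def)
  \<comment> \<open>Euler iterates over a time \<open>t\<close> move a point by at most
    \<open>t * M\<close>, so this radius confines the support of every \<open>?F n\<close>.\<close>
  define R' where "R' = R + t * M"
  define h where "h = (\<lambda>n. t / real (Suc n))"
  let ?F = "\<lambda>n x. f ((euler_step (h n) ^^ Suc n) x)"
  have h: "h n > 0" "real (Suc n) * h n = t" for n using t by (auto simp: h_def)
  have h_lim: "h \<longlonglongrightarrow> 0"
    using tendsto_mult_right_zero[OF LIMSEQ_inverse_real_of_nat, of t] by (simp add: h_def divide_inverse)
  have zero: "?F n x = 0" if "norm x > R'" for n x
  proof (rule supp)
    have "norm x \<le> norm ((euler_step (h n) ^^ Suc n) x) + norm ((euler_step (h n) ^^ Suc n) x - x)"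
      using norm_triangle_ineq4[of "(euler_step (h n) ^^ Suc n) x" "(euler_step (h n) ^^ Suc n) x - x"] by simp
    moreover have "norm ((euler_step (h n) ^^ Suc n) x - x) \<le> real (Suc n) * (h n * M)"
      using h(1)[of n] by (intro euler_steps_displacement) simp
    moreover have "real (Suc n) * (h n * M) = t * M" using h(2)[of n] by (metis mult.assoc)
    ultimately show "norm ((euler_step (h n) ^^ Suc n) x) > R" using that unfolding R'_def by linarith
  qed
  have *: "?F n integrable_on UNIV"
    "(\<lambda>x. B * indicator (cball (0::real^2) R') x) integrable_on UNIV"
    "norm (?F n x) \<le> B * indicator (cball (0::real^2) R') x"
    "(\<lambda>n. ?F n x) \<longlonglongrightarrow> f (y x t)" for n x
  proof -
    show "?F n integrable_on UNIV"
      using absolutely_integrable_compact_support[OF continuous_on_UNIV_compose[OF f continuous_euler_steps[of "Suc n" "h n"]] zero[of _ n]]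
      by (simp only: absolutely_integrable_on_def)
    show "(\<lambda>x. B * indicator (cball (0::real^2) R') x) integrable_on UNIV"
      by (intro integrable_on_mult_right) (simp add: integrable_on_indicator)
    show "norm (?F n x) \<le> B * indicator (cball (0::real^2) R') x"
    proof (cases "norm x > R'")
      case True
      then show ?thesis by (simp only: zero) (simp add: B less_imp_le)
    next
      case False
      then show ?thesis using B(2) by simp
    qed
    show "(\<lambda>n. ?F n x) \<longlonglongrightarrow> f (y x t)"
    proof (rule isCont_tendsto_compose[of _ f])
      show "isCont f (y x t)" using f by (simp add: continuous_on_eq_continuous_at)
      show "(\<lambda>n. (euler_step (h n) ^^ Suc n) x) \<longlonglongrightarrow> y x t"
        using euler_method_tendsto[OF y(1)[of x] t] unfolding y(2) h_def .
    qed
  qed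
  show "(\<lambda>x. f (y x t)) integrable_on UNIV"
    by (rule dominated_convergence(1)[of ?F, OF *])
  have "(\<lambda>n. integral UNIV (?F n)) \<longlonglongrightarrow> integral UNIV (\<lambda>x. f (y x t))"
    by (rule dominated_convergence(2)[of ?F, OF *])
  moreover have "(\<lambda>n. integral UNIV (?F n)) \<longlonglongrightarrow> integral UNIV f"
  proof -
    let ?c = "C * B * measure lebesgue (cball (0::real^2) R')"
    have "\<forall>\<^sub>F n in sequentially. h n * K < 1"
      using order_tendstoD(2)[OF tendsto_mult_left_zero[OF h_lim, of K], of 1] by simp
    then have "\<forall>\<^sub>F n in sequentially. norm (integral UNIV (?F n) - integral UNIV f) \<le> t * ?c * h n"
    proof eventually_elim
      case (elim n)
      have "\<bar>integral UNIV (?F n) - integral UNIV f\<bar> \<le> real (Suc n) * (C * (h n)\<^sup>2 * B * measure lebesgue (cball (0::real^2) R'))"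
      proof (rule euler_steps_integral[OF h(1) elim f B(2) supp])
        show "R + real (Suc n) * (h n * M) \<le> R'"
          unfolding R'_def using h(2)[of n] by (metis mult.assoc order_refl)
      qed
      also have "\<dots> = (real (Suc n) * h n) * ?c * h n" by (simp add: power2_eq_square mult_ac del: of_nat_Suc)
      finally show ?case unfolding h(2) by simp
    qed
    then have "(\<lambda>n. integral UNIV (?F n) - integral UNIV f) \<longlonglongrightarrow> 0"
      by (rule Lim_null_comparison) (rule tendsto_mult_right_zero[OF h_lim])
    then show ?thesis by (rule LIM_zero_cancel)
  qed
  ultimately show "integral UNIV (\<lambda>x. f (y x t)) = integral UNIV f" by (rule LIMSEQ_unique)
qed

end

section \<open>From the Lagrangian to the Euler formulation\<close>

lemma Ck_2D:
  assumes "Ck 2 f"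
  shows "f differentiable (at x)" "partial i f differentiable (at x)"
    "continuous_on UNIV f" "continuous_on UNIV (partial i f)" "continuous_on UNIV (partial i (partial j f))"
    "continuous_on UNIV (laplacian f)"
proof -
  have f: "\<And>x. f differentiable (at x)" "\<And>i x. partial i f differentiable (at x)"
    "\<And>i j. continuous_on UNIV (partial i (partial j f))"
    using assms by (auto simp: numeral_2_eq_2)
  then show "f differentiable (at x)" "partial i f differentiable (at x)" "continuous_on UNIV (partial i (partial j f))"
    "continuous_on UNIV f" "continuous_on UNIV (partial i f)"
    by (auto intro: differentiable_imp_continuous_on_UNIV)
  show "continuous_on UNIV (laplacian f)"
    unfolding laplacian_def[abs_def] by (intro continuous_on_add f)
qed

lemma biperiodic_laplacian:
  assumes "biperiodic a f" "Ck 2 f"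
  shows "biperiodic a (laplacian f)"
proof -
  have "biperiodic a (partial i (partial j f))" for i j
    using biperiodic_partial[OF biperiodic_partial[OF assms(1) Ck_2D(1)[OF assms(2)]] Ck_2D(2)[OF assms(2)]] .
  then show ?thesis by (simp add: biperiodic_def laplacian_def)
qed

lemma partial_diff:
  assumes "f differentiable (at x)" "g differentiable (at x)"
  shows "partial i (\<lambda>x. f x - g x) x = partial i f x - partial i g x"
  using partial_eqI[OF has_derivative_diff[OF has_derivative_partial[OF assms(1)] has_derivative_partial[OF assms(2)]], of i]
    exhaust_2[of i] by (auto simp: axis_def)

section \<open>Derivatives of \<open>psi_star\<close> and of differences\<close>

lemma has_derivative_fun_2:
  assumes "(g has_real_derivative g') (at (x $ 2))"
  shows "((\<lambda>x::real^2. g (x $ 2)) has_derivative (\<lambda>h. h $ 2 * g')) (at x)"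
  using DERIV_compose_FDERIV[OF assms bounded_linear_imp_has_derivative[OF bounded_linear_vec_nth]] .

lemma partial_fun_2:
  assumes "\<And>t. (g has_real_derivative g' t) (at t)"
  shows "(\<lambda>x::real^2. g (x $ 2)) differentiable (at x)"
    "partial 1 (\<lambda>x. g (x $ 2)) = (\<lambda>x. 0)" "partial 2 (\<lambda>x. g (x $ 2)) = (\<lambda>x. g' (x $ 2))"
  using has_derivative_fun_2[OF assms, THEN partial_eqI] has_derivative_fun_2[OF assms, THEN differentiableI]
  by (auto simp: axis_def fun_eq_iff)

lemma psi_star_partials:
  "psi_star differentiable (at x)" "partial 1 psi_star = (\<lambda>x. 0)" "partial 2 psi_star = (\<lambda>x. - sin (x $ 2))"
  unfolding psi_star_def[abs_def] by (intro partial_fun_2; auto intro!: derivative_eq_intros)+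

lemma minus_sin_partials:
  "(\<lambda>x::real^2. - sin (x $ 2)) differentiable (at x)" "partial 1 (\<lambda>x. - sin (x $ 2)) = (\<lambda>x. 0)"
  "partial 2 (\<lambda>x. - sin (x $ 2)) = (\<lambda>x. - cos (x $ 2))"
  by (rule partial_fun_2; auto intro!: derivative_eq_intros)+

lemma partial_const: "partial i (\<lambda>x. c) = (\<lambda>x. 0)"
  by (simp add: fun_eq_iff partial_def)

lemma laplacian_psi_star: "laplacian psi_star = (\<lambda>x. - cos (x $ 2))"
  by (simp add: fun_eq_iff laplacian_def psi_star_partials minus_sin_partials partial_const)

lemma continuous_minus_cos: "continuous_on UNIV (\<lambda>x::real^2. - cos (x $ 2))"
  by (intro continuous_intros)

lemma Ck_2_psi_star: "Ck 2 psi_star"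
proof -
  have "partial i psi_star differentiable (at x) \<and> continuous_on UNIV (partial j (partial i psi_star))" for i j x
    using exhaust_2[of i] exhaust_2[of j] continuous_minus_cos
    by (auto simp: psi_star_partials minus_sin_partials partial_const)
  then show ?thesis by (simp add: numeral_2_eq_2 psi_star_partials)
qed

lemma biperiodic_psi_star: "biperiodic a psi_star"
  by (simp add: biperiodic_def psi_star_def)

lemma Ck_2_diff:
  assumes "Ck 2 f" "Ck 2 g"
  shows "Ck 2 (\<lambda>x. f x - g x)" "laplacian (\<lambda>x. f x - g x) = (\<lambda>x. laplacian f x - laplacian g x)"
proof -
  note f = Ck_2D[OF assms(1)] and g = Ck_2D[OF assms(2)]
  have 1: "partial i (\<lambda>x. f x - g x) = (\<lambda>x. partial i f x - partial i g x)" for i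
    using partial_diff f(1) g(1) by blast
  have 2: "partial j (\<lambda>x. partial i f x - partial i g x) = (\<lambda>x. partial j (partial i f) x - partial j (partial i g) x)" for i j
    using partial_diff f(2) g(2) by blast
  show "Ck 2 (\<lambda>x. f x - g x)"
    by (auto simp: numeral_2_eq_2 1 2 intro!: differentiable_diff continuous_on_diff f g)
  show "laplacian (\<lambda>x. f x - g x) = (\<lambda>x. laplacian f x - laplacian g x)"
    by (simp add: fun_eq_iff laplacian_def 1 2)
qed

lemma laplacian_minus_psi_star:
  assumes "Ck 2 f"
  shows "laplacian (\<lambda>z. f z - psi_star z) x = laplacian f x + cos (x $ 2)"
  using Ck_2_diff(2)[OF assms Ck_2_psi_star] by (simp add: laplacian_psi_star)

section \<open>The velocity field and its derivative\<close>

definition curl_deriv :: "(real^2 \<Rightarrow> real) \<Rightarrow> real^2 \<Rightarrow> real^2 \<Rightarrow> real^2" where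
  "curl_deriv f x h = vector [- (h $ 1 * partial 1 (partial 2 f) x + h $ 2 * partial 2 (partial 2 f) x),
     h $ 1 * partial 1 (partial 1 f) x + h $ 2 * partial 2 (partial 1 f) x]"

lemma curl_has_derivative:
  assumes "Ck 2 f"
  shows "(curl f has_derivative curl_deriv f x) (at x)"
  unfolding curl_def[abs_def] curl_deriv_def[abs_def]
  by (intro has_derivative_vector_2 has_derivative_minus has_derivative_partial Ck_2D assms)

lemma biperiodic_curl: "biperiodic a f \<Longrightarrow> Ck 2 f \<Longrightarrow> biperiodic a (curl f)"
  using biperiodic_partial[of a f] Ck_2D(1)[of f] by (simp add: biperiodic_def curl_def)

lemma norm_vector_2_le: "norm (vector [s, t] :: real^2) \<le> \<bar>s\<bar> + \<bar>t\<bar>"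
  using norm_le_l1_cart[of "vector [s, t] :: real^2"] by (simp add: sum_2)

lemma biperiodic_second_partials_bounded:
  assumes "a > 0" "Ck 2 f" "biperiodic a f"
  obtains B where "B > 0" "\<And>i j x. \<bar>partial i (partial j f) x\<bar> \<le> B"
proof -
  note f = Ck_2D[OF assms(2)]
  have "\<exists>B>0. \<forall>x. \<bar>partial i (partial j f) x\<bar> \<le> B" for i j
    using biperiodic_bounded[OF assms(1) biperiodic_partial[OF biperiodic_partial[OF assms(3) f(1)] f(2)] f(5), of i j]
    by (metis real_norm_def)
  then obtain B where B: "\<And>i j. B i j > 0" "\<And>i j x. \<bar>partial i (partial j f) x\<bar> \<le> B i j" by metis
  have "\<bar>partial i (partial j f) x\<bar> \<le> B 1 1 + B 1 2 + B 2 1 + B 2 2" for i j x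
    using B(2)[of i j x] B(1)[of 1 1] B(1)[of 1 2] B(1)[of 2 1] B(1)[of 2 2] exhaust_2[of i] exhaust_2[of j] by fastforce
  then show ?thesis
    using that[of "B 1 1 + B 1 2 + B 2 1 + B 2 2"] B(1)[of 1 1] B(1)[of 1 2] B(1)[of 2 1] B(1)[of 2 2] by simp
qed

text \<open>The trace of \<open>curl_deriv f x\<close> is a difference of mixed derivatives and
  vanishes, so the determinant is 1 plus \<open>h\<^sup>2\<close> times the Hessian determinant of
  \<open>f\<close>. The constants count quantities controlled by \<open>B\<close>: four entries of
  the derivative, two products in the Hessian determinant.\<close>

lemma curl_lipschitz_field:
  assumes a: "a > 0" and C2: "Ck 2 f" and per: "biperiodic a f"
  obtains K M C where "lipschitz_field (curl f) (curl_deriv f) K M C"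
proof -
  obtain B where B: "B > 0" "\<And>i j x. \<bar>partial i (partial j f) x\<bar> \<le> B"
    using biperiodic_second_partials_bounded[OF a C2 per] by blast
  have "continuous_on UNIV (curl f)"
    using curl_has_derivative[OF C2]
    by (intro continuous_at_imp_continuous_on ballI has_derivative_continuous) auto
  then obtain M where M: "M > 0" "\<And>x. norm (curl f x) \<le> M"
    using biperiodic_bounded[OF a biperiodic_curl[OF per C2]] by metis
  have "norm (curl_deriv f x h) \<le> 4 * B * norm h" for x h
  proof -
    have *: "\<bar>h $ k * partial i (partial j f) x\<bar> \<le> norm h * B" for k i j
      unfolding abs_mult by (intro mult_mono component_le_norm_cart B) auto
    have "norm (curl_deriv f x h) \<le> \<bar>h $ 1 * partial 1 (partial 2 f) x\<bar> + \<bar>h $ 2 * partial 2 (partial 2 f) x\<bar>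
       + \<bar>h $ 1 * partial 1 (partial 1 f) x\<bar> + \<bar>h $ 2 * partial 2 (partial 1 f) x\<bar>"
      unfolding curl_deriv_def by (rule order_trans[OF norm_vector_2_le]) linarith
    also have "\<dots> \<le> norm h * B + norm h * B + norm h * B + norm h * B"
      by (intro add_mono *)
    finally show ?thesis by simp
  qed
  then have "onorm (curl_deriv f x) \<le> 4 * B" for x by (rule onorm_le)
  then have lip: "norm (curl f x - curl f y) \<le> 4 * B * norm (x - y)" for x y
    using curl_has_derivative[OF C2]
    by (intro differentiable_bound[of UNIV "curl f" "curl_deriv f"]) auto
  have "\<bar>det (matrix (\<lambda>w. w - h *\<^sub>R curl_deriv f x w)) - 1\<bar> \<le> 2 * B\<^sup>2 * h\<^sup>2" for h x
  proof -
    let ?A = "partial 1 (partial 1 f) x" and ?D = "partial 1 (partial 2 f) x" and ?F = "partial 2 (partial 2 f) x"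
    have "det (matrix (\<lambda>w. w - h *\<^sub>R curl_deriv f x w)) - 1 = h\<^sup>2 * (?A * ?F - ?D\<^sup>2)"
      using mixed_partials_eq[OF C2, of x]
      by (simp add: det_2 matrix_def curl_deriv_def axis_def power2_eq_square algebra_simps)
    also have "\<bar>\<dots>\<bar> \<le> h\<^sup>2 * (B * B + B\<^sup>2)"
    proof -
      have "\<bar>?A * ?F\<bar> \<le> B * B" unfolding abs_mult using B by (intro mult_mono) auto
      moreover have "?D\<^sup>2 \<le> B\<^sup>2" using power_mono[OF B(2)[of 1 2 x], of 2] by simp
      ultimately have "\<bar>?A * ?F - ?D\<^sup>2\<bar> \<le> B * B + B\<^sup>2" using zero_le_power2[of ?D] by linarith
      then show ?thesis by (simp add: abs_mult mult_left_mono)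
    qed
    finally show ?thesis by (simp add: power2_eq_square mult_ac)
  qed
  then show ?thesis
    using B M lip curl_has_derivative[OF C2]
    by (intro that[of "4 * B" M "2 * B\<^sup>2"]) (unfold_locales, auto)
qed

text \<open>The substitution of \<open>t + s\<close> pulls out \<open>exp (\<kappa> * t)\<close>.
  The integral over \<open>{0..t}\<close> can be differentiated in \<open>t\<close> by the
  fundamental theorem of calculus, whereas the left side does not allow differentiation under the
  integral for a merely continuous \<open>g\<close>.\<close>

lemma discounted_integral_along_shift:
  fixes g :: "real \<Rightarrow> real"
  assumes \<kappa>: "\<kappa> > 0" and g: "continuous_on {0..} g" "\<And>s. \<bar>g s\<bar> \<le> 1" and t: "t \<ge> 0"
  shows "integral {0..} (\<lambda>s. exp (- \<kappa> * s) * g (t + s))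
    = exp (\<kappa> * t) * (integral {0..} (\<lambda>s. exp (- \<kappa> * s) * g s) - integral {0..t} (\<lambda>s. exp (- \<kappa> * s) * g s))"
proof -
  let ?e = "\<lambda>s. exp (- \<kappa> * s) * g s"
  have cont: "continuous_on S ?e" if "S \<subseteq> {0..}" for S
    by (intro continuous_intros continuous_on_subset[OF g(1) that])
  have ai: "?e absolutely_integrable_on {c..}" if "c \<ge> 0" for c
  proof (rule measurable_bounded_by_integrable_imp_absolutely_integrable)
    show "?e \<in> borel_measurable (lebesgue_on {c..})"
      using that by (intro continuous_imp_measurable_on_sets_lebesgue cont) auto
    show "(\<lambda>s. exp (- \<kappa> * s)) integrable_on {c..}"
      using has_integral_exp_minus_to_infinity[OF \<kappa>] by blast
    show "norm (?e s) \<le> exp (- \<kappa> * s)" for s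
      using g(2)[of s] by (simp add: abs_mult mult_left_le)
  qed auto
  have img: "(\<lambda>s. t + s) ` {0..} = {t..}"
  proof (intro set_eqI iffI)
    show "x \<in> (\<lambda>s. t + s) ` {0..}" if "x \<in> {t..}" for x
      using that by (intro image_eqI[of _ _ "x - t"]) auto
  qed auto
  have "((\<lambda>s. t + s) has_real_derivative 1) (at s within {0..})" for s
    by (auto intro!: derivative_eq_intros)
  then have "integral {0..} (\<lambda>s. \<bar>1\<bar> * ?e (t + s)) = integral {t..} ?e"
    using has_absolute_integral_change_of_variables_1'[of "{0..}" "\<lambda>s. t + s" "\<lambda>_. 1" ?e "integral {t..} ?e"] ai[OF t]
    unfolding img by auto
  moreover have "\<bar>1\<bar> * ?e (t + s) = exp (- \<kappa> * t) * (exp (- \<kappa> * s) * g (t + s))" for s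
    by (simp only: distrib_left exp_add mult.assoc abs_one mult_1)
  ultimately have "integral {t..} ?e = integral {0..} (\<lambda>s. exp (- \<kappa> * t) * (exp (- \<kappa> * s) * g (t + s)))"
    by (simp only:)
  then have 1: "integral {t..} ?e = exp (- \<kappa> * t) * integral {0..} (\<lambda>s. exp (- \<kappa> * s) * g (t + s))"
    by simp
  have "{0..} = {0..t} \<union> {t..}" "{0..t} \<inter> {t..} = {t}" using t by auto
  moreover have "?e integrable_on {0..t}" by (intro integrable_continuous_real cont) auto
  moreover have "?e integrable_on {t..}" using ai[OF t] by (simp add: absolutely_integrable_on_def)
  ultimately have 2: "integral {0..} ?e = integral {0..t} ?e + integral {t..} ?e"
    using integral_Un[of ?e "{0..t}" "{t..}"] by simp
  have "exp (\<kappa> * t) * exp (- \<kappa> * t) = 1" by (simp add: exp_minus)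
  then show ?thesis using 1 2 by (simp add: mult.assoc[symmetric])
qed

text \<open>The flow preserves area, so \<open>\<integral> (\<omega> \<phi>)(y x t) dx\<close> does not depend on \<open>t\<close>; its derivative at
  \<open>t = 0\<close> is the weak form, because \<open>\<omega>\<close> satisfies a linear equation along trajectories.\<close>
theorem lagrangian_imp_euler:
  assumes a: "a > 0" and \<kappa>: "\<kappa> > 0" and C2: "Ck 2 \<psi>" and per: "biperiodic a \<psi>"
    and lag: "lagrangian_solution \<kappa> \<psi>"
  shows "euler_solution \<kappa> \<psi>"
  unfolding euler_solution_def
proof (intro allI impI)
  fix \<phi> assume \<phi>: "test_function \<phi>"
  obtain K M C where "lipschitz_field (curl \<psi>) (curl_deriv \<psi>) K M C"
    using curl_lipschitz_field[OF a C2 per] .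
  then interpret lipschitz_field "curl \<psi>" "curl_deriv \<psi>" K M C .
  obtain y where y: "trajectory_map \<psi> y"
    and lap: "\<And>x. - laplacian \<psi> x = \<kappa> * integral {0..} (\<lambda>s. exp (- \<kappa> * s) * psi_star (y x s))"
    using lag unfolding lagrangian_solution_def by blast
  have traj: "is_trajectory (y x)" and y0: "y x 0 = x" for x
    using y unfolding trajectory_map_def is_trajectory_def by auto
  define \<omega> where "\<omega> = (\<lambda>x. - laplacian \<psi> x)"
  have \<omega>_cont: "continuous_on UNIV \<omega>"
    unfolding \<omega>_def by (intro continuous_intros Ck_2D C2)
  have psi_cont: "continuous_on UNIV psi_star"
    unfolding psi_star_def[abs_def] by (intro continuous_intros)
  have psi_y: "continuous_on {0..} (\<lambda>s. psi_star (y x s))" for x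
    using traj[of x] by (intro continuous_on_UNIV_compose[OF psi_cont]) (simp add: is_trajectory_def)
  have \<omega>_flow: "\<omega> (y x t) = exp (\<kappa> * t) * (\<omega> x - \<kappa> * integral {0..t} (\<lambda>s. exp (- \<kappa> * s) * psi_star (y x s)))"
    if "t \<ge> 0" for x t
  proof -
    \<comment> \<open>Uniqueness of trajectories gives the semigroup law, so the Lagrangian formula
      at \<open>y x t\<close> becomes an integral along the trajectory of \<open>x\<close>.\<close>
    have "y (y x t) s = y x (t + s)" if "s \<ge> 0" for s
      using trajectory_unique[OF traj is_trajectory_shift[OF traj \<open>t \<ge> 0\<close>] _ that, of "y x t" x] by (simp add: y0)
    then have "integral {0..} (\<lambda>s. exp (- \<kappa> * s) * psi_star (y (y x t) s)) = integral {0..} (\<lambda>s. exp (- \<kappa> * s) * psi_star (y x (t + s)))"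
      by (intro integral_cong) auto
    then have "\<omega> (y x t) = \<kappa> * integral {0..} (\<lambda>s. exp (- \<kappa> * s) * psi_star (y x (t + s)))"
      unfolding \<omega>_def lap by simp
    also have "integral {0..} (\<lambda>s. exp (- \<kappa> * s) * psi_star (y x (t + s)))
        = exp (\<kappa> * t) * (integral {0..} (\<lambda>s. exp (- \<kappa> * s) * psi_star (y x s)) - integral {0..t} (\<lambda>s. exp (- \<kappa> * s) * psi_star (y x s)))"
      by (rule discounted_integral_along_shift[OF \<kappa> psi_y _ that]) (simp add: psi_star_def)
    finally show ?thesis by (simp add: \<omega>_def lap algebra_simps)
  qed
  \<comment> \<open>Only continuity of \<open>\<omega>\<close> is known on the plane, but
    \<open>\<omega>_flow\<close> makes it differentiable along trajectories.\<close>
  have \<omega>_deriv: "((\<lambda>t. \<omega> (y x t)) has_real_derivative \<kappa> * (\<omega> (y x t) - psi_star (y x t))) (at t)" if "t > 0" for x t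
  proof -
    let ?e = "\<lambda>s. exp (- \<kappa> * s) * psi_star (y x s)"
    have "((\<lambda>t. integral {0..t} ?e) has_real_derivative ?e t) (at t within {0..t + 1})"
      using that by (intro integral_has_real_derivative continuous_intros continuous_on_subset[OF psi_y]) auto
    then have "((\<lambda>t. integral {0..t} ?e) has_real_derivative ?e t) (at t)"
      using that by (simp add: at_within_Icc_at)
    note I = this
    have "((\<lambda>t. exp (\<kappa> * t) * (\<omega> x - \<kappa> * integral {0..t} ?e)) has_real_derivative
        \<kappa> * exp (\<kappa> * t) * (\<omega> x - \<kappa> * integral {0..t} ?e) - exp (\<kappa> * t) * (\<kappa> * ?e t)) (at t)"
      using I by (auto intro!: derivative_eq_intros)
    also have "\<kappa> * exp (\<kappa> * t) * (\<omega> x - \<kappa> * integral {0..t} ?e) - exp (\<kappa> * t) * (\<kappa> * ?e t) = \<kappa> * (\<omega> (y x t) - psi_star (y x t))"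
      using that by (simp add: \<omega>_flow exp_minus field_simps)
    finally show ?thesis
      by (rule has_field_derivative_transform_within_open[of _ _ _ "{0<..}"]) (use that \<omega>_flow in auto)
  qed
  have \<phi>_Ck: "Ck 1 \<phi>" using \<phi> by (simp add: test_function_def)
  have \<phi>_diff: "\<phi> differentiable (at x)" and \<phi>'_cont: "continuous_on UNIV (partial i \<phi>)" for x i
    using \<phi>_Ck by simp_all
  have \<phi>_cont: "continuous_on UNIV \<phi>"
    using \<phi>_diff by (rule differentiable_imp_continuous_on_UNIV)
  have "bounded (closure {x. \<phi> x \<noteq> 0})"
    using \<phi> by (intro compact_imp_bounded) (simp only: test_function_def)
  then obtain R where R': "\<forall>x\<in>closure {x. \<phi> x \<noteq> 0}. norm x \<le> R" unfolding bounded_iff ..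
  have R: "x \<notin> closure {x. \<phi> x \<noteq> 0}" if "norm x > R" for x
    using R' that by fastforce
  have \<phi>0: "\<phi> x = 0" if "norm x > R" for x
    using R[OF that] subsetD[OF closure_subset, of x "{x. \<phi> x \<noteq> 0}"] by auto
  have grad0: "grad \<phi> x = 0" if "norm x > R" for x
  proof -
    let ?S = "- closure {x. \<phi> x \<noteq> 0}"
    have "open ?S" by (intro open_Compl closed_closure)
    moreover have "x \<in> ?S" using R[OF that] unfolding Compl_iff .
    moreover have "0 = \<phi> z" if "z \<in> ?S" for z
      using that subsetD[OF closure_subset, of z "{x. \<phi> x \<noteq> 0}"] by auto
    ultimately have "(\<phi> has_derivative (\<lambda>h. 0)) (at x)"
      by (rule has_derivative_transform_within_open[OF has_derivative_const])
    from partial_eqI[OF this] show ?thesis by (simp add: grad_def vec_eq_iff)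
  qed
  define f where "f = (\<lambda>x. \<omega> x * \<phi> x)"
  \<comment> \<open>\<open>A\<close> and \<open>B\<close> come from the product rule along a
    trajectory: the source term in the equation of \<open>\<omega>\<close>, and the transport of
    \<open>\<phi>\<close>.\<close>
  define A where "A = (\<lambda>x. \<kappa> * (\<omega> x - psi_star x) * \<phi> x)"
  define B where "B = (\<lambda>x. \<omega> x * (curl \<psi> x \<bullet> grad \<phi> x))"
  have cont: "continuous_on UNIV f" "continuous_on UNIV A" "continuous_on UNIV B"
  proof -
    have "continuous_on UNIV (\<lambda>x. curl \<psi> x \<bullet> grad \<phi> x)"
      unfolding inner_2 grad_def by (auto simp: curl_def intro!: continuous_intros Ck_2D(4)[OF C2] \<phi>'_cont)
    then show "continuous_on UNIV B"
      unfolding B_def by (rule continuous_on_mult[OF \<omega>_cont])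
    show "continuous_on UNIV f" "continuous_on UNIV A"
      unfolding f_def A_def by (intro continuous_intros \<omega>_cont psi_cont \<phi>_cont)+
  qed
  have zero: "f x = 0" "A x = 0" "B x = 0" if "norm x > R" for x
    using \<phi>0[OF that] grad0[OF that] by (simp_all add: f_def A_def B_def)
  obtain BF where BF: "BF > 0" "\<And>x. \<bar>A x - B x\<bar> \<le> BF"
    using bounded_compact_support[of "\<lambda>x. A x - B x" R] continuous_on_diff[OF cont(2,3)] zero by auto
  have f_deriv: "((\<lambda>t. f (y x t)) has_real_derivative A (y x t) - B (y x t)) (at t)" if "t > 0" for x t
  proof -
    have "(y x has_vector_derivative - curl \<psi> (y x t)) (at t)"
      using traj that by (simp add: is_trajectory_def)
    from has_real_derivative_compose_partial[OF \<phi>_diff this]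
    have "((\<lambda>t. \<phi> (y x t)) has_real_derivative - (curl \<psi> (y x t) \<bullet> grad \<phi> (y x t))) (at t)"
      by (simp add: inner_2 grad_def)
    from DERIV_mult[OF \<omega>_deriv[OF that] this] show ?thesis
      by (simp add: f_def A_def B_def algebra_simps)
  qed
  have f_y_cont: "continuous_on {0..} (\<lambda>t. f (y x t))" for x
    using traj[of x] by (intro continuous_on_UNIV_compose[OF cont(1)]) (simp add: is_trajectory_def)
  define h where "h = (\<lambda>n::nat. inverse (real (Suc n)))"
  have h: "h n > 0" "h n \<le> 1" for n by (auto simp: h_def field_simps)
  have h_lim: "h \<longlonglongrightarrow> 0" unfolding h_def by (rule LIMSEQ_inverse_real_of_nat)
  \<comment> \<open>The trajectory equation holds for \<open>t > 0\<close> only, so the derivative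
    at \<open>t = 0\<close> is reached through intermediate times tending to 0.\<close>
  have "\<exists>s. 0 < s \<and> s < h n \<and> (f (y x (h n)) - f x) / h n = A (y x s) - B (y x s)" for n x
  proof -
    obtain s where "0 < s" "s < h n" "f (y x (h n)) - f (y x 0) = (A (y x s) - B (y x s)) * (h n - 0)"
      by (rule mvt[OF h(1)[of n], of "\<lambda>t. f (y x t)" "\<lambda>t. (*) (A (y x t) - B (y x t))"])
        (use f_deriv f_y_cont[of x] in \<open>auto simp: has_field_derivative_def intro: continuous_on_subset\<close>)
    then show ?thesis using h(1)[of n] by (intro exI[of _ s]) (simp add: y0)
  qed
  then obtain s where s: "\<And>n x. 0 < s n x" "\<And>n x. s n x < h n"
    "\<And>n x. (f (y x (h n)) - f x) / h n = A (y x (s n x)) - B (y x (s n x))" by metis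
  have fi: "f absolutely_integrable_on UNIV" "A absolutely_integrable_on UNIV" "B absolutely_integrable_on UNIV"
    using cont zero by (auto intro: absolutely_integrable_compact_support)
  have fy_int: "(\<lambda>x. f (y x (h n))) integrable_on UNIV" for n
    by (rule flow_integral_eq(1)[OF traj y0 h(1) cont(1) zero(1)])
  have "(\<lambda>n. integral UNIV (\<lambda>x. (f (y x (h n)) - f x) / h n)) \<longlonglongrightarrow> integral UNIV (\<lambda>x. A x - B x)"
  proof (rule dominated_convergence(2))
    show "(\<lambda>x. (f (y x (h n)) - f x) / h n) integrable_on UNIV" for n
      using fy_int fi(1) by (intro integrable_on_divide integrable_diff) (auto simp: absolutely_integrable_on_def)
    \<comment> \<open>Times below \<open>h n \<le> 1\<close> displace a point by at most
      \<open>M\<close>, so outside the radius \<open>R + M\<close> the quotient vanishes for every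
      \<open>n\<close>.\<close>
    show "(\<lambda>x. BF * indicator (cball (0::real^2) (R + M)) x) integrable_on UNIV"
      by (intro integrable_on_mult_right) (simp add: integrable_on_indicator)
    show "norm ((f (y x (h n)) - f x) / h n) \<le> BF * indicator (cball (0::real^2) (R + M)) x" for n x
    proof (cases "norm x > R + M")
      case True
      have "norm (y x (s n x) - x) \<le> M * s n x"
        using trajectory_displacement[OF traj, of 0 "s n x" x] s(1)[of n x] by (simp add: y0)
      also have "\<dots> \<le> M * 1"
        using s(2)[of n x] h(2)[of n] M by (intro mult_left_mono) auto
      finally have "norm (y x (s n x)) > R"
        using True norm_triangle_ineq4[of "y x (s n x)" "y x (s n x) - x"] by simp
      then show ?thesis using BF unfolding s(3) by (simp add: zero)
    next
      case False
      then show ?thesis using BF unfolding s(3) by simp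
    qed
    show "(\<lambda>n. (f (y x (h n)) - f x) / h n) \<longlonglongrightarrow> A x - B x" for x
    proof -
      have "(\<lambda>n. s n x) \<longlonglongrightarrow> 0"
        by (rule tendsto_sandwich[OF _ _ tendsto_const h_lim]) (auto intro!: always_eventually less_imp_le s)
      then have "(\<lambda>n. y x (s n x)) \<longlonglongrightarrow> y x 0"
        using traj[of x] s(1) unfolding is_trajectory_def
        by (intro continuous_on_tendsto_compose[of "{0..}" "y x"]) (auto intro!: always_eventually less_imp_le)
      moreover have "isCont (\<lambda>x. A x - B x) x"
        using continuous_on_diff[OF cont(2,3)] by (simp add: continuous_on_eq_continuous_at)
      ultimately show ?thesis
        unfolding s(3) y0 by (rule isCont_tendsto_compose[rotated])
    qed
  qed
  moreover have "integral UNIV (\<lambda>x. (f (y x (h n)) - f x) / h n) = 0" for n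
  proof -
    have "integral UNIV (\<lambda>x. f (y x (h n)) - f x) = 0"
      using flow_integral_eq(2)[OF traj y0 h(1)[of n] cont(1) zero(1)] fy_int fi(1)
      by (subst integral_diff) (auto simp: absolutely_integrable_on_def)
    then show ?thesis by simp
  qed
  ultimately have "(\<lambda>n. 0) \<longlonglongrightarrow> integral UNIV (\<lambda>x. A x - B x)"
    by (simp only:)
  then have "integral UNIV (\<lambda>x. A x - B x) = 0"
    by (rule LIMSEQ_unique[OF _ tendsto_const])
  then have "integral UNIV A = integral UNIV B"
    using fi by (subst (asm) integral_diff) (auto simp: absolutely_integrable_on_def)
  moreover have "integral UNIV B = - integral UNIV (\<lambda>x. (laplacian \<psi> x *\<^sub>R curl \<psi> x) \<bullet> grad \<phi> x)"
    unfolding B_def \<omega>_def by (simp flip: integral_neg)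
  moreover have "A = (\<lambda>x. - \<kappa> * laplacian (\<lambda>z. \<psi> z - psi_star z) x * \<phi> x)"
    unfolding A_def \<omega>_def laplacian_minus_psi_star[OF C2] by (simp add: psi_star_def algebra_simps)
  ultimately show "- integral UNIV (\<lambda>x. (laplacian \<psi> x *\<^sub>R curl \<psi> x) \<bullet> grad \<phi> x)
      = integral UNIV (\<lambda>x. - \<kappa> * laplacian (\<lambda>z. \<psi> z - psi_star z) x * \<phi> x)"
    by (simp only:)
qed

section \<open>Uniqueness\<close>

lemma integral_UNIV_rescale:
  fixes F :: "real^2 \<Rightarrow> real"
  assumes F: "continuous_on UNIV F" and \<epsilon>: "\<epsilon> > 0"
    and supp: "\<And>w. w \<notin> cbox (vector [-1, -1]) (vector [1, 1]) \<Longrightarrow> F (x + \<epsilon> *\<^sub>R w) = 0"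
  shows "integral UNIV F = \<epsilon>\<^sup>2 * integral (cbox (vector [-1, -1]) (vector [1, 1])) (\<lambda>w. F (x + \<epsilon> *\<^sub>R w))"
proof -
  let ?l = "x + \<epsilon> *\<^sub>R vector [-1, -1]" and ?u = "x + \<epsilon> *\<^sub>R vector [1, 1]"
  have "F = (\<lambda>z. if z \<in> cbox ?l ?u then F z else 0)"
  proof (intro ext)
    fix z
    have z: "x + \<epsilon> *\<^sub>R ((z - x) /\<^sub>R \<epsilon>) = z" using \<epsilon> by simp
    have "F z = 0" if "z \<notin> cbox ?l ?u"
    proof -
      have "(z - x) /\<^sub>R \<epsilon> \<notin> cbox (vector [-1, -1]) (vector [1, 1])"
        using that \<epsilon> by (auto simp: mem_cbox_2 field_simps)
      then show ?thesis using supp[of "(z - x) /\<^sub>R \<epsilon>"] z by simp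
    qed
    then show "F z = (if z \<in> cbox ?l ?u then F z else 0)" by simp
  qed
  then have "integral UNIV F = integral (cbox ?l ?u) F"
    using Henstock_Kurzweil_Integration.integral_restrict_UNIV[of "cbox ?l ?u" F] by simp
  moreover have "(F has_integral integral (cbox ?l ?u) F) (cbox ?l ?u)"
    by (intro integrable_integral integrable_continuous continuous_on_subset[OF F]) simp
  from has_integral_affinity'[OF this \<epsilon>, of x]
  have "((\<lambda>w. F (x + \<epsilon> *\<^sub>R w)) has_integral integral (cbox ?l ?u) F / \<epsilon>\<^sup>2) (cbox (vector [-1, -1]) (vector [1, 1]))"
    using \<epsilon> by (simp add: add.commute divide_inverse mult.commute power2_eq_square)
  then have "integral (cbox (vector [-1, -1]) (vector [1, 1])) (\<lambda>w. F (x + \<epsilon> *\<^sub>R w)) = integral (cbox ?l ?u) F / \<epsilon>\<^sup>2"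
    by (rule integral_unique)
  ultimately show ?thesis using \<epsilon> by simp
qed

text \<open>The test function is the product bump centred at \<open>x\<close> and scaled by
  \<open>\<epsilon>\<close>. Rescaling the variable gives the same factor on both sides, while the
  gradient contributes \<open>1 / \<epsilon>\<close>; hence the single \<open>\<epsilon>\<close> on
  the right. With \<open>x\<close> free, this is the mollified equation.\<close>

lemma euler_solution_tested_against_bump:
  fixes b b' :: "real \<Rightarrow> real"
  assumes C2: "Ck 2 \<psi>" and sol: "euler_solution \<kappa> \<psi>" and \<epsilon>: "\<epsilon> > 0"
    and b: "\<And>k. Ck_real k b" "\<And>t. (b has_real_derivative b' t) (at t)" "continuous_on UNIV b'"
      "\<And>t. \<bar>t\<bar> \<ge> 1 \<Longrightarrow> b t = 0" "\<And>t. \<bar>t\<bar> \<ge> 1 \<Longrightarrow> b' t = 0"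
  shows "integral (cbox (vector [-1, -1]) (vector [1, 1])) (\<lambda>w. laplacian \<psi> (x + \<epsilon> *\<^sub>R w) *
      (curl \<psi> (x + \<epsilon> *\<^sub>R w) \<bullet> vector [b' (w $ 1) * b (w $ 2), b (w $ 1) * b' (w $ 2)]))
    = \<epsilon> * \<kappa> * integral (cbox (vector [-1, -1]) (vector [1, 1]))
      (\<lambda>w. (laplacian \<psi> (x + \<epsilon> *\<^sub>R w) + cos ((x + \<epsilon> *\<^sub>R w) $ 2)) * (b (w $ 1) * b (w $ 2)))"
proof -
  let ?S = "cbox (vector [-1, -1]) (vector [1, 1]) :: (real^2) set"
  \<comment> \<open>This is \<open>b\<close> at \<open>(t - x $ i) / \<epsilon>\<close>, written as
    an affine function of \<open>t\<close> to match \<open>Ck_real_affine\<close>.\<close>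
  define f where "f = (\<lambda>i t. b (1 / \<epsilon> * t + (- x $ i / \<epsilon>)))"
  define f' where "f' = (\<lambda>i t. b' (1 / \<epsilon> * t + (- x $ i / \<epsilon>)) * (1 / \<epsilon>))"
  define \<phi> where "\<phi> = (\<lambda>z::real^2. f 1 (z $ 1) * f 2 (z $ 2))"
  have f_Ck: "Ck_real k (f i)" for k i unfolding f_def by (rule Ck_real_affine[OF b(1)])
  have f': "(f i has_real_derivative f' i t) (at t)" for i t
    unfolding f_def f'_def by (rule DERIV_chain2[OF b(2)]) (use \<epsilon> in \<open>auto intro!: derivative_eq_intros\<close>)
  have f_zero: "f i t = 0" "f' i t = 0" if "\<bar>t - x $ i\<bar> \<ge> \<epsilon>" for i t
  proof -
    have "1 / \<epsilon> * t + (- x $ i / \<epsilon>) = (t - x $ i) / \<epsilon>" by (simp add: diff_divide_distrib)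
    then have "\<bar>1 / \<epsilon> * t + (- x $ i / \<epsilon>)\<bar> \<ge> 1" using that \<epsilon> by simp
    then show "f i t = 0" "f' i t = 0" using b(4,5) by (simp_all add: f_def f'_def)
  qed
  have f_cont: "continuous_on UNIV (f i)" "continuous_on UNIV (f' i)" for i
    unfolding f_def f'_def
    by (intro continuous_intros continuous_on_UNIV_compose[OF b(3)]
        continuous_on_UNIV_compose[OF Ck_real_imp_continuous[OF b(1)[of 0]]])+
  have \<phi>': "partial 1 \<phi> = (\<lambda>z. f' 1 (z $ 1) * f 2 (z $ 2))" "partial 2 \<phi> = (\<lambda>z. f 1 (z $ 1) * f' 2 (z $ 2))"
    unfolding \<phi>_def by (rule partial_prod_2[OF f' f'])+
  have out: "\<phi> z = 0" "grad \<phi> z = 0" if "\<bar>z $ 1 - x $ 1\<bar> \<ge> \<epsilon> \<or> \<bar>z $ 2 - x $ 2\<bar> \<ge> \<epsilon>" for z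
  proof -
    show "\<phi> z = 0" using that f_zero by (auto simp: \<phi>_def)
    have "partial 1 \<phi> z = 0" "partial 2 \<phi> z = 0" using that f_zero by (auto simp: \<phi>')
    then show "grad \<phi> z = 0" by (simp add: grad_def vec_eq_iff forall_2)
  qed
  have "test_function \<phi>"
    unfolding test_function_def
  proof (intro conjI allI)
    show "Ck k \<phi>" for k unfolding \<phi>_def by (rule Ck_prod_2[OF f_Ck f_Ck])
    have "{z. \<phi> z \<noteq> 0} \<subseteq> cbox (x + \<epsilon> *\<^sub>R vector [-1, -1]) (x + \<epsilon> *\<^sub>R vector [1, 1])"
    proof
      fix z assume "z \<in> {z. \<phi> z \<noteq> 0}"
      then have "\<bar>z $ 1 - x $ 1\<bar> < \<epsilon>" "\<bar>z $ 2 - x $ 2\<bar> < \<epsilon>" using out(1)[of z] by force+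
      then show "z \<in> cbox (x + \<epsilon> *\<^sub>R vector [-1, -1]) (x + \<epsilon> *\<^sub>R vector [1, 1])"
        by (auto simp: mem_cbox_2)
    qed
    then show "compact (closure {z. \<phi> z \<noteq> 0})"
      using bounded_subset[OF bounded_cbox] by (simp only: compact_closure)
  qed
  then have weak: "- integral UNIV (\<lambda>z. (laplacian \<psi> z *\<^sub>R curl \<psi> z) \<bullet> grad \<phi> z)
      = integral UNIV (\<lambda>z. - \<kappa> * laplacian (\<lambda>z. \<psi> z - psi_star z) z * \<phi> z)"
    using sol by (simp add: euler_solution_def)
  have c: "continuous_on UNIV (laplacian \<psi>)" "continuous_on UNIV (curl \<psi>)"
    using Ck_2D(6)[OF C2] curl_has_derivative[OF C2]
    by (auto intro!: continuous_at_imp_continuous_on intro: has_derivative_continuous)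
  have fz: "continuous_on UNIV (\<lambda>z::real^2. f i (z $ j))" "continuous_on UNIV (\<lambda>z::real^2. f' i (z $ j))" for i j
    by (intro continuous_on_UNIV_compose[OF f_cont(1)] continuous_on_UNIV_compose[OF f_cont(2)] continuous_intros)+
  have outside: "\<bar>(x + \<epsilon> *\<^sub>R w) $ 1 - x $ 1\<bar> \<ge> \<epsilon> \<or> \<bar>(x + \<epsilon> *\<^sub>R w) $ 2 - x $ 2\<bar> \<ge> \<epsilon>" if "w \<notin> ?S" for w
  proof -
    have "\<bar>w $ 1\<bar> \<ge> 1 \<or> \<bar>w $ 2\<bar> \<ge> 1" using that by (auto simp: mem_cbox_2)
    then show ?thesis using \<epsilon> by (simp add: abs_mult)
  qed
  have grad: "grad \<phi> (x + \<epsilon> *\<^sub>R w) = (1 / \<epsilon>) *\<^sub>R vector [b' (w $ 1) * b (w $ 2), b (w $ 1) * b' (w $ 2)]" for w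
    using \<epsilon> by (simp add: grad_def vec_eq_iff forall_2 \<phi>' f_def f'_def add_divide_distrib)
  have \<phi>_at: "\<phi> (x + \<epsilon> *\<^sub>R w) = b (w $ 1) * b (w $ 2)" for w
    using \<epsilon> by (simp add: \<phi>_def f_def add_divide_distrib)
  have "integral UNIV (\<lambda>z. (laplacian \<psi> z *\<^sub>R curl \<psi> z) \<bullet> grad \<phi> z)
      = \<epsilon>\<^sup>2 * integral ?S (\<lambda>w. (laplacian \<psi> (x + \<epsilon> *\<^sub>R w) *\<^sub>R curl \<psi> (x + \<epsilon> *\<^sub>R w)) \<bullet> grad \<phi> (x + \<epsilon> *\<^sub>R w))"
  proof (rule integral_UNIV_rescale[OF _ \<epsilon>])
    have "continuous_on UNIV (grad \<phi>)"
    proof -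
      have "continuous_on UNIV (partial i \<phi>)" for i
        using exhaust_2[of i] fz by (auto simp: \<phi>' intro!: continuous_on_mult)
      then show ?thesis unfolding grad_def[abs_def] by (rule continuous_on_vec_lambda)
    qed
    then show "continuous_on UNIV (\<lambda>z. (laplacian \<psi> z *\<^sub>R curl \<psi> z) \<bullet> grad \<phi> z)"
      by (intro continuous_on_inner continuous_on_scaleR c)
  qed (use out(2)[OF outside] in simp)
  also have "\<dots> = \<epsilon> * integral ?S (\<lambda>w. laplacian \<psi> (x + \<epsilon> *\<^sub>R w) *
      (curl \<psi> (x + \<epsilon> *\<^sub>R w) \<bullet> vector [b' (w $ 1) * b (w $ 2), b (w $ 1) * b' (w $ 2)]))"
    using \<epsilon> by (simp add: grad power2_eq_square)
  finally have 1: "integral UNIV (\<lambda>z. (laplacian \<psi> z *\<^sub>R curl \<psi> z) \<bullet> grad \<phi> z)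
    = \<epsilon> * integral ?S (\<lambda>w. laplacian \<psi> (x + \<epsilon> *\<^sub>R w) *
      (curl \<psi> (x + \<epsilon> *\<^sub>R w) \<bullet> vector [b' (w $ 1) * b (w $ 2), b (w $ 1) * b' (w $ 2)]))" .
  have "integral UNIV (\<lambda>z. (laplacian \<psi> z + cos (z $ 2)) * \<phi> z)
      = \<epsilon>\<^sup>2 * integral ?S (\<lambda>w. (laplacian \<psi> (x + \<epsilon> *\<^sub>R w) + cos ((x + \<epsilon> *\<^sub>R w) $ 2)) * \<phi> (x + \<epsilon> *\<^sub>R w))"
  proof (rule integral_UNIV_rescale[OF _ \<epsilon>])
    show "continuous_on UNIV (\<lambda>z. (laplacian \<psi> z + cos (z $ 2)) * \<phi> z)"
      unfolding \<phi>_def by (intro continuous_on_mult continuous_on_add c fz continuous_intros)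
  qed (use out(1)[OF outside] in simp)
  then have "integral UNIV (\<lambda>z. - \<kappa> * laplacian (\<lambda>z. \<psi> z - psi_star z) z * \<phi> z)
      = - \<kappa> * (\<epsilon>\<^sup>2 * integral ?S (\<lambda>w. (laplacian \<psi> (x + \<epsilon> *\<^sub>R w) + cos ((x + \<epsilon> *\<^sub>R w) $ 2)) * (b (w $ 1) * b (w $ 2))))"
    unfolding laplacian_minus_psi_star[OF C2] \<phi>_at mult.assoc by simp
  with weak 1 \<epsilon> show ?thesis by (simp add: power2_eq_square)
qed

lemma euler_solution_energy_identities:
  assumes a: "a > 0" and \<kappa>: "\<kappa> \<noteq> 0" and C2: "Ck 2 \<psi>" and per: "biperiodic a \<psi>"
    and sol: "euler_solution \<kappa> \<psi>"
  shows "integral (Omega a) (\<lambda>x. laplacian \<psi> x * (laplacian \<psi> x + cos (x $ 2))) = 0"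
    and "- integral (Omega a) (\<lambda>x. laplacian \<psi> x * sin (x $ 2) * partial 1 \<psi> x)
      = \<kappa> * integral (Omega a) (\<lambda>x. (laplacian \<psi> x + cos (x $ 2)) * cos (x $ 2))"
proof -
  obtain b b' :: "real \<Rightarrow> real" where b: "\<And>k. Ck_real k b" "\<And>t. (b has_real_derivative b' t) (at t)"
    "continuous_on UNIV b" "continuous_on UNIV b'"
    and even: "\<And>t. b (- t) = b t" and odd: "\<And>t. b' (- t) = - b' t"
    and zero: "\<And>t. \<bar>t\<bar> \<ge> 1 \<Longrightarrow> b t = 0" "\<And>t. \<bar>t\<bar> \<ge> 1 \<Longrightarrow> b' t = 0" and pos: "\<And>t. \<bar>t\<bar> < 1 \<Longrightarrow> b t > 0"
    using bump_exists by blast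
  let ?S = "cbox (vector [-1, -1]) (vector [1, 1]) :: (real^2) set"
  let ?u = "\<lambda>x. laplacian \<psi> x + cos (x $ 2)"
  define \<theta> where "\<theta> = (\<lambda>w::real^2. b (w $ 1) * b (w $ 2))"
  \<comment> \<open>\<open>H\<close> is the gradient of \<open>\<theta>\<close>, odd because
    \<open>\<theta>\<close> is even.\<close>
  define H where "H = (\<lambda>w::real^2. vector [b' (w $ 1) * b (w $ 2), b (w $ 1) * b' (w $ 2)] :: real^2)"
  note prod = integral_cbox_prod[of _ _ "-1" "-1" 1 1]
  have bc [continuous_intros]: "continuous_on T (\<lambda>x. b (g x))" "continuous_on T (\<lambda>x. b' (g x))"
    if "continuous_on T g" for T :: "'z::topological_space set" and g
    using that b(3,4) continuous_on_UNIV_compose by blast+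
  have \<theta>_cont: "continuous_on UNIV \<theta>" and H_cont: "continuous_on UNIV H"
    unfolding \<theta>_def H_def by (intro continuous_intros)+
  have H_odd: "H (- w) = - H w" for w by (simp add: H_def even odd vec_eq_iff forall_2)
  have L: "continuous_on UNIV (laplacian \<psi>)" "biperiodic a (laplacian \<psi>)"
    using Ck_2D(6)[OF C2] biperiodic_laplacian[OF per C2] .
  have u: "continuous_on UNIV ?u" "biperiodic a ?u"
    using L by (auto simp: biperiodic_def intro!: continuous_intros)
  have weak: "integral ?S (\<lambda>w. laplacian \<psi> (x + \<epsilon> *\<^sub>R w) * (curl \<psi> (x + \<epsilon> *\<^sub>R w) \<bullet> H w))
      = \<epsilon> * \<kappa> * integral ?S (\<lambda>w. ?u (x + \<epsilon> *\<^sub>R w) * \<theta> w)" if "\<epsilon> > 0" for \<epsilon> x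
    using euler_solution_tested_against_bump[OF C2 sol that b(1,2,4) zero] unfolding H_def \<theta>_def .
  \<comment> \<open>The mass of \<open>b\<close> and its cosine moment \<open>\<gamma>\<close>, the
    factor by which convolution with \<open>b\<close> multiplies a cosine.\<close>
  define \<beta> where "\<beta> = integral {-1..1} b"
  define \<gamma> where "\<gamma> = integral {-1..1} (\<lambda>t. cos t * b t)"
  have pos_int: "integral {-1..1} (\<lambda>t. g t * b t) > 0"
    if "continuous_on UNIV g" "\<And>t. \<bar>t\<bar> < 1 \<Longrightarrow> g t > 0" for g :: "real \<Rightarrow> real"
  proof -
    have "integral (cbox (-1) 1) (\<lambda>t::real. 0) < integral (cbox (-1) 1) (\<lambda>t. g t * b t)"
      using that pos by (intro integral_less continuous_on_mult continuous_intros continuous_on_subset[OF that(1)]) (auto simp: box_real abs_less_iff)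
    then show ?thesis by simp
  qed
  have \<beta>_pos: "\<beta> > 0" using pos_int[of "\<lambda>_. 1"] by (simp add: \<beta>_def)
  have \<gamma>_pos: "\<gamma> > 0" unfolding \<gamma>_def
  proof (rule pos_int)
    show "cos t > 0" if "\<bar>t\<bar> < 1" for t :: real
      using that pi_gt3 by (intro cos_gt_zero_pi) auto
  qed (intro continuous_intros)
  have b'_int: "integral {-1..1} b' = 0" by (rule integral_odd_eq_0) (rule odd)
  have tb_int: "integral {-1..1} (\<lambda>t. t * b t) = 0" by (rule integral_odd_eq_0) (simp add: even)
  obtain K M C where "lipschitz_field (curl \<psi>) (curl_deriv \<psi>) K M C"
    using curl_lipschitz_field[OF a C2 per] .
  then interpret lipschitz_field "curl \<psi>" "curl_deriv \<psi>" K M C .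
  show "integral (Omega a) (\<lambda>x. laplacian \<psi> x * ?u x) = 0"
  proof (rule renormalized_energy_identity[OF a \<kappa> L u deriv biperiodic_curl[OF per C2] lipschitz _ H_cont H_odd \<theta>_cont _ weak])
    show "continuous_on UNIV (\<lambda>(x, w). curl_deriv \<psi> x w)"
      unfolding curl_deriv_def case_prod_unfold
      by (intro continuous_intros continuous_on_UNIV_compose[OF Ck_2D(5)[OF C2]])
    show "integral ?S \<theta> \<noteq> 0"
      using prod[OF b(3) b(3)] \<beta>_pos by (simp add: \<theta>_def \<beta>_def)
    \<comment> \<open>Parity kills the off-diagonal moments of the kernel and its symmetry makes the
      diagonal ones equal, so the integral is a multiple of the trace of
      \<open>curl_deriv \<psi> x\<close>, a difference of mixed derivatives.\<close>
    show "integral ?S (\<lambda>w. curl_deriv \<psi> x w \<bullet> H w) = 0" for x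
    proof -
      let ?\<alpha> = "integral {-1..1} (\<lambda>t. t * b' t)"
      have I: "integral ?S (\<lambda>w. (w $ 1 * b' (w $ 1)) * b (w $ 2)) = ?\<alpha> * \<beta>"
        "integral ?S (\<lambda>w. b' (w $ 1) * (w $ 2 * b (w $ 2))) = 0"
        "integral ?S (\<lambda>w. (w $ 1 * b (w $ 1)) * b' (w $ 2)) = 0"
        "integral ?S (\<lambda>w. b (w $ 1) * (w $ 2 * b' (w $ 2))) = ?\<alpha> * \<beta>"
        by (subst prod; auto simp: \<beta>_def b'_int tb_int intro!: continuous_intros)+
      let ?A = "partial 1 (partial 1 \<psi>) x" and ?D = "partial 1 (partial 2 \<psi>) x"
        and ?E = "partial 2 (partial 1 \<psi>) x" and ?F = "partial 2 (partial 2 \<psi>) x"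
      have "(\<lambda>w. curl_deriv \<psi> x w \<bullet> H w) = (\<lambda>w. ((- ?D) * ((w $ 1 * b' (w $ 1)) * b (w $ 2)) + (- ?F) * (b' (w $ 1) * (w $ 2 * b (w $ 2))))
          + (?A * ((w $ 1 * b (w $ 1)) * b' (w $ 2)) + ?E * (b (w $ 1) * (w $ 2 * b' (w $ 2)))))"
        by (simp add: fun_eq_iff inner_2 curl_deriv_def H_def algebra_simps)
      moreover have int: "(\<lambda>w. c * g w) integrable_on ?S" if "continuous_on UNIV g" for c and g :: "real^2 \<Rightarrow> real"
        by (intro integrable_continuous continuous_on_mult continuous_on_subset[OF that] continuous_intros) simp
      moreover have lin: "integral ?S (\<lambda>w. (c1 * g1 w + c2 * g2 w) + (c3 * g3 w + c4 * g4 w))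
          = (c1 * integral ?S g1 + c2 * integral ?S g2) + (c3 * integral ?S g3 + c4 * integral ?S g4)"
        if "continuous_on UNIV g1" "continuous_on UNIV g2" "continuous_on UNIV g3" "continuous_on UNIV g4"
        for c1 c2 c3 c4 and g1 g2 g3 g4 :: "real^2 \<Rightarrow> real"
        by (simp add: integral_add integrable_add int that)
      have "integral ?S (\<lambda>w. ((- ?D) * ((w $ 1 * b' (w $ 1)) * b (w $ 2)) + (- ?F) * (b' (w $ 1) * (w $ 2 * b (w $ 2))))
          + (?A * ((w $ 1 * b (w $ 1)) * b' (w $ 2)) + ?E * (b (w $ 1) * (w $ 2 * b' (w $ 2)))))
        = ((- ?D) * (?\<alpha> * \<beta>) + (- ?F) * 0) + (?A * 0 + ?E * (?\<alpha> * \<beta>))"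
      proof -
        have "continuous_on UNIV (\<lambda>w::real^2. (w $ 1 * b' (w $ 1)) * b (w $ 2))" "continuous_on UNIV (\<lambda>w::real^2. b' (w $ 1) * (w $ 2 * b (w $ 2)))"
          "continuous_on UNIV (\<lambda>w::real^2. (w $ 1 * b (w $ 1)) * b' (w $ 2))" "continuous_on UNIV (\<lambda>w::real^2. b (w $ 1) * (w $ 2 * b' (w $ 2)))"
          by (intro continuous_intros)+
        from lin[OF this] show ?thesis unfolding I .
      qed
      ultimately have "integral ?S (\<lambda>w. curl_deriv \<psi> x w \<bullet> H w) = (- ?D) * (?\<alpha> * \<beta>) + ?E * (?\<alpha> * \<beta>)"
        by (simp only:)
      then show ?thesis using mixed_partials_eq[OF C2] by simp
    qed
  qed
  have "- integral (Omega a) (\<lambda>x. laplacian \<psi> x * sin (x $ 2) * curl \<psi> x $ 2) = \<kappa> * integral (Omega a) (\<lambda>x. ?u x * cos (x $ 2))"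
  proof (rule weak_identity_against_cos[OF a L u continuous_v biperiodic_curl[OF per C2] H_cont \<theta>_cont])
    show "integral ?S (\<lambda>w. laplacian \<psi> (x + w) * (curl \<psi> (x + w) \<bullet> H w)) = \<kappa> * integral ?S (\<lambda>w. ?u (x + w) * \<theta> w)" for x
      using weak[OF zero_less_one, of x] by simp
    have cos_b: "integral {-1..1} (\<lambda>t. cos (r - t) * b t) = \<gamma> * cos r"
      and sin_b: "integral {-1..1} (\<lambda>t. sin (r - t) * b t) = \<gamma> * sin r" for r
    proof -
      \<comment> \<open>The addition theorems below leave a sine moment of \<open>b\<close>, which
        is zero by parity.\<close>
      have sin0: "integral {-1..1} (\<lambda>t. sin t * b t) = 0" by (rule integral_odd_eq_0) (simp add: even)
      have i: "(\<lambda>t. c * (cos t * b t)) integrable_on {-1..1}" "(\<lambda>t. c * (sin t * b t)) integrable_on {-1..1}" for c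
        by (intro integrable_continuous_real continuous_intros)+
      have "(\<lambda>t. cos (r - t) * b t) = (\<lambda>t. cos r * (cos t * b t) + sin r * (sin t * b t))"
        by (simp add: fun_eq_iff cos_diff algebra_simps)
      then show "integral {-1..1} (\<lambda>t. cos (r - t) * b t) = \<gamma> * cos r"
        using integral_add[OF i] by (simp add: sin0 \<gamma>_def)
      have "(\<lambda>t. sin (r - t) * b t) = (\<lambda>t. sin r * (cos t * b t) - cos r * (sin t * b t))"
        by (simp add: fun_eq_iff sin_diff algebra_simps)
      then show "integral {-1..1} (\<lambda>t. sin (r - t) * b t) = \<gamma> * sin r"
        using integral_diff[OF i] by (simp add: sin0 \<gamma>_def)
    qed
    have cos_b': "integral {-1..1} (\<lambda>t. cos (r - t) * b' t) = - \<gamma> * sin r" for r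
    proof -
      \<comment> \<open>Integration by parts: the integrand is the derivative of
        \<open>cos (r - t) * b t\<close>, which vanishes at both ends.\<close>
      have "((\<lambda>t. sin (r - t) * b t + cos (r - t) * b' t) has_integral cos (r - 1) * b 1 - cos (r - (-1)) * b (-1)) {-1..1}"
        by (rule fundamental_theorem_of_calculus)
          (auto simp: has_real_derivative_iff_has_vector_derivative[symmetric] intro!: derivative_eq_intros has_field_derivative_at_within[OF b(2)])
      then have "integral {-1..1} (\<lambda>t. sin (r - t) * b t + cos (r - t) * b' t) = 0"
        using zero(1)[of 1] zero(1)[of "-1"] by (simp add: integral_unique)
      moreover have "integral {-1..1} (\<lambda>t. sin (r - t) * b t + cos (r - t) * b' t)
          = integral {-1..1} (\<lambda>t. sin (r - t) * b t) + integral {-1..1} (\<lambda>t. cos (r - t) * b' t)"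
        by (intro integral_add integrable_continuous_real continuous_intros)
      ultimately show ?thesis using sin_b[of r] by simp
    qed
    show "integral ?S (\<lambda>w. cos (r - w $ 2) * \<theta> w) = (\<beta> * \<gamma>) * cos r" for r
    proof -
      have "(\<lambda>w::real^2. cos (r - w $ 2) * \<theta> w) = (\<lambda>w. b (w $ 1) * (cos (r - w $ 2) * b (w $ 2)))"
        by (simp add: \<theta>_def fun_eq_iff)
      then show ?thesis using prod[of b "\<lambda>t. cos (r - t) * b t"]
        by (simp add: b(3) continuous_intros cos_b \<beta>_def)
    qed
    show "integral ?S (\<lambda>w. cos (r - w $ 2) * (y \<bullet> H w)) = - (\<beta> * \<gamma>) * sin r * y $ 2" for r y
    proof -
      have I: "integral ?S (\<lambda>w. b' (w $ 1) * (cos (r - w $ 2) * b (w $ 2))) = 0"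
        "integral ?S (\<lambda>w. b (w $ 1) * (cos (r - w $ 2) * b' (w $ 2))) = \<beta> * (- \<gamma> * sin r)"
        using prod[of b' "\<lambda>t. cos (r - t) * b t"] prod[of b "\<lambda>t. cos (r - t) * b' t"]
        by (simp_all add: b(3,4) continuous_intros b'_int cos_b' \<beta>_def)
      have "(\<lambda>w. cos (r - w $ 2) * (y \<bullet> H w)) = (\<lambda>w. y $ 1 * (b' (w $ 1) * (cos (r - w $ 2) * b (w $ 2)))
          + y $ 2 * (b (w $ 1) * (cos (r - w $ 2) * b' (w $ 2))))"
        by (simp add: H_def inner_2 fun_eq_iff algebra_simps)
      moreover have "(\<lambda>w. y $ 1 * (b' (w $ 1) * (cos (r - w $ 2) * b (w $ 2)))) integrable_on ?S"
        "(\<lambda>w. y $ 2 * (b (w $ 1) * (cos (r - w $ 2) * b' (w $ 2)))) integrable_on ?S"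
        by (intro integrable_continuous continuous_intros)+
      ultimately show ?thesis using I by (simp add: integral_add)
    qed
    show "\<beta> * \<gamma> \<noteq> 0" using \<beta>_pos \<gamma>_pos by simp
  qed
  then show "- integral (Omega a) (\<lambda>x. laplacian \<psi> x * sin (x $ 2) * partial 1 \<psi> x) = \<kappa> * integral (Omega a) (\<lambda>x. ?u x * cos (x $ 2))"
    by (simp add: curl_def)
qed

section \<open>From the energy identities to uniqueness\<close>

lemma integral_cos_eq_0: "a > 0 \<Longrightarrow> integral (Omega a) (\<lambda>x. cos (x $ 2)) = 0"
proof -
  assume a: "a > 0"
  have sin_partials: "(\<lambda>x::real^2. sin (x $ 2)) differentiable (at x)" "partial 2 (\<lambda>x. sin (x $ 2)) = (\<lambda>x. cos (x $ 2))" for x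
    by (rule partial_fun_2; auto intro!: derivative_eq_intros)+
  show ?thesis
    using integral_Omega_partial_eq_0[OF a, of "\<lambda>x. sin (x $ 2)" 2]
    by (simp add: sin_partials biperiodic_def continuous_intros)
qed

text \<open>The function depends on \<open>x\<^sub>2\<close> only and is affine in it; periodicity
  removes the slope and the mean removes the constant.\<close>

lemma biperiodic_harmonic_eq_0:
  assumes a: "a > 0" and C2: "Ck 2 \<phi>" and per: "biperiodic a \<phi>" and mean: "integral (Omega a) \<phi> = 0"
    and p: "\<And>x. partial 1 \<phi> x = 0" and harm: "\<And>x. laplacian \<phi> x = 0"
  shows "\<phi> x = 0"
proof -
  note \<phi> = Ck_2D[OF C2]
  have "partial 1 \<phi> = (\<lambda>x. 0)" using p by blast
  then have q: "partial 2 (partial 2 \<phi>) x = 0" for x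
    using harm[of x] by (simp add: laplacian_def partial_const)
  have const1: "\<phi> (vector [s, t]) = \<phi> (vector [0, t])" for s t
    using DERIV_isconst_all[of "\<lambda>s. \<phi> (vector [s, t])"] partial_line_1[OF \<phi>(1)] p by metis
  have const2: "\<phi> (vector [s, t]) = \<phi> (vector [s, 0])" for s t
  proof -
    have "vector [s, 0] + (vector [0, 2 * pi] :: real^2) = vector [s, 2 * pi]"
      by (simp add: vec_eq_iff forall_2)
    then have "\<phi> (vector [s, 2 * pi]) = \<phi> (vector [s, 0])"
      using per unfolding biperiodic_def by metis
    moreover obtain \<xi> where "\<phi> (vector [s, 2 * pi]) - \<phi> (vector [s, 0]) = (2 * pi - 0) * partial 2 \<phi> (vector [s, \<xi>])"
      using MVT2[of 0 "2 * pi" "\<lambda>t. \<phi> (vector [s, t])" "\<lambda>t. partial 2 \<phi> (vector [s, t])"] partial_line_2[OF \<phi>(1)] by auto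
    ultimately have "partial 2 \<phi> (vector [s, \<xi>]) = 0" by simp
    moreover have "partial 2 \<phi> (vector [s, t]) = partial 2 \<phi> (vector [s, \<xi>])" for t
      using DERIV_isconst_all[of "\<lambda>t. partial 2 \<phi> (vector [s, t])"] partial_line_2[OF \<phi>(2)] q by metis
    ultimately show ?thesis
      using DERIV_isconst_all[of "\<lambda>t. \<phi> (vector [s, t])"] partial_line_2[OF \<phi>(1)] by metis
  qed
  have const: "\<phi> x = \<phi> (vector [0, 0])" for x
    using const1[of "x $ 1" "x $ 2"] const2[of 0 "x $ 2"] by (simp add: vector_2_eta)
  let ?k = "\<phi> (vector [0, 0])"
  \<comment> \<open>The constant is multiplied by itself to obtain a nonnegative integrand, as
    \<open>integral_Omega_eq_0D\<close> requires.\<close>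
  have eq: "(\<lambda>x. ?k * \<phi> x) = (\<lambda>x. ?k * ?k)" by (intro ext arg_cong[where f = "(*) ?k"] const)
  have "integral (Omega a) (\<lambda>x. ?k * \<phi> x) = 0" using mean by simp
  then have "?k * ?k = 0"
    unfolding eq by (intro integral_Omega_eq_0D[OF a, of "\<lambda>x. ?k * ?k"]) (auto simp: biperiodic_def)
  then show ?thesis using const[of x] by simp
qed

theorem euler_solution_unique:
  assumes a: "a > 0" and \<kappa>: "\<kappa> \<ge> 1 / a" and C2: "Ck 2 \<psi>" and per: "biperiodic a \<psi>"
    and mean: "integral (Omega a) \<psi> = 0" and sol: "euler_solution \<kappa> \<psi>"
  shows "\<psi> = psi_star"
proof -
  have \<kappa>_pos: "\<kappa> > 0" using a \<kappa> by (meson divide_pos_pos less_le_trans zero_less_one)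
  note \<psi> = Ck_2D[OF C2]
  define \<phi> where "\<phi> = (\<lambda>x. \<psi> x - psi_star x)"
  define u where "u = (\<lambda>x. laplacian \<psi> x + cos (x $ 2))"
  define p where "p = partial 1 \<psi>"
  have \<phi>_C2: "Ck 2 \<phi>" unfolding \<phi>_def by (rule Ck_2_diff(1)[OF C2 Ck_2_psi_star])
  have \<phi>_per: "biperiodic a \<phi>" using per biperiodic_psi_star[of a] by (simp add: \<phi>_def biperiodic_def)
  have lap_\<phi>: "laplacian \<phi> = u" unfolding \<phi>_def u_def using laplacian_minus_psi_star[OF C2] by blast
  \<comment> \<open>\<open>psi_star\<close> does not depend on \<open>x\<^sub>1\<close>, so
    \<open>p\<close> is also the derivative of \<open>\<phi>\<close>, to which the Wirtinger bound
    is applied.\<close>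
  have p_\<phi>: "partial 1 \<phi> = p"
    using partial_diff[OF \<psi>(1) psi_star_partials(1), of 1] by (simp add: \<phi>_def p_def psi_star_partials fun_eq_iff)
  have u_cont: "continuous_on UNIV u" using Ck_2D(6)[OF \<phi>_C2] by (simp add: lap_\<phi>)
  have u_per: "biperiodic a u" using biperiodic_laplacian[OF \<phi>_per \<phi>_C2] by (simp add: lap_\<phi>)
  have p_cont: "continuous_on UNIV p" unfolding p_def by (rule \<psi>(4))
  have p_per: "biperiodic a p" unfolding p_def by (rule biperiodic_partial[OF per \<psi>(1)])
  note ci = continuous_intros u_cont p_cont
  have int: "f integrable_on Omega a" if "continuous_on UNIV f" for f :: "real^2 \<Rightarrow> real"
    by (rule integrable_on_Omega[OF that])
  have E: "integral (Omega a) (\<lambda>x. laplacian \<psi> x * u x) = 0"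
    "- integral (Omega a) (\<lambda>x. laplacian \<psi> x * sin (x $ 2) * p x) = \<kappa> * integral (Omega a) (\<lambda>x. u x * cos (x $ 2))"
    unfolding u_def p_def using euler_solution_energy_identities[OF a _ C2 per sol] \<kappa>_pos by simp_all
  have L: "laplacian \<psi> x = u x - cos (x $ 2)" for x by (simp add: u_def)
  let ?U = "integral (Omega a) (\<lambda>x. u x * u x)"
  \<comment> \<open>Inserting \<open>u x - cos (x $ 2)\<close> for the Laplacian into the first
    energy identity expresses the cosine moment of \<open>u\<close> by its square integral.\<close>
  have "integral (Omega a) (\<lambda>x. laplacian \<psi> x * u x) = integral (Omega a) (\<lambda>x. u x * u x - u x * cos (x $ 2))"
    by (simp add: L algebra_simps)
  also have "\<dots> = ?U - integral (Omega a) (\<lambda>x. u x * cos (x $ 2))"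
    by (intro integral_diff int ci)
  finally have A: "integral (Omega a) (\<lambda>x. u x * cos (x $ 2)) = ?U" using E(1) by simp
  have "integral (Omega a) (\<lambda>x. laplacian \<psi> x * sin (x $ 2) * p x)
      = integral (Omega a) (\<lambda>x. u x * sin (x $ 2) * p x - p x * (cos (x $ 2) * sin (x $ 2)))"
    by (simp add: L algebra_simps)
  also have "\<dots> = integral (Omega a) (\<lambda>x. u x * sin (x $ 2) * p x) - integral (Omega a) (\<lambda>x. p x * (cos (x $ 2) * sin (x $ 2)))"
    by (intro integral_diff int ci)
  \<comment> \<open>The integrand is the derivative in \<open>x\<^sub>1\<close> of a biperiodic
    function, because the trigonometric factor is independent of \<open>x\<^sub>1\<close>.\<close>
  also have "integral (Omega a) (\<lambda>x. p x * (cos (x $ 2) * sin (x $ 2))) = 0"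
  proof -
    let ?g = "\<lambda>x::real^2. cos (x $ 2) * sin (x $ 2)"
    have "((\<lambda>t. cos t * sin t) has_real_derivative cos t * cos t - sin t * sin t) (at t)" for t :: real
      by (auto intro!: derivative_eq_intros)
    note g = partial_fun_2(1,2)[of "\<lambda>t. cos t * sin t", OF this]
    have eq: "partial 1 (\<lambda>x. \<psi> x * ?g x) = (\<lambda>x. p x * ?g x)"
      using partial_mult[OF \<psi>(1) g(1)] by (simp add: g(2) p_def fun_eq_iff)
    have "continuous_on UNIV (\<lambda>x. p x * ?g x)" by (intro ci)
    moreover have "biperiodic a (\<lambda>x. \<psi> x * ?g x)" using per by (simp add: biperiodic_def)
    ultimately show ?thesis
      using integral_Omega_partial_eq_0[OF a, of "\<lambda>x. \<psi> x * ?g x" 1] differentiable_mult[OF \<psi>(1) g(1)] by (simp only: eq)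
  qed
  finally have B: "- integral (Omega a) (\<lambda>x. u x * sin (x $ 2) * p x) = \<kappa> * ?U" using E(2) A by simp
  have "\<kappa>\<^sup>2 * ?U = \<kappa> * (\<kappa> * ?U)" by (simp add: power2_eq_square)
  also have "\<dots> = integral (Omega a) (\<lambda>x. - \<kappa> * (u x * sin (x $ 2) * p x))"
    unfolding B[symmetric] by simp
  \<comment> \<open>Young's inequality with equal weights: half of the left side is absorbed, which
    leaves \<open>C\<close> with constant 1, as the borderline case \<open>\<kappa> * a = 1\<close>
    demands.\<close>
  also have "\<dots> \<le> integral (Omega a) (\<lambda>x. \<kappa>\<^sup>2 / 2 * (u x * u x) + 1 / 2 * (sin (x $ 2) * p x)\<^sup>2)"
  proof (intro integral_le int ci)
    show "- \<kappa> * (u x * sin (x $ 2) * p x) \<le> \<kappa>\<^sup>2 / 2 * (u x * u x) + 1 / 2 * (sin (x $ 2) * p x)\<^sup>2" for x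
      using zero_le_power2[of "\<kappa> * u x + sin (x $ 2) * p x"] by (simp add: power2_eq_square algebra_simps)
  qed
  also have "\<dots> = \<kappa>\<^sup>2 / 2 * ?U + 1 / 2 * integral (Omega a) (\<lambda>x. (sin (x $ 2) * p x)\<^sup>2)"
    by (subst integral_add) (auto intro!: int ci)
  finally have C: "\<kappa>\<^sup>2 * ?U \<le> integral (Omega a) (\<lambda>x. (sin (x $ 2) * p x)\<^sup>2)" by simp
  have "integral (Omega a) (\<lambda>x. (p x)\<^sup>2) \<le> \<kappa>\<^sup>2 * ?U"
  proof -
    have "a\<^sup>2 * integral (Omega a) (\<lambda>x. (p x)\<^sup>2) \<le> ?U"
      using integral_partial_1_le_laplacian[OF a \<phi>_C2 \<phi>_per] by (simp add: p_\<phi> lap_\<phi> power2_eq_square)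
    then have "\<kappa>\<^sup>2 * (a\<^sup>2 * integral (Omega a) (\<lambda>x. (p x)\<^sup>2)) \<le> \<kappa>\<^sup>2 * ?U"
      by (intro mult_left_mono) auto
    moreover have "1 * integral (Omega a) (\<lambda>x. (p x)\<^sup>2) \<le> (\<kappa>\<^sup>2 * a\<^sup>2) * integral (Omega a) (\<lambda>x. (p x)\<^sup>2)"
    proof (intro mult_right_mono integral_nonneg int ci)
      have "1 \<le> \<kappa> * a" using \<kappa> a by (simp add: field_simps)
      then show "1 \<le> \<kappa>\<^sup>2 * a\<^sup>2" using one_le_power[of "\<kappa> * a" 2] by (simp add: power_mult_distrib)
    qed auto
    ultimately show ?thesis by (simp add: mult.assoc)
  qed
  with C have "integral (Omega a) (\<lambda>x. (p x)\<^sup>2) - integral (Omega a) (\<lambda>x. (sin (x $ 2) * p x)\<^sup>2) \<le> 0" by simp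
  also have "integral (Omega a) (\<lambda>x. (p x)\<^sup>2) - integral (Omega a) (\<lambda>x. (sin (x $ 2) * p x)\<^sup>2)
      = integral (Omega a) (\<lambda>x. (p x)\<^sup>2 - (sin (x $ 2) * p x)\<^sup>2)"
    by (intro integral_diff[symmetric] int ci)
  also have "(\<lambda>x. (p x)\<^sup>2 - (sin (x $ 2) * p x)\<^sup>2) = (\<lambda>x. (cos (x $ 2) * p x)\<^sup>2)"
    by (simp add: fun_eq_iff power_mult_distrib cos_squared_eq algebra_simps)
  finally have cos_int: "integral (Omega a) (\<lambda>x. (cos (x $ 2) * p x)\<^sup>2) \<le> 0" .
  have cos_per: "biperiodic a (\<lambda>x. (cos (x $ 2) * p x)\<^sup>2)" using p_per by (simp add: biperiodic_def)
  have cos_cont: "continuous_on UNIV (\<lambda>x. (cos (x $ 2) * p x)\<^sup>2)" by (intro ci)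
  have "(cos (x $ 2) * p x)\<^sup>2 = 0" for x
    by (rule integral_Omega_eq_0D[OF a cos_cont cos_per zero_le_power2 cos_int])
  then have cos_p: "cos (x $ 2) * p x = 0" for x by simp
  have p0: "p x = 0" for x
  proof (cases "cos (x $ 2) = 0")
    \<comment> \<open>Where the cosine vanishes, the identity \<open>cos_p\<close> is differentiated
      in \<open>x\<^sub>2\<close>: only the sine term survives, and the sine is nonzero
      there.\<close>
    case True
    have c: "(\<lambda>x::real^2. cos (x $ 2)) differentiable (at x)" "partial 2 (\<lambda>x. cos (x $ 2)) = (\<lambda>x. - sin (x $ 2))"
      by (rule partial_fun_2; auto intro!: derivative_eq_intros)+
    have "partial 2 (\<lambda>x. cos (x $ 2) * p x) x = 0" by (simp add: cos_p partial_const)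
    then have "sin (x $ 2) * p x = 0"
      using partial_mult[OF c(1), of p 2] \<psi>(2)[of 1 x] True by (simp add: c(2) p_def)
    moreover have "sin (x $ 2) \<noteq> 0" using sin_cos_squared_add[of "x $ 2"] True by auto
    ultimately show ?thesis by simp
  qed (use cos_p[of x] in simp)
  have "\<kappa>\<^sup>2 * ?U \<le> 0" using C by (simp add: p0)
  then have U: "?U \<le> 0" using \<kappa>_pos by (simp add: mult_le_0_iff)
  have uu: "continuous_on UNIV (\<lambda>x. u x * u x)" "biperiodic a (\<lambda>x. u x * u x)"
    using u_per u_cont by (auto simp: biperiodic_def intro!: continuous_on_mult)
  have "u x * u x = 0" for x
    by (rule integral_Omega_eq_0D[OF a uu zero_le_square U])
  then have u0: "u x = 0" for x by simp
  have "integral (Omega a) \<phi> = integral (Omega a) \<psi> - integral (Omega a) psi_star"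
    unfolding \<phi>_def by (intro integral_diff int \<psi>(3) Ck_2D(3)[OF Ck_2_psi_star])
  then have "integral (Omega a) \<phi> = 0"
    using mean integral_cos_eq_0[OF a] by (simp add: psi_star_def[abs_def])
  then have "\<phi> x = 0" for x
    using biperiodic_harmonic_eq_0[OF a \<phi>_C2 \<phi>_per] by (simp add: p_\<phi> p0 lap_\<phi> u0)
  then show ?thesis by (simp add: \<phi>_def fun_eq_iff)
qed

lemma laplacian_psi_star_C_per: "a > 0 \<Longrightarrow> laplacian psi_star \<in> C_per 1 a"
proof -
  assume a: "a > 0"
  have d: "(\<lambda>x::real^2. - cos (x $ 2)) differentiable (at x)" "partial 1 (\<lambda>x. - cos (x $ 2)) = (\<lambda>x. 0)"
    "partial 2 (\<lambda>x. - cos (x $ 2)) = (\<lambda>x. sin (x $ 2))" for x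
    by (rule partial_fun_2; auto intro!: derivative_eq_intros)+
  have "continuous_on UNIV (partial i (\<lambda>x. - cos (x $ 2)))" for i
    using exhaust_2[of i] by (auto simp: d intro!: continuous_intros)
  then show ?thesis
    using integral_cos_eq_0[OF a] d(1) by (simp add: laplacian_psi_star C_per_def)
qed

theorem theorem2p1:
  fixes a \<kappa> :: real and \<psi> :: "real^2 \<Rightarrow> real"
  assumes "a > 0"
    and "\<kappa> \<ge> 1 / a"
    and "\<psi> \<in> C_per 2 a"
    and "C0_norm a (\<lambda>x. hessian \<psi> x - hessian psi_star x) < \<kappa>\<^sup>2 / 4"
    and "C0_norm a (\<lambda>x. hessian \<psi> x - hessian psi_star x) \<le> 1 / 2"
    and "lagrangian_solution \<kappa> \<psi> \<or> euler_solution \<kappa> \<psi>"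
  shows "laplacian \<psi> \<in> C_per 1 a \<and> \<psi> = psi_star"
proof -
  have C2: "Ck 2 \<psi>" and per: "biperiodic a \<psi>" and mean: "integral (Omega a) \<psi> = 0"
    using assms(3) by (auto simp: C_per_def biperiodic_def)
  have "\<kappa> > 0" using assms(1,2) by (meson divide_pos_pos less_le_trans zero_less_one)
  then have "euler_solution \<kappa> \<psi>"
    using assms(6) lagrangian_imp_euler[OF assms(1) _ C2 per] by blast
  then have "\<psi> = psi_star"
    by (rule euler_solution_unique[OF assms(1,2) C2 per mean])
  then show ?thesis using laplacian_psi_star_C_per[OF assms(1)] by simp
qed

end
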